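(* The center $Z(\triangle)$ of the universal Askey--Wilson algebra $\triangle$ is the commutative $\mathbb F$-algebra generated by $T_{\bar d}(A)$, $T_{\bar d}(B)$, $T_{\bar d}(C)$, $\alpha$, $\beta$, $\gamma$, $\Omega$ subject to the single relation $$ q^{\bar d}\,\Phi_{\bar d}^{(0)}(\alpha,\beta,\gamma;\Omega)\, T_{\bar d}(A) +q^{\bar d}\,\Phi_{\bar d}^{(1)}(\alpha,\beta,\gamma;\Omega)\, T_{\bar d}(B) +q^{\bar d}\,\Phi_{\bar d}^{(2)}(\alpha,\beta,\gamma;\Omega)\, T_{\bar d}(C) $$ $$ = q^{\bar d}\, T_{\bar d}(A) T_{\bar d}(B) T_{\bar d}(C)+T_{\bar d}(A)^2+T_{\bar d}(B)^2+T_{\bar d}(C)^2+\Psi_{\bar d}(\alpha,\beta,\gamma;\Omega)-2 . $$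
   Context: $\mathbb F$ is an arbitrary field and $q\in\mathbb F$ is a primitive $d$-th root of unity ($d\ge 1$ an integer). Put $\bar d=d$ if $d$ is odd and $\bar d=d/2$ if $d$ is even. $\mathbb N$ is the set of nonnegative integers. The universal Askey--Wilson algebra $\triangle$ is the associative unital $\mathbb F$-algebra with generators $A,B,C,\alpha,\beta,\gamma$ and relations: $\alpha,\beta,\gamma$ are central, and $CB=q^2BC+q(q^2-q^{-2})A-q(q-q^{-1})\alpha$, $CA=q^{-2}AC-q^{-1}(q^2-q^{-2})B+q^{-1}(q-q^{-1})\beta$, $BA=q^2AB+q(q^2-q^{-2})C-q(q-q^{-1})\gamma$. The normalized Casimir element is $\Omega=q^2+q^{-2}-qABC-q^2A^2-q^{-2}B^2-q^2C^2+qA\alpha+q^{-1}B\beta+qC\gamma$ (a central element of $\triangle$). $T_n(X)$ ($n\in\mathbb N$) are the normalized Chebyshev polynomials of the first kind over $\mathbb Z$: $T_0(X)=2$, $T_1(X)=X$, $T_{n+1}(X)=XT_n(X)-T_{n-1}(X)$ for $n\ge1$. For $n\in\mathbb N$ and $i\in\mathbb Z/3\mathbb Z$ (indices of $X_j$ read mod 3) put $\phi_n^{(i)}=T_n(X)T_n(X_i)+T_n(X_{i+1})T_n(X_{i+2})$, $\phi_n=\phi_n^{(0)}$, and $\psi_n=T_{2n}(X)+T_n(X_0)^2+T_n(X_1)^2+T_n(X_2)^2+T_n(X)T_n(X_0)T_n(X_1)T_n(X_2)$. For each $n\in\mathbb N$, $\Phi_n(X_0,X_1,X_2;X)$ and $\Psi_n(X_0,X_1,X_2;X)$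 denote the unique polynomials over $\mathbb Z$ such that $\Phi_n(\phi_m^{(0)},\phi_m^{(1)},\phi_m^{(2)};\psi_m)=\phi_{mn}$ and $\Psi_n(\phi_m^{(0)},\phi_m^{(1)},\phi_m^{(2)};\psi_m)=\psi_{mn}$ for all $m\in\mathbb N$. $\Phi_n^{(i)}$ is obtained from $\Phi_n$ by replacing $X_j$ by $X_{i+j}$ for all $j\in\mathbb Z/3\mathbb Z$ and fixing $X$. Polynomials over $\mathbb Z$ are evaluated in $\mathbb F$-algebras via the ring homomorphism $\mathbb Z\to\mathbb F$. *)

theory Defs
  imports
    "HOL-Library.Poly_Mapping"
    "HOL-Library.Numeral_Type"
    "HOL-Computational_Algebra.Polynomial"
    "HOL-Algebra.Algebraic_Closure_Type"
begin

section \<open>Roots of unity\<close>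

definition primitive_root_of_unity :: "nat \<Rightarrow> 'a::field \<Rightarrow> bool" where
  "primitive_root_of_unity d q \<longleftrightarrow> d \<ge> 1 \<and> q ^ d = 1 \<and> (\<forall>k. 0 < k \<and> k < d \<longrightarrow> q ^ k \<noteq> 1)"

definition dbar :: "nat \<Rightarrow> nat" where
  "dbar d = (if odd d then d else d div 2)"


section \<open>Commutative multivariate polynomials\<close>

text \<open>The monoid algebra \<open>('v \<Rightarrow>\<^sub>0 nat) \<Rightarrow>\<^sub>0 'a\<close> is the ring of polynomials over \<open>'a\<close> in
  variables indexed by \<open>'v\<close>.\<close>

type_synonym ('v, 'a) mpol = "('v \<Rightarrow>\<^sub>0 nat) \<Rightarrow>\<^sub>0 'a"

definition mvar :: "'v \<Rightarrow> ('v, 'a::zero_neq_one) mpol" where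
  "mvar v = Poly_Mapping.single (Poly_Mapping.single v 1) 1"

definition mconst :: "'a::zero \<Rightarrow> ('v, 'a) mpol" where
  "mconst c = Poly_Mapping.single 0 c"

definition mpol_eval :: "('v \<Rightarrow> 'b::comm_ring_1) \<Rightarrow> ('v, int) mpol \<Rightarrow> 'b" where
  "mpol_eval \<sigma> p =
     (\<Sum>m\<in>Poly_Mapping.keys p. of_int (Poly_Mapping.lookup p m) *
        (\<Prod>v\<in>Poly_Mapping.keys m. \<sigma> v ^ Poly_Mapping.lookup m v))"


section \<open>Chebyshev polynomials\<close>

fun cheb_poly :: "nat \<Rightarrow> int poly" where
  "cheb_poly 0 = [:2:]"
| "cheb_poly (Suc 0) = [:0, 1:]"
| "cheb_poly (Suc (Suc n)) = [:0, 1:] * cheb_poly (Suc n) - cheb_poly n"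

text \<open>The library's \<open>poly\<close> requires a commutative ring; here the argument may
  also lie in a noncommutative one.\<close>

definition cheb :: "nat \<Rightarrow> 'b::ring_1 \<Rightarrow> 'b" where
  "cheb n x = (\<Sum>i\<le>Polynomial.degree (cheb_poly n). of_int (Polynomial.coeff (cheb_poly n) i) * x ^ i)"


section \<open>The polynomials $\phi_n$, $\psi_n$, $\Phi_n$, $\Psi_n$\<close>

text \<open>The variables $X$ (\<open>XX\<close>) and $X_i$ (\<open>XI i\<close>). In the numeral type \<^typ>\<open>3\<close> arithmetic is modulo 3.\<close>

datatype xvar = XX | XI 3

definition phi :: "nat \<Rightarrow> 3 \<Rightarrow> (xvar, int) mpol" where
  "phi n i = cheb n (mvar XX) * cheb n (mvar (XI i))
     + cheb n (mvar (XI (i + 1))) * cheb n (mvar (XI (i + 2)))"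

definition psi :: "nat \<Rightarrow> (xvar, int) mpol" where
  "psi n = cheb (2 * n) (mvar XX)
     + cheb n (mvar (XI 0)) ^ 2 + cheb n (mvar (XI 1)) ^ 2 + cheb n (mvar (XI 2)) ^ 2
     + cheb n (mvar XX) * cheb n (mvar (XI 0)) * cheb n (mvar (XI 1)) * cheb n (mvar (XI 2))"

text \<open>\<open>args a b c w\<close> is the substitution written $(a, b, c; w)$ for $(X_0, X_1, X_2; X)$.\<close>

definition args :: "'b \<Rightarrow> 'b \<Rightarrow> 'b \<Rightarrow> 'b \<Rightarrow> xvar \<Rightarrow> 'b" where
  "args a b c w v = (case v of XX \<Rightarrow> w | XI j \<Rightarrow> if j = 0 then a else if j = 1 then b else c)"

definition Phi :: "nat \<Rightarrow> (xvar, int) mpol" where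
  "Phi n = (THE P. \<forall>m. mpol_eval (args (phi m 0) (phi m 1) (phi m 2) (psi m)) P = phi (m * n) 0)"

definition Psi :: "nat \<Rightarrow> (xvar, int) mpol" where
  "Psi n = (THE P. \<forall>m. mpol_eval (args (phi m 0) (phi m 1) (phi m 2) (psi m)) P = psi (m * n))"

definition Phi_shift :: "nat \<Rightarrow> 3 \<Rightarrow> (xvar, int) mpol" where
  "Phi_shift n i = mpol_eval (\<lambda>v. case v of XX \<Rightarrow> mvar XX | XI j \<Rightarrow> mvar (XI (i + j))) (Phi n)"


section \<open>Free associative algebras\<close>

text \<open>The free monoid on \<open>'x\<close>, written additively so that the convolution product of
  \<open>_ \<Rightarrow>\<^sub>0 _\<close> applies: \<open>'x word \<Rightarrow>\<^sub>0 'a\<close> is the free associative unital algebra on \<open>'x\<close>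
  over \<open>'a\<close>.\<close>

datatype 'x word = Word (letters: "'x list")

instantiation word :: (type) monoid_add
begin

definition zero_word :: "'a word" where
  "0 = Word []"

definition plus_word :: "'a word \<Rightarrow> 'a word \<Rightarrow> 'a word" where
  "u + v = Word (letters u @ letters v)"

instance
  by standard (simp_all add: zero_word_def plus_word_def)

end

definition fvar :: "'x \<Rightarrow> 'x word \<Rightarrow>\<^sub>0 'a::zero_neq_one" where
  "fvar x = Poly_Mapping.single (Word [x]) 1"

definition fconst :: "'a::zero \<Rightarrow> 'x word \<Rightarrow>\<^sub>0 'a" where
  "fconst c = Poly_Mapping.single 0 c"


section \<open>The universal Askey--Wilson algebra\<close>

datatype aw_gen = GenA | GenB | GenC | GenAlpha | GenBeta | GenGamma

type_synonym 'a aw_free = "aw_gen word \<Rightarrow>\<^sub>0 'a"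

definition aw_relators :: "'a::field \<Rightarrow> 'a aw_free set" where
  "aw_relators q =
    (let A = fvar GenA; B = fvar GenB; C = fvar GenC;
         \<alpha> = fvar GenAlpha; \<beta> = fvar GenBeta; \<gamma> = fvar GenGamma;
         p = inverse q
     in {z * fvar x - fvar x * z | z x. z \<in> {\<alpha>, \<beta>, \<gamma>}}
      \<union> {C * B - (fconst (q^2) * B * C + fconst (q * (q^2 - p^2)) * A - fconst (q * (q - p)) * \<alpha>),
         C * A - (fconst (p^2) * A * C - fconst (p * (q^2 - p^2)) * B + fconst (p * (q - p)) * \<beta>),
         B * A - (fconst (q^2) * A * B + fconst (q * (q^2 - p^2)) * C - fconst (q * (q - p)) * \<gamma>)})"

definition aw_ideal :: "'a::field \<Rightarrow> 'a aw_free set" where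
  "aw_ideal q = Idl\<^bsub>ring_of_type_algebra\<^esub> (aw_relators q)"

definition AW :: "'a::field \<Rightarrow> 'a aw_free set ring" where
  "AW q = ring_of_type_algebra Quot (aw_ideal q)"

definition aw_class :: "'a::field \<Rightarrow> 'a aw_free \<Rightarrow> 'a aw_free set" where
  "aw_class q x = aw_ideal q +>\<^bsub>ring_of_type_algebra\<^esub> x"

definition casimir :: "'a::field \<Rightarrow> 'a aw_free" where
  "casimir q =
    (let A = fvar GenA; B = fvar GenB; C = fvar GenC;
         \<alpha> = fvar GenAlpha; \<beta> = fvar GenBeta; \<gamma> = fvar GenGamma;
         p = inverse q
     in fconst (q^2) + fconst (p^2) - fconst q * A * B * C
        - fconst (q^2) * A^2 - fconst (p^2) * B^2 - fconst (q^2) * C^2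
        + fconst q * A * \<alpha> + fconst p * B * \<beta> + fconst q * C * \<gamma>)"

definition center_ring :: "('a, 'b) ring_scheme \<Rightarrow> ('a, 'b) ring_scheme" where
  "center_ring R = R\<lparr>carrier := {z \<in> carrier R. \<forall>x\<in>carrier R. z \<otimes>\<^bsub>R\<^esub> x = x \<otimes>\<^bsub>R\<^esub> z}\<rparr>"


section \<open>The presentation of the center\<close>

text \<open>Names of the seven generators of the center, as variables of a commutative polynomial
  ring, and the defining relation as an element of that ring (left-hand side minus
  right-hand side).\<close>

datatype center_gen = ZTA | ZTB | ZTC | ZAlpha | ZBeta | ZGamma | ZOmega

definition center_relator :: "'a::field \<Rightarrow> nat \<Rightarrow> (center_gen, 'a) mpol" where
  "center_relator q n =
    (let a = mvar ZTA; b = mvar ZTB; c = mvar ZTC; s = mconst (q ^ n);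
         \<sigma> = args (mvar ZAlpha) (mvar ZBeta) (mvar ZGamma) (mvar ZOmega)
     in (s * mpol_eval \<sigma> (Phi_shift n 0) * a
         + s * mpol_eval \<sigma> (Phi_shift n 1) * b
         + s * mpol_eval \<sigma> (Phi_shift n 2) * c)
        - (s * a * b * c + a^2 + b^2 + c^2 + mpol_eval \<sigma> (Psi n) - 2))"

definition center_rel_ideal :: "'a::field \<Rightarrow> nat \<Rightarrow> (center_gen, 'a) mpol set" where
  "center_rel_ideal q n = Idl\<^bsub>ring_of_type_algebra\<^esub> {center_relator q n}"

definition center_pres :: "'a::field \<Rightarrow> nat \<Rightarrow> (center_gen, 'a) mpol set ring" where
  "center_pres q n = ring_of_type_algebra Quot (center_rel_ideal q n)"

definition center_pres_class ::
    "'a::field \<Rightarrow> nat \<Rightarrow> (center_gen, 'a) mpol \<Rightarrow> (center_gen, 'a) mpol set" where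
  "center_pres_class q n x = center_rel_ideal q n +>\<^bsub>ring_of_type_algebra\<^esub> x"

end

theory Submission
  imports Defs "HOL-Library.Product_Plus"
begin

text \<open>The algebra acts on sequences over the Laurent polynomials in $a, b, c, \lambda, \eta$ by
  tridiagonal operators, obtained from Terwilliger's equitable generators $x, y, z$ of $U_q(sl_2)$: for
  instance $A$ acts as $a x + a^{-1} y + b c^{-1} q^{-1} (1 - y x)$, while
  $\alpha = \phi_1^{(0)}$ and $\Omega = \psi_1$ at $X = \lambda + \lambda^{-1}$, $X_0 = a + a^{-1}$, and so on.
  Leading terms show that the monomials $A^i B^j C^k \alpha^r \beta^s \gamma^t$ stay independent, hence the
  representation is faithful. For a pair with $x y = p y x + 1 - p$, $p$ a primitive $n$-th root of unity,
  $T_n(y + x + t (1 - y x)) = y^n + x^n + t^n (1 - y^n x^n)$; so $T_n(A), T_n(B), T_n(C)$ act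
  as $A, B, C$ do after raising all parameters to the $n$-th power and replacing $q$ by $q^n = \pm 1$. They are
  central, and the relation between them is the Casimir identity at $q^n$. Finally, a monomial
  $A^i B^j C^k$ leads a central element only if $i \equiv j \equiv k$ modulo $n$, and
  $T_n(A)^i T_n(B)^j T_n(C)^k \Omega^l$ with $\min(i, j, k) = 0$ has leading monomial
  $A^{ni+l} B^{nj+l} C^{nk+l}$; this gives generation of the center and the completeness of the relation.\<close>

text \<open>The identity for T_n resists induction on n, since p has order exactly n and no
  analogous identity is at hand for T_k with k < n. It is therefore derived from continuous
  q-Hermite polynomials, whose normally ordered expansion holds in every degree; in degree n the
  inner Gaussian binomials vanish and the q-Hermite polynomial turns into T_n. The model is set up
  over any commutative ring and with an arbitrary step, so that the operators built from n-th powers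
  are a second instance of the same locale: centrality then reduces to periodicity of coefficients.
  The variable \<eta> occurs at index i together with the factor q^(2i), so leading terms commute
  only up to powers of q, and these powers carry the congruences satisfied by central elements.
  Since \<open>Phi\<close> and \<open>Psi\<close> are definite descriptions, existence over the
  integers must be shown as well as uniqueness; the latter comes from the algebraic independence of
  \<alpha>, \<beta>, \<gamma>, \<Omega> in the model over the rationals.\<close>

abbreviation (input) lookup :: "('m \<Rightarrow>\<^sub>0 'k::zero) \<Rightarrow> 'm \<Rightarrow> 'k" where
  "lookup \<equiv> Poly_Mapping.lookup"

abbreviation (input) keys :: "('m \<Rightarrow>\<^sub>0 'k::zero) \<Rightarrow> 'm set" where
  "keys \<equiv> Poly_Mapping.keys"

abbreviation (input) single :: "'m \<Rightarrow> 'k \<Rightarrow> ('m \<Rightarrow>\<^sub>0 'k::zero)" where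
  "single \<equiv> Poly_Mapping.single"

section \<open>Ring homomorphisms and evaluation of monoid algebras\<close>

locale unital_hom =
  fixes f :: "'a::ring_1 \<Rightarrow> 'b::ring_1"
  assumes one: "f 1 = 1"
    and add: "f (x + y) = f x + f y"
    and mult: "f (x * y) = f x * f y"
begin

lemma zero: "f 0 = 0"
  using add[of 0 0] by simp

lemma uminus: "f (- x) = - f x"
  using add[of x "- x"] by (simp add: zero eq_neg_iff_add_eq_0 add.commute)

lemma diff: "f (x - y) = f x - f y"
  using add[of x "- y"] by (simp add: uminus)

lemma sum: "f (\<Sum>i\<in>I. g i) = (\<Sum>i\<in>I. f (g i))"
  by (induction I rule: infinite_finite_induct) (simp_all add: zero add)

lemma power: "f (x ^ n) = f x ^ n"
  by (induction n) (simp_all add: one mult)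

lemma of_nat: "f (of_nat n) = of_nat n"
  by (induction n) (simp_all add: zero one add)

lemma of_int: "f (of_int k) = of_int k"
  by (cases k) (simp_all add: of_nat diff uminus one add)

lemma numeral: "f (numeral n) = numeral n"
  using of_nat[of "numeral n"] by simp

lemma prod_list: "f (prod_list xs) = prod_list (map f xs)"
  by (induction xs) (simp_all add: one mult)

lemmas simps = zero one add mult uminus diff power of_int numeral

end

lemma unital_hom_comp: "unital_hom f \<Longrightarrow> unital_hom g \<Longrightarrow> unital_hom (\<lambda>x. f (g x))"
  by (simp add: unital_hom_def)

lemma unital_hom_of_int: "unital_hom (of_int :: int \<Rightarrow> 'a::ring_1)"
  by unfold_locales simp_all

text \<open>The map \<open>\<mu>\<close> need not be multiplicative. It is a monoid homomorphism
  when polynomials or free words are evaluated, but the same sum also expands along ordered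
  monomials, whose products are not again ordered monomials.\<close>

definition ma_eval :: "('k::ring_1 \<Rightarrow> 'r::ring_1) \<Rightarrow> ('m \<Rightarrow> 'r) \<Rightarrow> ('m \<Rightarrow>\<^sub>0 'k) \<Rightarrow> 'r" where
  "ma_eval \<iota> \<mu> p = (\<Sum>m\<in>keys p. \<iota> (lookup p m) * \<mu> m)"

lemma poly_mapping_sum_single:
  fixes p :: "'m \<Rightarrow>\<^sub>0 'b::comm_monoid_add"
  shows "p = (\<Sum>m\<in>keys p. single m (lookup p m))"
proof (rule poly_mapping_eqI)
  fix k
  have "lookup (\<Sum>m\<in>keys p. single m (lookup p m)) k
      = (\<Sum>m\<in>keys p. if m = k then lookup p m else 0)"
    by (simp add: lookup_sum lookup_single when_def)
  also have "\<dots> = lookup p k"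
    by (simp add: in_keys_iff)
  finally show "lookup p k = lookup
      (\<Sum>m\<in>keys p. single m (lookup p m)) k"
    by simp
qed

lemma poly_mapping_induct_sum [case_names zero single add]:
  fixes p :: "'m \<Rightarrow>\<^sub>0 'b::comm_monoid_add"
  assumes "P 0" "\<And>m c. P (single m c)"
    and "\<And>x y. P x \<Longrightarrow> P y \<Longrightarrow> P (x + y)"
  shows "P p"
proof -
  have "P (\<Sum>m\<in>S. single m (lookup p m))" if "finite S" for S
    using that by (induction S rule: finite_induct) (use assms in auto)
  then show ?thesis
    by (subst poly_mapping_sum_single) simp
qed

lemma ma_eval_superset:
  assumes "\<iota> 0 = 0" "finite S" "keys p \<subseteq> S"
  shows "ma_eval \<iota> \<mu> p = (\<Sum>m\<in>S. \<iota> (lookup p m) * \<mu> m)"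
  unfolding ma_eval_def using assms
  by (intro sum.mono_neutral_left) (auto simp: in_keys_iff)

context
  fixes \<iota> :: "'k::ring_1 \<Rightarrow> 'r::ring_1"
  assumes \<iota>: "unital_hom \<iota>"
begin

interpretation \<iota>: unital_hom \<iota> by (fact \<iota>)

lemma ma_eval_single: "ma_eval \<iota> \<mu> (single m c) = \<iota> c * \<mu> m"
  by (simp add: ma_eval_def \<iota>.zero)

lemma ma_eval_zero: "ma_eval \<iota> \<mu> 0 = 0"
  by (simp add: ma_eval_def)

lemma ma_eval_add: "ma_eval \<iota> \<mu> (x + y) = ma_eval \<iota> \<mu> x + ma_eval \<iota> \<mu> y"
proof -
  let ?S = "keys x \<union> keys y"
  have "ma_eval \<iota> \<mu> (x + y) = (\<Sum>m\<in>?S. \<iota> (lookup (x + y) m) * \<mu> m)"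
    by (rule ma_eval_superset) (use keys_add[of x y] in \<open>auto simp: \<iota>.zero\<close>)
  also have "\<dots> = ma_eval \<iota> \<mu> x + ma_eval \<iota> \<mu> y"
    by (simp add: ma_eval_superset[of \<iota> ?S x] ma_eval_superset[of \<iota> ?S y] \<iota>.zero
        lookup_add \<iota>.add distrib_right sum.distrib)
  finally show ?thesis .
qed

lemma unital_hom_ma_eval:
  fixes \<mu> :: "'m::monoid_add \<Rightarrow> 'r"
  assumes central: "\<And>m c. \<mu> m * \<iota> c = \<iota> c * \<mu> m"
    and \<mu>0: "\<mu> 0 = 1" and \<mu>_add: "\<And>m n. \<mu> (m + n) = \<mu> m * \<mu> n"
  shows "unital_hom (ma_eval \<iota> \<mu>)"
proof
  show "ma_eval \<iota> \<mu> 1 = 1"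
    using ma_eval_single[of \<mu> 0 1] by (simp add: \<mu>0 \<iota>.one)
  show "ma_eval \<iota> \<mu> (x + y) = ma_eval \<iota> \<mu> x + ma_eval \<iota> \<mu> y" for x y
    by (rule ma_eval_add)
  have single: "ma_eval \<iota> \<mu> (single m c * single n d)
      = (\<iota> c * \<mu> m) * (\<iota> d * \<mu> n)" for m n c d
  proof -
    have "(\<iota> c * \<mu> m) * (\<iota> d * \<mu> n) = \<iota> c * (\<mu> m * \<iota> d) * \<mu> n"
      by (simp add: mult.assoc)
    then show ?thesis
      by (simp add: mult_single ma_eval_single \<iota>.mult \<mu>_add central mult.assoc)
  qed
  have "ma_eval \<iota> \<mu> (single m c * y) = (\<iota> c * \<mu> m) * ma_eval \<iota> \<mu> y" for m c y
    by (induction y rule: poly_mapping_induct_sum)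
       (simp_all add: single ma_eval_single ma_eval_add ma_eval_zero distrib_left)
  then show "ma_eval \<iota> \<mu> (x * y) = ma_eval \<iota> \<mu> x * ma_eval \<iota> \<mu> y" for x y
    by (induction x rule: poly_mapping_induct_sum)
       (simp_all add: ma_eval_single ma_eval_add ma_eval_zero distrib_right)
qed

end

section \<open>Chebyshev polynomials\<close>

lemma cheb_eq_sum:
  assumes "Polynomial.degree (cheb_poly n) \<le> N"
  shows "cheb n x = (\<Sum>i\<le>N. of_int (Polynomial.coeff (cheb_poly n) i) * x ^ i)"
  unfolding cheb_def using assms
  by (intro sum.mono_neutral_left) (auto simp: coeff_eq_0 not_le)

lemma cheb_0: "cheb 0 x = 2"
  by (simp add: cheb_def)

lemma cheb_1: "cheb (Suc 0) x = x"
  by (simp add: cheb_def)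

lemma cheb_Suc_Suc: "cheb (Suc (Suc n)) x = x * cheb (Suc n) x - cheb n x"
proof -
  define N where "N = Polynomial.degree (cheb_poly n) + Polynomial.degree (cheb_poly (Suc n))
    + Polynomial.degree (cheb_poly (Suc (Suc n)))"
  have "cheb (Suc (Suc n)) x
      = (\<Sum>i\<le>Suc N. of_int (Polynomial.coeff ([:0, 1:] * cheb_poly (Suc n)) i) * x ^ i)
        - (\<Sum>i\<le>Suc N. of_int (Polynomial.coeff (cheb_poly n) i) * x ^ i)"
    by (subst cheb_eq_sum[of _ "Suc N"]) (simp_all add: N_def left_diff_distrib sum_subtractf)
  also have "(\<Sum>i\<le>Suc N. of_int (Polynomial.coeff ([:0, 1:] * cheb_poly (Suc n)) i) * x ^ i)
      = x * (\<Sum>i\<le>N. of_int (Polynomial.coeff (cheb_poly (Suc n)) i) * x ^ i)"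
  proof -
    have "of_int k * (x * y) = x * (of_int k * y)" for k y
      by (metis mult.assoc mult_of_int_commute)
    then show ?thesis
      by (subst sum.atMost_Suc_shift) (simp add: sum_distrib_left)
  qed
  also have "(\<Sum>i\<le>N. of_int (Polynomial.coeff (cheb_poly (Suc n)) i) * x ^ i) = cheb (Suc n) x"
    by (rule cheb_eq_sum[symmetric]) (simp add: N_def)
  also have "(\<Sum>i\<le>Suc N. of_int (Polynomial.coeff (cheb_poly n) i) * x ^ i) = cheb n x"
    by (rule cheb_eq_sum[symmetric]) (simp add: N_def)
  finally show ?thesis .
qed

lemmas cheb_rec = cheb_0 cheb_1 cheb_Suc_Suc

lemma (in unital_hom) cheb: "f (cheb n x) = cheb n (f x)"
  by (induction n rule: cheb_poly.induct) (simp_all add: cheb_rec simps)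

lemma cheb_plus_inverse:
  fixes u v :: "'a::ring_1"
  assumes "u * v = 1" "v * u = 1"
  shows "cheb n (u + v) = u ^ n + v ^ n"
proof (induction n rule: cheb_poly.induct)
  case (3 n)
  have "u * v ^ Suc n = v ^ n" "v * u ^ Suc n = u ^ n"
    using assms by (simp_all flip: mult.assoc)
  with 3 show ?case
    by (simp add: cheb_rec algebra_simps)
qed (simp_all add: cheb_rec)

section \<open>Gaussian binomial coefficients\<close>

text \<open>Defined by the Pascal rule instead of quotients of factors \<open>1 - p ^ k\<close>,
  which may vanish at the roots of unity of interest.\<close>

fun qb :: "'a::comm_ring_1 \<Rightarrow> nat \<Rightarrow> nat \<Rightarrow> 'a" where
  "qb p n 0 = 1"
| "qb p 0 (Suc k) = 0"
| "qb p (Suc n) (Suc k) = qb p n k + p ^ Suc k * qb p n (Suc k)"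

lemma qb_eq_0: "n < k \<Longrightarrow> qb p n k = 0"
  by (induction p n k rule: qb.induct) auto

lemma qb_self: "qb p n n = 1"
  by (induction n) (simp_all add: qb_eq_0)

text \<open>The ratio of neighbouring coefficients, cleared of denominators. In the induction on
  \<open>k + r = Suc n\<close> both sides turn out to be
  \<open>qb p n k * (1 - p ^ Suc n)\<close>.\<close>

lemma qb_step: "qb p (k + r) (Suc k) * (1 - p ^ Suc k) = qb p (k + r) k * (1 - p ^ r)"
proof (induction "k + r" arbitrary: k r)
  case 0
  then show ?case by simp
next
  case (Suc n)
  show ?case
  proof (cases k)
    case 0
    then obtain r' where r: "r = Suc r'" "n = r'" using Suc.hyps by (cases r) auto
    have "qb p r' (Suc 0) * (1 - p) = 1 - p ^ r'"
      using Suc.hyps(1)[of 0 r'] r by simp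
    have "(1 + p * qb p r' (Suc 0)) * (1 - p) = (1 - p) + p * (qb p r' (Suc 0) * (1 - p))"
      by (simp add: algebra_simps)
    also have "\<dots> = 1 - p ^ Suc r'"
      unfolding \<open>qb p r' (Suc 0) * (1 - p) = 1 - p ^ r'\<close> by (simp add: algebra_simps)
    finally show ?thesis using 0 r by simp
  next
    case (Suc j)
    then have n: "n = j + r" using Suc.hyps(2) by simp
    let ?X = "qb p n (Suc j)"
    have IH1: "?X * (1 - p ^ Suc j) = qb p n j * (1 - p ^ r)"
      using Suc.hyps(1)[of j r] n by simp
    have IH2: "qb p n (Suc (Suc j)) * (1 - p ^ Suc (Suc j)) = ?X * (1 - p ^ (r - 1))" if "r > 0"
    proof -
      have "n = Suc j + (r - 1)" using n that by simp
      from Suc.hyps(1)[OF this] this show ?thesis by simp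
    qed
    have L: "qb p (Suc n) (Suc (Suc j)) * (1 - p ^ Suc (Suc j)) = ?X * (1 - p ^ Suc n)"
    proof (cases "r = 0")
      case True
      then show ?thesis using n by (simp add: qb_eq_0)
    next
      case False
      then obtain r' where r: "r = Suc r'" by (cases r) auto
      have "qb p (Suc n) (Suc (Suc j)) * (1 - p ^ Suc (Suc j))
          = ?X * (1 - p ^ Suc (Suc j)) + p ^ Suc (Suc j) * (qb p n (Suc (Suc j)) * (1 - p ^ Suc (Suc j)))"
        by (simp add: algebra_simps)
      also have "\<dots> = ?X * (1 - p ^ (Suc (Suc j) + (r - 1)))"
        using False by (subst IH2) (simp_all add: algebra_simps power_add r)
      finally show ?thesis using n by (simp add: r)
    qed
    have "qb p (Suc n) (Suc j) * (1 - p ^ r) = qb p n j * (1 - p ^ r) + p ^ Suc j * ?X * (1 - p ^ r)"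
      by (simp add: algebra_simps)
    also have "\<dots> = ?X * (1 - p ^ Suc n)"
      unfolding IH1[symmetric] unfolding n by (simp add: algebra_simps power_add)
    finally have R: "qb p (Suc n) (Suc j) * (1 - p ^ r) = ?X * (1 - p ^ Suc n)" .
    show ?thesis
      unfolding Suc.hyps(2)[symmetric] unfolding Suc L R ..
  qed
qed

lemma qb_absorb: "qb p (Suc n) (Suc k) * (1 - p ^ Suc k) = (1 - p ^ Suc n) * qb p n k"
proof (cases "k \<le> n")
  case True
  then obtain r where n: "n = k + r" using le_Suc_ex by blast
  have "qb p (Suc n) (Suc k) * (1 - p ^ Suc k)
      = qb p n k * (1 - p ^ Suc k) + p ^ Suc k * (qb p n (Suc k) * (1 - p ^ Suc k))"
    by (simp add: algebra_simps)
  also have "\<dots> = (1 - p ^ Suc n) * qb p n k"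
    unfolding n qb_step by (simp add: algebra_simps power_add)
  finally show ?thesis .
qed (simp add: qb_eq_0)

lemma qb_absorb_comp: "qb p (Suc (k + r)) k * (1 - p ^ Suc r) = (1 - p ^ Suc (k + r)) * qb p (k + r) k"
  using qb_step[of p k "Suc r"] qb_absorb[of p "k + r" k] by simp

text \<open>The form of the Pascal rule that fits appending the last factor
  \<open>1 - p ^ k * z\<close> to a q-shifted factorial.\<close>

lemma qb_pascal': "k \<le> n \<Longrightarrow> qb p (Suc n) (Suc k) = qb p n (Suc k) + p ^ (n - k) * qb p n k"
  using qb_step[of p k "n - k"] by (simp add: algebra_simps)

definition prim_root :: "nat \<Rightarrow> 'a::field \<Rightarrow> bool" where
  "prim_root n p \<longleftrightarrow> n > 0 \<and> p ^ n = 1 \<and> (\<forall>k. 0 < k \<and> k < n \<longrightarrow> p ^ k \<noteq> 1)"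

text \<open>In \<open>qb_absorb\<close> the factor \<open>1 - p ^ n\<close> vanishes, while
  \<open>1 - p ^ k\<close> is invertible.\<close>

lemma qb_prim_root:
  assumes "prim_root n p" "0 < k" "k < n"
  shows "qb p n k = 0"
proof -
  obtain n' k' where nk: "n = Suc n'" "k = Suc k'"
    using assms by (cases n; cases k) auto
  have "qb p n k * (1 - p ^ k) = 0"
    using qb_absorb[of p n' k'] assms(1) by (simp add: nk prim_root_def)
  moreover have "1 - p ^ k \<noteq> 0"
    using assms by (simp add: prim_root_def)
  ultimately show ?thesis by simp
qed

text \<open>The common mechanism of every collapse below: an expansion with Gaussian binomial
  coefficients keeps only its two end terms.\<close>

lemma sum_qb_prim_root:
  fixes \<iota> :: "'a::field \<Rightarrow> 'r::ring_1"
  assumes "prim_root n p" "unital_hom \<iota>"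
  shows "(\<Sum>j\<le>n. \<iota> (qb p n j) * g j) = g 0 + g n"
proof -
  interpret unital_hom \<iota> by fact
  have n: "n > 0" using assms by (simp add: prim_root_def)
  have "(\<Sum>j\<le>n. \<iota> (qb p n j) * g j) = (\<Sum>j\<in>{0, n}. \<iota> (qb p n j) * g j)"
  proof (rule sum.mono_neutral_right)
    show "\<forall>j\<in>{..n} - {0, n}. \<iota> (qb p n j) * g j = 0"
      using qb_prim_root[OF assms(1)] by (auto simp: zero)
  qed auto
  also have "\<dots> = g 0 + g n"
    using n by (simp add: qb_self one)
  finally show ?thesis .
qed

section \<open>q-Hermite polynomials of a q-Weyl pair\<close>

fun hermite :: "('a::comm_ring_1 \<Rightarrow> 'r::ring_1) \<Rightarrow> 'a \<Rightarrow> nat \<Rightarrow> 'r \<Rightarrow> 'r" where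
  "hermite \<iota> p 0 x = 1"
| "hermite \<iota> p (Suc 0) x = x"
| "hermite \<iota> p (Suc (Suc n)) x = x * hermite \<iota> p (Suc n) x - \<iota> (1 - p ^ Suc n) * hermite \<iota> p n x"

text \<open>For p = q^(-2) the relation \<open>weyl\<close> is the equitable relation q x y - q^(-1)
  y x = q - q^(-1). The element \<open>t\<close> is the parameter in front of 1 - y x in the
  Askey-Wilson generators.\<close>

locale q_weyl =
  fixes \<iota> :: "'a::comm_ring_1 \<Rightarrow> 'r::ring_1" and p :: 'a and x y t :: 'r
  assumes \<iota>: "unital_hom \<iota>"
    and central: "\<And>c. x * \<iota> c = \<iota> c * x" "\<And>c. y * \<iota> c = \<iota> c * y" "\<And>c. t * \<iota> c = \<iota> c * t"
    and weyl: "x * y = \<iota> p * y * x + \<iota> (1 - p)"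
    and xt: "x * t = t * x" and yt: "y * t = t * y"
begin

interpretation \<iota>: unital_hom \<iota> by (fact \<iota>)

lemma \<iota>_comm: "\<iota> c * \<iota> d = \<iota> d * \<iota> c"
  by (metis \<iota>.mult mult.commute)

lemma left_comm:
  "x * (\<iota> c * z) = \<iota> c * (x * z)" "y * (\<iota> c * z) = \<iota> c * (y * z)" "t * (\<iota> c * z) = \<iota> c * (t * z)"
  "x * (t * z) = t * (x * z)" "y * (t * z) = t * (y * z)"
  by (simp_all add: central xt yt flip: mult.assoc)

lemma weyl': "x * y = \<iota> p * (y * x) + (1 - \<iota> p)" "x * (y * z) = \<iota> p * (y * (x * z)) + (z - \<iota> p * z)"
  by (simp_all add: weyl \<iota>.simps algebra_simps flip: mult.assoc)

text \<open>The homogeneous Rogers-Szego polynomial in \<open>y\<close> and \<open>t\<close>, given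
  by its three-term recurrence; \<open>hh_closed\<close> recovers the explicit sum.\<close>

fun hh :: "nat \<Rightarrow> 'r" where
  "hh 0 = 1"
| "hh (Suc 0) = y + t"
| "hh (Suc (Suc n)) = (y + t) * hh (Suc n) - \<iota> (1 - p ^ Suc n) * (y * t * hh n)"

text \<open>The q-shifted factorial (t y; p)_j.\<close>

fun nn :: "nat \<Rightarrow> 'r" where
  "nn 0 = 1"
| "nn (Suc j) = nn j * (1 - \<iota> (p ^ j) * (t * y))"

lemma commute_hh:
  assumes "z * y = y * z" "z * t = t * z" "\<And>c. z * \<iota> c = \<iota> c * z"
  shows "z * hh n = hh n * z"
proof (induction n rule: hh.induct)
  case (3 n)
  have "z * hh (Suc (Suc n)) = (y + t) * (z * hh (Suc n)) - \<iota> (1 - p ^ Suc n) * (y * t * (z * hh n))"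
  proof -
    have z: "z * (y * w) = y * (z * w)" "z * (t * w) = t * (z * w)" "z * (\<iota> c * w) = \<iota> c * (z * w)" for c w
      by (simp_all add: assms flip: mult.assoc)
    show ?thesis
      unfolding hh.simps right_diff_distrib distrib_right mult.assoc distrib_left z ..
  qed
  then show ?case by (simp add: 3 algebra_simps)
qed (simp_all add: algebra_simps assms)

lemma commute_nn:
  assumes "z * y = y * z" "z * t = t * z" "\<And>c. z * \<iota> c = \<iota> c * z"
  shows "z * nn n = nn n * z"
proof (induction n)
  case (Suc n)
  have "z * (y * w) = y * (z * w)" "z * (t * w) = t * (z * w)" "z * (\<iota> c * w) = \<iota> c * (z * w)" for c w
    by (simp_all add: assms flip: mult.assoc)
  then have "z * (\<iota> (p ^ n) * (t * y)) = \<iota> (p ^ n) * (t * y) * z"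
    by (simp add: assms mult.assoc)
  then have "z * (1 - \<iota> (p ^ n) * (t * y)) = (1 - \<iota> (p ^ n) * (t * y)) * z"
    by (simp add: algebra_simps)
  then show ?case by (metis Suc mult.assoc nn.simps(2))
qed simp

lemma hh_comm: "\<iota> c * hh n = hh n * \<iota> c" "t * hh n = hh n * t" "y * hh n = hh n * y"
  by (rule commute_hh; simp add: central yt \<iota>_comm)+

lemma nn_comm: "\<iota> c * nn n = nn n * \<iota> c" "t * nn n = nn n * t" "y * nn n = nn n * y"
    "hh m * nn n = nn n * hh m"
  by (rule commute_nn; simp add: central yt \<iota>_comm hh_comm)+

text \<open>The difference quotient (f(y) - f(p y)) / y of f = \<open>hh n\<close>: by absorption it
  is a multiple of the previous Rogers-Szego polynomial.\<close>

fun dd :: "nat \<Rightarrow> 'r" where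
  "dd 0 = 0"
| "dd (Suc n) = \<iota> (1 - p ^ Suc n) * hh n"

lemma hh_Suc: "hh (Suc n) = (y + t) * hh n - y * (t * dd n)"
proof (cases n)
  case (Suc m)
  then show ?thesis
    by (simp add: left_comm mult.assoc)
qed simp

text \<open>A twisted Leibniz rule: the Weyl relation yields x f(y) = f(p y) x + (f(y) - f(p y)) / y
  for polynomials f in y, and \<open>hh n - y * dd n\<close> is \<open>hh n\<close> taken at p
  y.\<close>

lemma x_hh: "x * hh n = (hh n - y * dd n) * x + dd n"
proof (induction n rule: hh.induct)
  case 1
  then show ?case by simp
next
  case 2
  then show ?case by (simp add: algebra_simps weyl' xt \<iota>.simps central)
next
  case (3 n)
  have A: "x * hh (Suc n) = (hh (Suc n) - y * dd (Suc n)) * x + dd (Suc n)"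
    and B: "x * hh n = (hh n - y * dd n) * x + dd n"
    using 3 by auto
  define e where "e = \<iota> (1 - p ^ Suc n)"
  define P where "P = \<iota> p"
  define H0 H1 D0 where "H0 = hh n" and "H1 = hh (Suc n)" and "D0 = dd n"
  have P: "x * P = P * x" "y * P = P * y" "t * P = P * t" "x * (P * z) = P * (x * z)"
    "y * (P * z) = P * (y * z)" "t * (P * z) = P * (t * z)" "e * P = P * e" "e * (P * z) = P * (e * z)" for z
    unfolding P_def e_def by (simp_all add: central left_comm \<iota>_comm flip: mult.assoc)
  have e: "e * x = x * e" "e * y = y * e" "e * t = t * e" "e * (x * z) = x * (e * z)"
    "e * (y * z) = y * (e * z)" "e * (t * z) = t * (e * z)" for z
    unfolding e_def by (simp_all add: central left_comm flip: mult.assoc)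
  have e2: "\<iota> (1 - p ^ Suc (Suc n)) = (1 - P) + P * e"
    by (simp add: e_def P_def algebra_simps \<iota>.simps)
  have D1: "dd (Suc n) = e * H0" and D2: "dd (Suc (Suc n)) = ((1 - P) + P * e) * H1"
    by (simp_all only: dd.simps e_def e2 H0_def H1_def)
  have H1: "e * H1 = e * ((y + t) * H0 - y * (t * D0))"
    unfolding H1_def H0_def D0_def hh_Suc ..
  have H2: "hh (Suc (Suc n)) = (y + t) * H1 - y * (t * (e * H0))"
    unfolding hh_Suc[of "Suc n"] D1 H1_def H0_def ..
  have xy: "x * (y * z) = P * (y * (x * z)) + (z - P * z)" for z
    using weyl'(2) by (simp add: P_def)
  have xH1: "x * H1 = (H1 - y * (e * H0)) * x + e * H0"
    using A D1 by (simp add: H1_def)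
  have xH0: "x * H0 = (H0 - y * D0) * x + D0"
    using B by (simp add: H0_def D0_def)
  have "x * hh (Suc (Suc n)) = P * (y * (x * H1)) + (1 - P) * H1 + t * (x * H1)
      - (P * (y * (t * (e * (x * H0)))) + (1 - P) * (t * (e * H0)))"
    unfolding H2 by (simp add: algebra_simps xy left_comm(4) e)
  also have "\<dots> = ((P * y + t) * (H1 - y * (e * H0)) - P * (y * (t * (e * (H0 - y * D0))))) * x
      + ((P * y + t) * (e * H0) + (1 - P) * H1 - (P * (y * (t * (e * D0))) + (1 - P) * (t * (e * H0))))"
    unfolding xH1 xH0 by (simp add: algebra_simps)
  also have "(P * y + t) * (H1 - y * (e * H0)) - P * (y * (t * (e * (H0 - y * D0))))
      = hh (Suc (Suc n)) - y * dd (Suc (Suc n))"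
    unfolding H2 D2 by (simp add: algebra_simps P e H1 yt left_comm(5))
  also have "(P * y + t) * (e * H0) + (1 - P) * H1 - (P * (y * (t * (e * D0))) + (1 - P) * (t * (e * H0)))
      = dd (Suc (Suc n))"
    unfolding D2 by (simp add: algebra_simps P e H1 yt left_comm(5))
  finally show ?case .
qed

text \<open>The same twisted Leibniz rule for \<open>nn j\<close>. The factor
  \<open>1 - t * y\<close> in front completes \<open>nn j\<close> taken at p y to
  \<open>nn (Suc j)\<close>, so that the family \<open>nn\<close> is closed under this
  operation.\<close>

lemma x_nn: "(1 - t * y) * x * nn j = nn (Suc j) * x - \<iota> (1 - p ^ j) * (t * nn j)"
proof (induction j)
  case (Suc j)
  define P where "P = \<iota> (p ^ j)"
  define Q where "Q = \<iota> p"
  have P: "x * P = P * x" "y * P = P * y" "t * P = P * t" "x * (P * z) = P * (x * z)"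
    "y * (P * z) = P * (y * z)" "t * (P * z) = P * (t * z)"
    "P * nn k = nn k * P" "P * (nn k * z) = nn k * (P * z)" "Q * P = P * Q" "Q * (P * z) = P * (Q * z)" for z k
    unfolding P_def Q_def by (simp_all add: central left_comm \<iota>_comm nn_comm(1) flip: mult.assoc)
  have Q: "x * Q = Q * x" "y * Q = Q * y" "t * Q = Q * t" "x * (Q * z) = Q * (x * z)"
    "y * (Q * z) = Q * (y * z)" "t * (Q * z) = Q * (t * z)"
    "Q * nn k = nn k * Q" "Q * (nn k * z) = nn k * (Q * z)" for z k
    unfolding Q_def by (simp_all add: central left_comm nn_comm(1) flip: mult.assoc)
  have e: "\<iota> (1 - p ^ Suc j) = 1 - P * Q" "\<iota> (1 - p ^ j) = 1 - P" "\<iota> (p ^ Suc j) = P * Q"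
    by (simp_all add: P_def Q_def \<iota>.simps power_commutes)
  have N: "nn (Suc j) = nn j * (1 - P * (t * y))" "nn (Suc (Suc j)) = nn (Suc j) * (1 - P * Q * (t * y))"
    unfolding nn.simps e by (simp_all add: P_def)
  have t: "t * nn k = nn k * t" "t * (nn k * z) = nn k * (t * z)" for k z
    by (simp_all add: nn_comm flip: mult.assoc)
  have "(1 - t * y) * x * nn (Suc j) = (1 - t * y) * x * nn j * (1 - P * (t * y))"
    by (simp only: N mult.assoc)
  also have "\<dots> = (nn (Suc j) * x - (1 - P) * (t * nn j)) * (1 - P * (t * y))"
    unfolding Suc e ..
  also have "\<dots> = nn (Suc j) * (x * (1 - P * (t * y))) - (1 - P) * (t * nn (Suc j))"
    by (simp add: N(1) algebra_simps del: nn.simps)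
  also have "x * (1 - P * (t * y)) = (1 - P * Q * (t * y)) * x - P * (1 - Q) * t"
    by (simp add: algebra_simps P Q weyl' left_comm(4,5) yt flip: Q_def)
  also have "nn (Suc j) * ((1 - P * Q * (t * y)) * x - P * (1 - Q) * t) - (1 - P) * (t * nn (Suc j))
      = nn (Suc (Suc j)) * x - (1 - P * Q) * (t * nn (Suc j))"
    unfolding N(2) by (simp add: algebra_simps P t Q yt del: nn.simps)
  finally show ?case unfolding e .
qed (simp add: \<iota>.simps)

lemma step:
  "(y + x + t * (1 - y * x)) * (nn j * hh r * x ^ j)
   = \<iota> (p ^ j) * (nn j * hh (Suc r) * x ^ j) + \<iota> (1 - p ^ j) * (nn j * (y * hh r) * x ^ j)
     + nn j * dd r * x ^ j + nn (Suc j) * (hh r - y * dd r) * x ^ Suc j"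
proof -
  define P where "P = \<iota> (p ^ j)"
  have P: "x * P = P * x" "y * P = P * y" "t * P = P * t" "x * (P * z) = P * (x * z)"
    "y * (P * z) = P * (y * z)" "t * (P * z) = P * (t * z)"
    "P * nn k = nn k * P" "P * (nn k * z) = nn k * (P * z)" for z k
    unfolding P_def by (simp_all add: central left_comm \<iota>_comm nn_comm(1) flip: mult.assoc)
  have t: "t * nn k = nn k * t" "t * (nn k * z) = nn k * (t * z)"
    "y * nn k = nn k * y" "y * (nn k * z) = nn k * (y * z)" for k z
    by (simp_all add: nn_comm flip: mult.assoc)
  have e: "\<iota> (1 - p ^ j) = 1 - P"
    by (simp_all add: P_def \<iota>.simps)
  have N: "nn (Suc j) = nn j * (1 - P * (t * y))"
    by (simp add: P_def)
  \<comment> \<open>The operator regroups as \<open>(y + t) + (1 - t * y) * x\<close>; this is what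
    brings the factors of \<open>nn\<close> into play.\<close>
  have "(y + x + t * (1 - y * x)) * nn j = (y + t) * nn j + (1 - t * y) * x * nn j"
    by (simp add: algebra_simps yt)
  also have "\<dots> = (y + t) * nn j + (nn (Suc j) * x - (1 - P) * (t * nn j))"
    unfolding x_nn e ..
  also have "\<dots> = nn j * (y + P * t) + nn (Suc j) * x"
    by (simp add: algebra_simps t P)
  finally have *: "(y + x + t * (1 - y * x)) * nn j = nn j * (y + P * t) + nn (Suc j) * x" .
  have "(y + x + t * (1 - y * x)) * nn j * hh r = nn j * (y + P * t) * hh r + nn (Suc j) * (x * hh r)"
    unfolding * by (simp add: distrib_right mult.assoc del: nn.simps)
  also have "\<dots> = nn j * ((y + P * t) * hh r + (1 - P * (t * y)) * dd r) + nn (Suc j) * (hh r - y * dd r) * x"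
    unfolding x_hh N by (simp add: algebra_simps)
  also have "(y + P * t) * hh r + (1 - P * (t * y)) * dd r = P * hh (Suc r) + (1 - P) * (y * hh r) + dd r"
    unfolding hh_Suc by (simp add: algebra_simps yt left_comm(5))
  finally have "(y + x + t * (1 - y * x)) * nn j * hh r * x ^ j
     = (nn j * (P * hh (Suc r) + (1 - P) * (y * hh r) + dd r) + nn (Suc j) * (hh r - y * dd r) * x) * x ^ j"
    by simp
  then show ?thesis
    unfolding e P_def[symmetric] by (simp add: algebra_simps P)
qed

text \<open>Normal ordering with \<open>x\<close> on the right, for every degree and every
  \<open>p\<close>. The three-term recurrence is applied to the sum, and the properties of
  \<open>qb\<close> absorb the correction terms produced by \<open>step\<close>.\<close>

lemma hermite_eq:
  "hermite \<iota> p k (y + x + t * (1 - y * x)) = (\<Sum>j\<le>k. \<iota> (qb p k j) * (nn j * hh (k - j) * x ^ j))"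
proof (induction k rule: hh.induct)
  case 1
  then show ?case by (simp add: \<iota>.one)
next
  case 2
  then show ?case by (simp add: \<iota>.one \<iota>.simps algebra_simps yt)
next
  case (3 m)
  define A where "A = y + x + t * (1 - y * x)"
  define k where "k = Suc m"
  define T where "T j r = nn j * hh r * x ^ j" for j r
  have "A * hermite \<iota> p k A = (\<Sum>j\<le>k. \<iota> (qb p k j) * (A * T j (k - j)))"
  proof -
    have "A * \<iota> c = \<iota> c * A" for c
      unfolding A_def by (simp add: algebra_simps central left_comm)
    then have "A * (\<iota> c * z) = \<iota> c * (A * z)" for c z
      by (metis mult.assoc)
    then show ?thesis
      using 3(1) by (simp add: A_def[symmetric] k_def[symmetric] sum_distrib_left T_def)
  qed
  also have "\<dots> = (\<Sum>j\<le>k. \<iota> (qb p k j * p ^ j) * T j (Suc (k - j)))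
      + (\<Sum>j\<le>k. \<iota> (qb p k j * (1 - p ^ j)) * (nn j * (y * hh (k - j)) * x ^ j))
      + (\<Sum>j\<le>k. \<iota> (qb p k j) * (nn j * dd (k - j) * x ^ j))
      + (\<Sum>j\<le>k. \<iota> (qb p k j) * (nn (Suc j) * hh (k - j) * x ^ Suc j))
      - (\<Sum>j\<le>k. \<iota> (qb p k j) * (nn (Suc j) * (y * dd (k - j)) * x ^ Suc j))"
    unfolding T_def A_def step \<iota>.mult
    by (simp add: sum.distrib sum_subtractf algebra_simps del: power_Suc nn.simps)
  \<comment> \<open>These two sums enter with opposite signs; \<open>qb_step\<close> identifies them
    after a shift of the index.\<close>
  also have "(\<Sum>j\<le>k. \<iota> (qb p k j * (1 - p ^ j)) * (nn j * (y * hh (k - j)) * x ^ j))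
      = (\<Sum>j\<le>k. \<iota> (qb p k j) * (nn (Suc j) * (y * dd (k - j)) * x ^ Suc j))"
  proof -
    have "\<iota> (qb p k (Suc j) * (1 - p ^ Suc j)) * (nn (Suc j) * (y * hh (k - Suc j)) * x ^ Suc j)
        = \<iota> (qb p k j) * (nn (Suc j) * (y * dd (k - j)) * x ^ Suc j)" if jk: "j < k" for j
    proof -
      obtain r where "k = Suc (j + r)" using less_imp_Suc_add[OF jk] by auto
      then have r: "k = j + Suc r" by simp
      have "nn i * (y * (\<iota> c * z)) = \<iota> c * (nn i * (y * z))" for i c z
        by (simp only: left_comm(2)) (simp only: nn_comm(1) flip: mult.assoc)
      then show ?thesis
        unfolding r qb_step by (simp add: \<iota>.mult mult.assoc del: power_Suc nn.simps)
    qed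
    then have "(\<Sum>j<k. \<iota> (qb p k (Suc j) * (1 - p ^ Suc j)) * (nn (Suc j) * (y * hh (k - Suc j)) * x ^ Suc j))
       = (\<Sum>j<k. \<iota> (qb p k j) * (nn (Suc j) * (y * dd (k - j)) * x ^ Suc j))"
      by (intro sum.cong) auto
    then show ?thesis
      unfolding lessThan_Suc_atMost[symmetric] sum.lessThan_Suc_shift
          [of "\<lambda>j. \<iota> (qb p k j * (1 - p ^ j)) * (nn j * (y * hh (k - j)) * x ^ j)"]
        sum.lessThan_Suc[of "\<lambda>j. \<iota> (qb p k j) * (nn (Suc j) * (y * dd (k - j)) * x ^ Suc j)"]
      by (simp add: \<iota>.zero del: power_Suc nn.simps)
  qed
  \<comment> \<open>By \<open>qb_absorb_comp\<close> the terms with \<open>dd\<close> sum up to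
    exactly what the recurrence of \<open>hermite\<close> subtracts.\<close>
  also have "(\<Sum>j\<le>k. \<iota> (qb p k j) * (nn j * dd (k - j) * x ^ j))
      = \<iota> (1 - p ^ k) * (\<Sum>j\<le>m. \<iota> (qb p m j) * T j (m - j))"
  proof -
    have "\<iota> (qb p k j) * (nn j * dd (k - j) * x ^ j) = \<iota> (1 - p ^ k) * (\<iota> (qb p m j) * T j (m - j))"
      if jm: "j \<le> m" for j
    proof -
      obtain r where r: "m = j + r" using jm le_Suc_ex by blast
      have "nn i * (\<iota> c * z) = \<iota> c * (nn i * z)" for i c z
        by (simp only: nn_comm(1) flip: mult.assoc)
      then show ?thesis
        using qb_absorb_comp[of p j r] unfolding T_def r k_def
        by (simp add: mult.assoc Suc_diff_le del: power_Suc nn.simps flip: \<iota>.mult)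
           (simp add: \<iota>.mult del: power_Suc nn.simps flip: mult.assoc \<iota>.mult)
    qed
    then show ?thesis
      unfolding sum_distrib_left k_def by (subst sum.atMost_Suc) (simp del: nn.simps)
  qed
  also have "(\<Sum>j\<le>k. \<iota> (qb p k j * p ^ j) * T j (Suc (k - j)))
      = hh (Suc k) + (\<Sum>j\<le>k. \<iota> (qb p k (Suc j) * p ^ Suc j) * T (Suc j) (k - j))"
  proof -
    have "(\<Sum>j<k. \<iota> (qb p k (Suc j) * p ^ Suc j) * T (Suc j) (Suc (k - Suc j)))
       = (\<Sum>j<k. \<iota> (qb p k (Suc j) * p ^ Suc j) * T (Suc j) (k - j))"
      by (intro sum.cong) (auto simp: Suc_diff_Suc)
    then show ?thesis
      unfolding lessThan_Suc_atMost[symmetric]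
        sum.lessThan_Suc_shift[of "\<lambda>j. \<iota> (qb p k j * p ^ j) * T j (Suc (k - j))"]
        sum.lessThan_Suc[of "\<lambda>j. \<iota> (qb p k (Suc j) * p ^ Suc j) * T (Suc j) (k - j)"]
      by (simp add: \<iota>.simps T_def qb_eq_0 del: power_Suc nn.simps(2) hh.simps)
  qed
  \<comment> \<open>The Pascal rule merges the two remaining sums. \<open>Z\<close> stands for the
    cancelling pair and \<open>W\<close> for the term of the recurrence.\<close>
  also have "hh (Suc k) + (\<Sum>j\<le>k. \<iota> (qb p k (Suc j) * p ^ Suc j) * T (Suc j) (k - j))
      + Z + W + (\<Sum>j\<le>k. \<iota> (qb p k j) * (nn (Suc j) * hh (k - j) * x ^ Suc j)) - Z
      = (\<Sum>j\<le>Suc k. \<iota> (qb p (Suc k) j) * T j (Suc k - j)) + W" for Z W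
    by (subst sum.atMost_Suc_shift)
       (simp add: T_def \<iota>.simps algebra_simps sum.distrib del: power_Suc nn.simps(2) hh.simps)
  finally have "A * hermite \<iota> p k A = (\<Sum>j\<le>Suc k. \<iota> (qb p (Suc k) j) * T j (Suc k - j))
      + \<iota> (1 - p ^ k) * (\<Sum>j\<le>m. \<iota> (qb p m j) * T j (m - j))" .
  then show ?case
    using 3(2) unfolding A_def[symmetric] T_def k_def by simp
qed


lemma hh_closed: "hh k = (\<Sum>i\<le>k. \<iota> (qb p k i) * (y ^ i * t ^ (k - i)))"
proof (induction k rule: hh.induct)
  case (3 k)
  define n where "n = Suc k"
  define M where "M i j = y ^ i * t ^ j" for i j
  have M: "y * M i j = M (Suc i) j" "t * M i j = M i (Suc j)" for i j
  proof -
    have "t * y ^ i = y ^ i * t"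
      by (rule power_commuting_commutes[symmetric]) (rule yt)
    then show "y * M i j = M (Suc i) j" "t * M i j = M i (Suc j)"
      by (simp_all add: M_def mult.assoc) (simp_all flip: mult.assoc)
  qed
  have 1: "y * hh n = (\<Sum>i\<le>n. \<iota> (qb p n i) * M (Suc i) (n - i))"
    using 3(1) by (simp add: n_def[symmetric] M_def[symmetric] sum_distrib_left left_comm M)
  have "t * hh n = (\<Sum>i\<le>n. \<iota> (qb p n i) * M i (Suc n - i))"
    using 3(1) by (simp add: n_def[symmetric] M_def[symmetric] sum_distrib_left left_comm M Suc_diff_le)
  also have "\<dots> = (\<Sum>i\<le>Suc n. \<iota> (qb p n i) * M i (Suc n - i))"
    by (simp add: qb_eq_0 \<iota>.zero)
  also have "\<dots> = M 0 (Suc n) + (\<Sum>i\<le>n. \<iota> (qb p n (Suc i)) * M (Suc i) (n - i))"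
    by (subst sum.atMost_Suc_shift) (simp add: \<iota>.one)
  finally have 2: "t * hh n = \<dots>" .
  have "\<iota> (1 - p ^ n) * (y * t * hh k) = (\<Sum>i\<le>k. \<iota> ((1 - p ^ n) * qb p k i) * M (Suc i) (Suc k - i))"
    using 3(2) by (simp add: M_def[symmetric] sum_distrib_left left_comm M Suc_diff_le \<iota>.mult mult.assoc)
  also have "\<dots> = (\<Sum>i\<le>k. \<iota> (qb p n (Suc i) * (1 - p ^ Suc i)) * M (Suc i) (n - i))"
    unfolding n_def qb_absorb ..
  also have "\<dots> = (\<Sum>i\<le>n. \<iota> (qb p n (Suc i) * (1 - p ^ Suc i)) * M (Suc i) (n - i))"
    by (simp add: n_def qb_eq_0 \<iota>.zero del: qb.simps)
  finally have 3: "\<iota> (1 - p ^ n) * (y * t * hh k) = \<dots>" .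
  have "hh (Suc n) = y * hh n + t * hh n - \<iota> (1 - p ^ n) * (y * t * hh k)"
    unfolding n_def by (simp add: distrib_right)
  also have "\<dots> = M 0 (Suc n) + (\<Sum>i\<le>n. \<iota> (qb p (Suc n) (Suc i)) * M (Suc i) (n - i))"
    unfolding 1 2 3 by (simp add: \<iota>.simps algebra_simps sum.distrib sum_subtractf)
  also have "\<dots> = (\<Sum>i\<le>Suc n. \<iota> (qb p (Suc n) i) * M i (Suc n - i))"
    by (subst sum.atMost_Suc_shift) (simp add: \<iota>.one)
  finally show ?case by (simp only: n_def M_def)
qed (simp_all add: \<iota>.simps add.commute)

end

section \<open>Collapse at a primitive root of unity\<close>

fun qpoch :: "('a::comm_ring_1 \<Rightarrow> 'r::ring_1) \<Rightarrow> 'a \<Rightarrow> 'r \<Rightarrow> nat \<Rightarrow> 'r" where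
  "qpoch \<iota> p z 0 = 1"
| "qpoch \<iota> p z (Suc k) = qpoch \<iota> p z k * (1 - \<iota> (p ^ k) * z)"

text \<open>Gauss's q-binomial theorem; the product of the \<open>- (p ^ i)\<close> is (-1)^j p^(j
  (j - 1) / 2).\<close>

lemma qpoch_closed:
  fixes \<iota> :: "'a::comm_ring_1 \<Rightarrow> 'r::ring_1"
  assumes "unital_hom \<iota>" and central: "\<And>c. z * \<iota> c = \<iota> c * z"
  shows "qpoch \<iota> p z k = (\<Sum>j\<le>k. \<iota> (qb p k j) * (\<iota> (\<Prod>i<j. - (p ^ i)) * z ^ j))"
proof (induction k)
  interpret \<iota>: unital_hom \<iota> by fact
  case 0
  then show ?case by (simp add: \<iota>.one)
next
  interpret \<iota>: unital_hom \<iota> by fact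
  case (Suc k)
  define s where "s j = (\<Prod>i<j. - (p ^ i))" for j
  have z: "z ^ j * \<iota> c = \<iota> c * z ^ j" for j c
    by (rule power_commuting_commutes) (rule central)
  have zz: "\<iota> a * (\<iota> b * z ^ j) * (\<iota> c * z) = \<iota> (a * b * c) * z ^ Suc j" for a b c j
  proof -
    have "\<iota> a * (\<iota> b * z ^ j) * (\<iota> c * z) = \<iota> a * \<iota> b * (z ^ j * \<iota> c) * z"
      by (simp only: mult.assoc)
    also have "\<dots> = \<iota> (a * b * c) * z ^ Suc j"
      unfolding z by (simp only: \<iota>.mult power_Suc2 mult.assoc)
    finally show ?thesis .
  qed
  have "qpoch \<iota> p z (Suc k) = (\<Sum>j\<le>k. \<iota> (qb p k j) * (\<iota> (s j) * z ^ j))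
      - (\<Sum>j\<le>k. \<iota> (qb p k j * s j * p ^ k) * z ^ Suc j)"
    using Suc by (simp add: right_diff_distrib sum_distrib_right zz s_def[symmetric] del: power_Suc)
  also have "(\<Sum>j\<le>k. \<iota> (qb p k j) * (\<iota> (s j) * z ^ j)) = (\<Sum>j\<le>Suc k. \<iota> (qb p k j) * (\<iota> (s j) * z ^ j))"
    by (simp add: qb_eq_0 \<iota>.zero)
  also have "\<dots> = 1 + (\<Sum>j\<le>k. \<iota> (qb p k (Suc j)) * (\<iota> (s (Suc j)) * z ^ Suc j))"
    by (subst sum.atMost_Suc_shift) (simp add: \<iota>.one s_def)
  also have "\<dots> - (\<Sum>j\<le>k. \<iota> (qb p k j * s j * p ^ k) * z ^ Suc j)
      = 1 + (\<Sum>j\<le>k. \<iota> (qb p k (Suc j) * s (Suc j) - qb p k j * s j * p ^ k) * z ^ Suc j)"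
    by (simp add: \<iota>.simps sum_subtractf left_diff_distrib mult.assoc del: power_Suc)
  also have "(\<Sum>j\<le>k. \<iota> (qb p k (Suc j) * s (Suc j) - qb p k j * s j * p ^ k) * z ^ Suc j)
      = (\<Sum>j\<le>k. \<iota> (qb p (Suc k) (Suc j)) * (\<iota> (s (Suc j)) * z ^ Suc j))"
  proof (intro sum.cong refl)
    fix j assume "j \<in> {..k}"
    then have "j \<le> k" by simp
    from qb_pascal'[OF this] have "qb p (Suc k) (Suc j) = qb p k (Suc j) + p ^ (k - j) * qb p k j" .
    moreover have "p ^ k = p ^ (k - j) * p ^ j"
      using \<open>j \<le> k\<close> by (simp flip: power_add)
    ultimately have "qb p (Suc k) (Suc j) * s (Suc j) = qb p k (Suc j) * s (Suc j) - qb p k j * s j * p ^ k"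
      unfolding s_def by (simp add: algebra_simps del: qb.simps)
    then show "\<iota> (qb p k (Suc j) * s (Suc j) - qb p k j * s j * p ^ k) * z ^ Suc j
        = \<iota> (qb p (Suc k) (Suc j)) * (\<iota> (s (Suc j)) * z ^ Suc j)"
      by (simp add: mult.assoc[symmetric] \<iota>.mult[symmetric] del: qb.simps power_Suc)
  qed
  also have "1 + \<dots> = (\<Sum>j\<le>Suc k. \<iota> (qb p (Suc k) j) * (\<iota> (s j) * z ^ j))"
    by (subst sum.atMost_Suc_shift) (simp add: \<iota>.one s_def)
  finally show ?case unfolding s_def .
qed

text \<open>The collapsed sum is 1 + s z^n with a constant s. At z = 1 the first factor of the
  q-shifted factorial is zero, which forces s = -1.\<close>

lemma qpoch_prim_root:
  fixes \<iota> :: "'a::field \<Rightarrow> 'r::ring_1"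
  assumes p: "prim_root n p" and \<iota>: "unital_hom \<iota>" and "\<And>c. z * \<iota> c = \<iota> c * z"
  shows "qpoch \<iota> p z n = 1 - z ^ n"
proof -
  interpret \<iota>: unital_hom \<iota> by fact
  have *: "qpoch \<kappa> p w n = 1 + \<kappa> (\<Prod>i<n. - (p ^ i)) * w ^ n"
    if "unital_hom \<kappa>" "\<And>c. w * \<kappa> c = \<kappa> c * w" for \<kappa> :: "'a \<Rightarrow> 'c::ring_1" and w
    unfolding qpoch_closed[OF that] by (subst sum_qb_prim_root[OF p that(1)]) (simp add: unital_hom.one[OF that(1)])
  have "qpoch id p 1 (Suc k) = 0" for k
    by (induction k) auto
  moreover have "n = Suc (n - 1)"
    using p by (simp add: prim_root_def)
  ultimately have "qpoch id p 1 n = 0" by metis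
  then have "(\<Prod>i<n. - (p ^ i)) = -1"
    using *[of id 1] by (simp add: unital_hom_def eq_neg_iff_add_eq_0 add.commute)
  then show ?thesis
    using *[of \<iota> z] assms by (simp add: \<iota>.simps)
qed

lemma (in q_weyl) nn_eq_qpoch: "nn k = qpoch \<iota> p (t * y) k"
  by (induction k) simp_all

lemma q_weyl_hermite_prim_root:
  fixes \<iota> :: "'a::field \<Rightarrow> 'r::ring_1"
  assumes "q_weyl \<iota> p x y t" and p: "prim_root n p"
  shows "hermite \<iota> p n (y + x + t * (1 - y * x)) = y ^ n + x ^ n + t ^ n * (1 - y ^ n * x ^ n)"
proof -
  interpret qw: q_weyl \<iota> p x y t by fact
  note hermite_eq = qw.hermite_eq and \<iota> = qw.\<iota>
  have "hermite \<iota> p n (y + x + t * (1 - y * x)) = qw.hh n + qw.nn n * x ^ n"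
    unfolding hermite_eq by (subst sum_qb_prim_root[OF p \<iota>]) simp
  also have "qw.hh n = y ^ n + t ^ n"
    unfolding qw.hh_closed by (subst sum_qb_prim_root[OF p \<iota>]) (simp add: add.commute)
  also have "qw.nn n = 1 - (t * y) ^ n"
    unfolding qw.nn_eq_qpoch by (rule qpoch_prim_root[OF p \<iota>]) (simp add: qw.central(2,3) qw.left_comm(3) mult.assoc)
  also have "(t * y) ^ n = t ^ n * y ^ n"
  proof (induction n)
    case (Suc n)
    have "t ^ n * y = y * t ^ n"
      by (rule power_commuting_commutes) (simp add: qw.yt)
    then have "t * (y * (t ^ n * w)) = t * (t ^ n * (y * w))" for w
      by (simp flip: mult.assoc)
    then show ?case by (simp add: Suc mult.assoc)
  qed simp
  finally show ?thesis by (simp add: algebra_simps)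
qed

lemma lookup_single_mult:
  fixes m w :: "'m::ab_group_add" and g :: "'m \<Rightarrow>\<^sub>0 'k::semiring_0"
  shows "lookup (single m c * g) w = c * lookup g (w - m)"
proof (induction g rule: poly_mapping_induct_sum)
  case (single k d)
  have "m + k = w \<longleftrightarrow> k = w - m"
    by (auto simp: algebra_simps)
  then show ?case
    by (simp add: mult_single lookup_single when_def)
qed (simp_all add: lookup_add distrib_left)

lemma lookup_power_plus_inverse:
  fixes \<Lambda> :: "int \<Rightarrow>\<^sub>0 'k::ring_1"
  defines "\<Lambda> \<equiv> single 1 1 + single (- 1) 1"
  shows "int k < w \<Longrightarrow> lookup (\<Lambda> ^ k) w = 0" "lookup (\<Lambda> ^ k) (int k) = 1"
proof (induction k arbitrary: w)
  case (Suc k)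
  have "lookup (\<Lambda> ^ Suc k) v
      = lookup (\<Lambda> ^ k) (v - 1) + lookup (\<Lambda> ^ k) (v + 1)" for v
    unfolding power_Suc by (subst (1) \<Lambda>_def) (simp add: distrib_right lookup_add lookup_single_mult)
  note * = this
  {
    case 1
    then show ?case unfolding * by (simp add: Suc)
  next
    case 2
    show ?case unfolding * by (simp add: Suc)
  }
qed (simp_all add: lookup_one when_def)

text \<open>The top term of (u + u^(-1))^k is u^k with coefficient 1, so the leading coefficient of
  \<open>p\<close> survives the substitution.\<close>

lemma ma_eval_plus_inverse_inj:
  fixes p :: "nat \<Rightarrow>\<^sub>0 'k::ring_1"
  assumes "ma_eval (single 0)
    (\<lambda>k. (single (1::int) 1 + single (- 1) 1) ^ k) p = 0"
  shows "p = 0"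
proof (rule ccontr)
  assume "p \<noteq> 0"
  let ?\<Lambda> = "single (1::int) (1::'k) + single (- 1) 1"
  define d where "d = Max (keys p)"
  have ne: "keys p \<noteq> {}"
  proof
    assume "keys p = {}"
    with poly_mapping_sum_single[of p] have "p = 0" by simp
    with \<open>p \<noteq> 0\<close> show False by simp
  qed
  then have d: "d \<in> keys p" "\<And>k. k \<in> keys p \<Longrightarrow> k \<le> d"
    by (simp_all add: d_def)
  have "0 = lookup (ma_eval (single 0) (\<lambda>k. ?\<Lambda> ^ k) p) (int d)"
    by (simp add: assms)
  also have "\<dots> = (\<Sum>k\<in>keys p. lookup p k * lookup (?\<Lambda> ^ k) (int d))"
    by (simp add: ma_eval_def lookup_sum lookup_single_mult)
  also have "\<dots> = (\<Sum>k\<in>{d}. lookup p k * lookup (?\<Lambda> ^ k) (int d))"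
  proof (rule sum.mono_neutral_right)
    have "lookup (?\<Lambda> ^ k) (int d) = 0" if "k \<in> keys p" "k \<noteq> d" for k
      by (rule lookup_power_plus_inverse(1)) (use d(2)[OF that(1)] that(2) in simp)
    then show "\<forall>k\<in>keys p - {d}. lookup p k * lookup (?\<Lambda> ^ k) (int d) = 0"
      by auto
  qed (use d in auto)
  also have "\<dots> = lookup p d"
    by (simp add: lookup_power_plus_inverse(2))
  finally show False
    using d(1) by (simp add: in_keys_iff)
qed

lemma (in unital_hom) hermite: "f (hermite \<iota> p n x) = hermite (\<lambda>c. f (\<iota> c)) p n (f x)"
  by (induction n rule: cheb_poly.induct) (simp_all add: one mult diff)

text \<open>At a root of unity the continuous $q$-Hermite polynomial $\sum_k \binom{n}{k}_q u^{n-2k}$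
  of $u + u^{-1}$ degenerates to $u^n + u^{-n}$.\<close>

lemma hermite_eq_cheb:
  fixes \<iota> :: "'a::field \<Rightarrow> 'r::ring_1"
  assumes p: "prim_root n p" and \<iota>: "unital_hom \<iota>" and central: "\<And>c. x * \<iota> c = \<iota> c * x"
  shows "hermite \<iota> p n x = cheb n x"
proof -
  have unital_single: "unital_hom (single 0 :: 'a \<Rightarrow> 'm::monoid_add \<Rightarrow>\<^sub>0 'a)"
    by unfold_locales (simp_all add: single_add mult_single)
  have hom: "unital_hom (ma_eval \<kappa> (\<lambda>k. w ^ k))"
    if "unital_hom \<kappa>" "\<And>c. w * \<kappa> c = \<kappa> c * w" for \<kappa> :: "'a \<Rightarrow> 'c::ring_1" and w
  proof (rule unital_hom_ma_eval[OF that(1)])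
    show "w ^ m * \<kappa> c = \<kappa> c * w ^ m" for m c
      by (rule power_commuting_commutes) (rule that(2))
  qed (simp_all add: power_add)
  define V :: "nat \<Rightarrow>\<^sub>0 'a" where "V = single 1 1"
  have V: "ma_eval \<kappa> (\<lambda>k. w ^ k) V = w" "ma_eval \<kappa> (\<lambda>k. w ^ k) (single 0 c) = \<kappa> c"
    if "unital_hom \<kappa>" for \<kappa> :: "'a \<Rightarrow> 'c::ring_1" and w c
    by (simp_all add: V_def ma_eval_single[OF that] unital_hom.one[OF that])
  \<comment> \<open>It suffices to compare both sides for a formal variable \<open>V\<close>, and
    there after the injective substitution of u + u^(-1).\<close>
  have "hermite (single 0) p n V = cheb n V"
  proof -
    define u v :: "int \<Rightarrow>\<^sub>0 'a" where "u = single 1 1" and "v = single (- 1) 1"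
    have uv: "u * v = 1" "v * u = 1"
      by (simp_all add: u_def v_def mult_single)
    have comm: "w * single 0 c = single 0 c * w" for w :: "int \<Rightarrow>\<^sub>0 'a" and c
      by (rule mult.commute)
    interpret ev: unital_hom "ma_eval (single 0) (\<lambda>k. (u + v) ^ k)"
      by (rule hom[OF unital_single comm])
    \<comment> \<open>Commuting inverse elements satisfy the Weyl relation trivially, as p + (1 - p)
      = 1. With \<open>t = 0\<close> the collapsed expansion is u^n + v^n, the Chebyshev
      value.\<close>
    have "v * u = single 0 p * u * v + single 0 (1 - p)"
      by (simp add: mult.assoc uv flip: single_add)
    then have "q_weyl (single 0) p v u 0"
      by (intro q_weyl.intro unital_single comm mult.commute)
    from q_weyl_hermite_prim_root[OF this p]
    have "hermite (single 0) p n (u + v) = cheb n (u + v)"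
      using p by (simp add: cheb_plus_inverse[OF uv] prim_root_def zero_power)
    then have "ma_eval (single 0) (\<lambda>k. (u + v) ^ k) (hermite (single 0) p n V - cheb n V) = 0"
      by (simp add: ev.diff ev.hermite ev.cheb V unital_single)
    then have "hermite (single 0) p n V - cheb n V = 0"
      unfolding u_def v_def by (rule ma_eval_plus_inverse_inj)
    then show ?thesis by simp
  qed
  then have *: "ma_eval \<iota> (\<lambda>k. x ^ k) (hermite (single 0) p n V) = ma_eval \<iota> (\<lambda>k. x ^ k) (cheb n V)"
    by simp
  interpret ev: unital_hom "ma_eval \<iota> (\<lambda>k. x ^ k)"
    by (rule hom[OF \<iota> central])
  from * show ?thesis
    by (simp add: ev.hermite ev.cheb V \<iota>)
qed

corollary q_weyl_cheb:
  fixes \<iota> :: "'a::field \<Rightarrow> 'r::ring_1"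
  assumes "q_weyl \<iota> p x y t" and p: "prim_root n p"
  shows "cheb n (y + x + t * (1 - y * x)) = y ^ n + x ^ n + t ^ n * (1 - y ^ n * x ^ n)"
proof -
  interpret qw: q_weyl \<iota> p x y t by fact
  have "(y + x + t * (1 - y * x)) * \<iota> c = \<iota> c * (y + x + t * (1 - y * x))" for c
    by (simp add: algebra_simps qw.central qw.left_comm)
  from hermite_eq_cheb[OF p qw.\<iota> this] show ?thesis
    using q_weyl_hermite_prim_root[OF assms] by simp
qed

text \<open>A q-analogue of the Frobenius identity: normal ordering of (u + v)^k produces Gaussian
  binomial coefficients.\<close>

lemma q_binomial_prim_root:
  fixes \<iota> :: "'a::field \<Rightarrow> 'r::ring_1"
  assumes p: "prim_root n p" and \<iota>: "unital_hom \<iota>"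
    and central: "\<And>c. u * \<iota> c = \<iota> c * u" "\<And>c. v * \<iota> c = \<iota> c * v"
    and vu: "v * u = \<iota> p * u * v"
  shows "(u + v) ^ n = u ^ n + v ^ n"
proof -
  interpret \<iota>: unital_hom \<iota> by fact
  have comm: "u * (\<iota> c * z) = \<iota> c * (u * z)" "v * (\<iota> c * z) = \<iota> c * (v * z)" for c z
    by (simp_all add: central flip: mult.assoc)
  have v: "v * (u ^ j * z) = \<iota> (p ^ j) * (u ^ j * (v * z))" for j z
  proof (induction j arbitrary: z)
    case (Suc j)
    have "v * (u ^ Suc j * z) = (v * u) * (u ^ j * z)"
      by (simp add: mult.assoc)
    also have "\<dots> = \<iota> (p ^ Suc j) * (u ^ Suc j * (v * z))"
      by (simp add: vu mult.assoc Suc comm \<iota>.mult)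
    finally show ?case .
  qed (simp add: \<iota>.one)
  have sum: "(u + v) ^ k = (\<Sum>j\<le>k. \<iota> (qb p k j) * (u ^ j * v ^ (k - j)))" for k
  proof (induction k)
    case (Suc k)
    have "(u + v) ^ Suc k = (\<Sum>j\<le>k. \<iota> (qb p k j) * (u ^ Suc j * v ^ (k - j)))
        + (\<Sum>j\<le>k. \<iota> (qb p k j * p ^ j) * (u ^ j * v ^ (Suc k - j)))"
      by (simp add: Suc distrib_right sum_distrib_left comm v \<iota>.mult mult.assoc sum.distrib Suc_diff_le)
    also have "(\<Sum>j\<le>k. \<iota> (qb p k j * p ^ j) * (u ^ j * v ^ (Suc k - j)))
        = (\<Sum>j\<le>Suc k. \<iota> (qb p k j * p ^ j) * (u ^ j * v ^ (Suc k - j)))"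
      by (simp add: qb_eq_0 \<iota>.zero)
    also have "\<dots> = v ^ Suc k + (\<Sum>j\<le>k. \<iota> (qb p k (Suc j) * p ^ Suc j) * (u ^ Suc j * v ^ (k - j)))"
      by (subst sum.atMost_Suc_shift) (simp add: \<iota>.one)
    also have "(\<Sum>j\<le>k. \<iota> (qb p k j) * (u ^ Suc j * v ^ (k - j))) + \<dots>
        = v ^ Suc k + (\<Sum>j\<le>k. \<iota> (qb p (Suc k) (Suc j)) * (u ^ Suc j * v ^ (k - j)))"
      by (simp add: \<iota>.simps distrib_right sum.distrib ac_simps del: power_Suc)
    also have "\<dots> = (\<Sum>j\<le>Suc k. \<iota> (qb p (Suc k) j) * (u ^ j * v ^ (Suc k - j)))"
      by (subst sum.atMost_Suc_shift) (simp add: \<iota>.one)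
    finally show ?case .
  qed (simp add: \<iota>.one)
  show ?thesis
    unfolding sum[of n] by (subst sum_qb_prim_root[OF p \<iota>]) (simp add: add.commute)
qed

section \<open>Operators on sequences\<close>

text \<open>Additive maps are enough for a ring. Scalars enter as the operators \<open>sc\<close>,
  which are shown to commute with the operators in use rather than being built into the
  type.\<close>

typedef (overloaded) 'l endo = "{T :: (int \<Rightarrow> 'l::comm_ring_1) \<Rightarrow> int \<Rightarrow> 'l. \<forall>f g. T (\<lambda>i. f i + g i) = (\<lambda>i. T f i + T g i)}"
  morphisms app Endo
  by (rule exI[of _ "\<lambda>f. f"]) simp

setup_lifting type_definition_endo

lemma app_add: "app T (\<lambda>i. f i + g i) i = app T f i + app T g i"
  using app[of T] by simp

lemma endo_eqI: "(\<And>f i. app S f i = app T f i) \<Longrightarrow> S = T"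
  by (simp add: app_inject[symmetric] fun_eq_iff)

instantiation endo :: (comm_ring_1) ring_1
begin

lift_definition zero_endo :: "'a endo" is "\<lambda>f i. 0" by simp
lift_definition one_endo :: "'a endo" is "\<lambda>f. f" by simp
lift_definition plus_endo :: "'a endo \<Rightarrow> 'a endo \<Rightarrow> 'a endo" is "\<lambda>S T f i. S f i + T f i"
  by (simp add: algebra_simps)
lift_definition minus_endo :: "'a endo \<Rightarrow> 'a endo \<Rightarrow> 'a endo" is "\<lambda>S T f i. S f i - T f i"
  by (simp add: algebra_simps)
lift_definition uminus_endo :: "'a endo \<Rightarrow> 'a endo" is "\<lambda>T f i. - T f i"
  by simp
lift_definition times_endo :: "'a endo \<Rightarrow> 'a endo \<Rightarrow> 'a endo" is "\<lambda>S T f. S (T f)"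
  by simp

lemmas app_simps =
  zero_endo.rep_eq one_endo.rep_eq plus_endo.rep_eq minus_endo.rep_eq uminus_endo.rep_eq times_endo.rep_eq

instance
proof
  show "(0::'a endo) \<noteq> 1"
  proof
    assume "(0::'a endo) = 1"
    then have "app (0::'a endo) (\<lambda>i. 1) 0 = app 1 (\<lambda>i. 1) 0" by simp
    then show False by (simp add: app_simps)
  qed
  show "S * (T + U) = S * T + S * U" for S T U :: "'a endo"
    by (rule endo_eqI) (simp add: app_simps app_add)
qed (rule endo_eqI; simp add: app_simps algebra_simps)+

end

text \<open>The step \<open>s\<close> is a parameter because n-th powers of such operators give
  operators of the same shape with step \<open>n * s\<close>.\<close>

lift_definition tri :: "int \<Rightarrow> (int \<Rightarrow> 'l) \<Rightarrow> (int \<Rightarrow> 'l) \<Rightarrow> (int \<Rightarrow> 'l) \<Rightarrow> 'l::comm_ring_1 endo" is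
  "\<lambda>s u v w f i. u i * f (i + s) + v i * f i + w i * f (i - s)"
  by (simp add: algebra_simps)

lift_definition sc :: "'l \<Rightarrow> 'l::comm_ring_1 endo" is "\<lambda>l f i. l * f i"
  by (simp add: algebra_simps)

lemmas app_op = tri.rep_eq sc.rep_eq app_simps

lemma unital_hom_sc: "unital_hom sc"
  by unfold_locales (rule endo_eqI; simp add: app_op algebra_simps)+

lemma sc_tri: "sc l * tri s u v w = tri s u v w * sc l"
  by (rule endo_eqI) (simp add: app_op algebra_simps)

lemma tri_add: "tri s u v w + tri s u' v' w' = tri s (\<lambda>i. u i + u' i) (\<lambda>i. v i + v' i) (\<lambda>i. w i + w' i)"
  by (rule endo_eqI) (simp add: app_op algebra_simps)

section \<open>Tridiagonal models of the Askey-Wilson relations\<close>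

locale aw_model =
  fixes q q' a a' b b' c c' \<Lambda> :: "'l::comm_ring_1" and Y Y' :: "int \<Rightarrow> 'l" and s :: int
  assumes inv: "q * q' = 1" "a * a' = 1" "b * b' = 1" "c * c' = 1" "\<And>i. Y i * Y' i = 1"
    and Y_step: "\<And>i. Y (i + s) = q\<^sup>2 * Y i"
begin

lemma cancel: "q * (q' * z) = z" "a * (a' * z) = z" "b * (b' * z) = z" "c * (c' * z) = z"
  "Y i * (Y' i * z) = z"
  by (simp_all add: inv flip: mult.assoc)

lemma Y_step': "Y' (i + s) = q'\<^sup>2 * Y' i"
proof -
  have "Y' (i + s) = (q * q')\<^sup>2 * (Y i * Y' i) * Y' (i + s)"
    by (simp add: inv)
  also have "\<dots> = q'\<^sup>2 * Y' i * (Y (i + s) * Y' (i + s))"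
    unfolding Y_step by (simp add: power2_eq_square ac_simps)
  finally show ?thesis by (simp add: inv)
qed

lemma Y_back: "Y (i - s) = q'\<^sup>2 * Y i" "Y' (i - s) = q\<^sup>2 * Y' i"
  using Y_step[of "i - s"] Y_step'[of "i - s"]
  by (simp_all add: power2_eq_square mult.assoc cancel mult.left_commute[of q' q])

lemmas Y_shift = Y_step Y_step' Y_back

text \<open>Forced by the requirement that the Casimir element q x + q^(-1) y + q z - q x y z of the
  equitable generators act as the scalar \<open>\<Lambda>\<close>. If \<open>\<Lambda>\<close> is
  the sum of two inverse elements, \<open>g\<close> splits into two linear factors in
  \<open>Y'\<close>.\<close>

definition g :: "int \<Rightarrow> 'l" where "g i = 1 - q' * \<Lambda> * Y' i + q'\<^sup>2 * (Y' i)\<^sup>2"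

definition ox where "ox = tri s (\<lambda>_. 0) Y' (\<lambda>_. 1)"
definition oy where "oy = tri s (\<lambda>_. 0) Y (\<lambda>_. 0)"
definition oz where "oz = tri s g Y' (\<lambda>_. 0)"

definition oA where
  "oA = tri s (\<lambda>_. 0) (\<lambda>i. a * Y' i + a' * Y i) (\<lambda>i. a - b * c' * q' * Y i)"
definition oB where
  "oB = tri s (\<lambda>i. g i * (b' - c * a' * q * Y i)) (\<lambda>i. b * Y i + b' * Y' i) (\<lambda>_. 0)"
definition oC where
  "oC = tri s (\<lambda>i. g i * (c - a * b' * q' * Y' i))
     (\<lambda>i. (c + c') * Y' i + a * b' * (\<Lambda> * Y' i - (q + q') * (Y' i)\<^sup>2))
     (\<lambda>i. c' - a * b' * q * Y' i)"

definition alpha where "alpha = \<Lambda> * (a + a') + (b + b') * (c + c')"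
definition beta where "beta = \<Lambda> * (b + b') + (c + c') * (a + a')"
definition gamma where "gamma = \<Lambda> * (c + c') + (a + a') * (b + b')"
definition omega where
  "omega = \<Lambda>\<^sup>2 - 2 + (a + a')\<^sup>2 + (b + b')\<^sup>2 + (c + c')\<^sup>2 + \<Lambda> * (a + a') * (b + b') * (c + c')"

lemma model_eqI:
  assumes "\<And>f i y y'. Y i = y \<Longrightarrow> Y' i = y' \<Longrightarrow> y * y' = 1 \<Longrightarrow> (\<And>z. y * (y' * z) = z) \<Longrightarrow> app S f i = app T f i"
  shows "S = T"
  by (rule endo_eqI) (rule assms[OF refl refl inv(5) cancel(5)])

lemmas model_simps = g_def alpha_def beta_def gamma_def omega_def app_op Y_shift algebra_simps power2_eq_square inv cancel

lemma weyl:
  "ox * oy = sc (q'\<^sup>2) * oy * ox + sc (1 - q'\<^sup>2)"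
  "oy * oz = sc (q'\<^sup>2) * oz * oy + sc (1 - q'\<^sup>2)"
  "oz * ox = sc (q'\<^sup>2) * ox * oz + sc (1 - q'\<^sup>2)"
  by (rule model_eqI; simp add: ox_def oy_def oz_def model_simps)+

lemma decompose:
  "oA = sc a' * oy + sc a * ox + sc (b * c' * q') * (1 - (sc a' * oy) * (sc a * ox))"
  "oB = sc b' * oz + sc b * oy + sc (c * a' * q') * (1 - (sc b' * oz) * (sc b * oy))"
  "oC = sc c' * ox + sc c * oz + sc (a * b' * q') * (1 - (sc c' * ox) * (sc c * oz))"
  by (rule model_eqI; simp add: oA_def oB_def oC_def ox_def oy_def oz_def model_simps)+

lemma relations:
  "oB * oA = sc (q\<^sup>2) * oA * oB + sc (q * (q\<^sup>2 - q'\<^sup>2)) * oC - sc (q * (q - q') * gamma)"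
  "oC * oB = sc (q\<^sup>2) * oB * oC + sc (q * (q\<^sup>2 - q'\<^sup>2)) * oA - sc (q * (q - q') * alpha)"
  "oC * oA = sc (q'\<^sup>2) * oA * oC - sc (q' * (q\<^sup>2 - q'\<^sup>2)) * oB + sc (q' * (q - q') * beta)"
  by (rule model_eqI; simp add: oA_def oB_def oC_def model_simps)+

text \<open>\<open>oA\<close> shifts only downwards and \<open>oB\<close> only upwards, so their
  product, and with it q \<gamma> - q A B - q^2 C, is again tridiagonal. Multiplying this operator
  by C absorbs the cubic term of the Casimir element and leaves only products of two operators to
  compare.\<close>

definition oD where
  "oD = tri s (\<lambda>i. - (q * a' * Y i * g i * (b' - c * a' * q * Y i)))
     (\<lambda>i. (c + c') * Y i + a' * b * (\<Lambda> * Y i - (q + q') * (Y i)\<^sup>2))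
     (\<lambda>i. - (q' * b * Y i * (a - b * c' * q' * Y i)))"

lemma oD_eq: "oD = sc q * (sc gamma - oA * oB - sc q * oC)"
  by (rule model_eqI; simp add: oA_def oB_def oC_def oD_def model_simps)

lemma casimir_aux:
  "sc (q\<^sup>2 + q'\<^sup>2) + oD * oC - sc (q\<^sup>2) * oA * oA - sc (q'\<^sup>2) * oB * oB + sc (q * alpha) * oA + sc (q' * beta) * oB = sc omega"
  by (rule model_eqI; simp add: oA_def oB_def oC_def oD_def model_simps)

end

context aw_model
begin

lemma sc_comm: "sc l * sc m = sc m * sc l"
  by (rule endo_eqI) (simp add: app_op algebra_simps)

lemma sc_central: "oA * sc l = sc l * oA" "oB * sc l = sc l * oB" "oC * sc l = sc l * oC"
  by (simp_all add: oA_def oB_def oC_def sc_tri)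

lemma casimir:
  "sc (q\<^sup>2) + sc (q'\<^sup>2) - sc q * oA * oB * oC - sc (q\<^sup>2) * oA\<^sup>2 - sc (q'\<^sup>2) * oB\<^sup>2 - sc (q\<^sup>2) * oC\<^sup>2
   + sc q * oA * sc alpha + sc q' * oB * sc beta + sc q * oC * sc gamma = sc omega"
proof -
  interpret sc: unital_hom "sc :: 'l \<Rightarrow> 'l endo" by (rule unital_hom_sc)
  have left: "oC * (sc l * z) = sc l * (oC * z)" for l z
    by (simp add: sc_central flip: mult.assoc)
  have "oD * oC = sc q * oC * sc gamma - sc q * oA * oB * oC - sc (q\<^sup>2) * oC\<^sup>2"
    unfolding oD_eq by (simp add: algebra_simps power2_eq_square sc.mult sc_central)
  from casimir_aux[unfolded this] show ?thesis
    by (simp add: algebra_simps power2_eq_square sc.mult sc.add sc_central)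
qed

end

text \<open>Each shift leaves the coefficients of the other operator unchanged, and shifts commute
  with each other.\<close>

lemma tri_commute:
  assumes "\<And>i. u (i + r) = u i" "\<And>i. v (i + r) = v i" "\<And>i. w (i + r) = w i"
    and "\<And>i. u' (i + s) = u' i" "\<And>i. v' (i + s) = v' i" "\<And>i. w' (i + s) = w' i"
  shows "tri s u v w * tri r u' v' w' = tri r u' v' w' * tri s u v w"
proof -
  have "u (i - r) = u i" "v (i - r) = v i" "w (i - r) = w i"
    "u' (i - s) = u' i" "v' (i - s) = v' i" "w' (i - s) = w' i" for i
    using assms[of "i - r"] assms[of "i - s"] by simp_all
  note periodic = this assms
  show ?thesis
  proof (rule endo_eqI)
    fix f i
    have "i + r + s = i + s + r" "i + r - s = i - s + r" "i - r + s = i + s - r" "i - r - s = i - s - r"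
      by simp_all
    then show "app (tri s u v w * tri r u' v' w') f i = app (tri r u' v' w' * tri s u v w) f i"
      by (simp only: app_op periodic) (simp add: algebra_simps)
  qed
qed

section \<open>The model of n-th powers at a root of unity\<close>

locale aw_model_root = aw_model q q' a a' b b' c c' \<Lambda> Y Y' s for q q' a a' b b' c c' \<Lambda> :: "'l::comm_ring_1" and Y Y' s +
  fixes \<iota> :: "'k::field \<Rightarrow> 'l" and p :: 'k and n :: nat and \<kappa> \<kappa>' :: 'l
  assumes \<iota>: "unital_hom \<iota>" and p: "prim_root n p" and q'_p: "q'\<^sup>2 = \<iota> p"
    and \<Lambda>: "\<Lambda> = \<kappa> + \<kappa>'" "\<kappa> * \<kappa>' = 1"
begin

sublocale \<iota>: unital_hom \<iota> by (rule \<iota>)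
sublocale sc: unital_hom "sc :: 'l \<Rightarrow> 'l endo" by (rule unital_hom_sc)

lemma q_period: "(q'\<^sup>2) ^ n = 1" "(q\<^sup>2) ^ n = 1" "q' ^ n = q ^ n"
proof -
  show 1: "(q'\<^sup>2) ^ n = 1"
    using p by (simp add: q'_p prim_root_def \<iota>.one flip: \<iota>.power)
  have "(q\<^sup>2) ^ n = (q * q') ^ (2 * n)"
    by (simp add: power_mult_distrib 1 power_mult)
  then show 2: "(q\<^sup>2) ^ n = 1" by (simp add: inv)
  have "q' ^ n = (q\<^sup>2) ^ n * q' ^ n"
    by (simp add: 2)
  also have "\<dots> = (q * q') ^ n * q ^ n"
    by (simp add: power_mult_distrib power2_eq_square ac_simps)
  finally show "q' ^ n = q ^ n" by (simp add: inv)
qed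

lemma Y_steps: "Y (i + int k * s) = (q\<^sup>2) ^ k * Y i" "Y' (i + int k * s) = (q'\<^sup>2) ^ k * Y' i"
proof -
  have "i + int (Suc k) * s = i + int k * s + s" for k by (simp add: algebra_simps)
  then have *: "Y (i + int (Suc k) * s) = q\<^sup>2 * Y (i + int k * s)"
      "Y' (i + int (Suc k) * s) = q'\<^sup>2 * Y' (i + int k * s)" for k
    by (simp_all only: Y_shift)
  show "Y (i + int k * s) = (q\<^sup>2) ^ k * Y i" "Y' (i + int k * s) = (q'\<^sup>2) ^ k * Y' i"
    by (induction k) (simp_all only: *, simp_all add: mult.assoc)
qed

text \<open>Since q^(2n) = 1, \<open>Y\<close> has period \<open>n * s\<close>, and (q^n)^2 = 1
  makes this periodicity the step condition for \<open>Y i ^ n\<close>. All operators and identities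
  of the locale thus become available at the parameter q^n.\<close>

sublocale fr: aw_model "q ^ n" "q' ^ n" "a ^ n" "a' ^ n" "b ^ n" "b' ^ n" "c ^ n" "c' ^ n"
  "\<kappa> ^ n + \<kappa>' ^ n" "\<lambda>i. Y i ^ n" "\<lambda>i. Y' i ^ n" "int n * s"
proof
  have "(q ^ n)\<^sup>2 = 1"
    using q_period(2) by (simp add: mult.commute flip: power_mult)
  then show "Y (i + int n * s) ^ n = (q ^ n)\<^sup>2 * Y i ^ n" for i
    by (simp add: Y_steps q_period)
qed (simp_all add: inv flip: power_mult_distrib)

text \<open>Along an orbit of the shift each linear factor of \<open>g\<close> runs through a
  q-shifted factorial of length n, which collapses to 1 - z^n.\<close>

lemma g_prod: "(\<Prod>j<n. g (i + int j * s)) = fr.g i"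
proof -
  have q: "(\<Prod>j<k. 1 - \<iota> (p ^ j) * z) = qpoch \<iota> p z k" for z k
    by (induction k) (simp_all add: mult.commute)
  have "g (i + int j * s) = (1 - \<iota> (p ^ j) * (q' * \<kappa> * Y' i)) * (1 - \<iota> (p ^ j) * (q' * \<kappa>' * Y' i))" for j
  proof -
    have "\<iota> (p ^ j) = (q'\<^sup>2) ^ j"
      by (simp add: q'_p \<iota>.power)
    moreover have "(1 - r * (q' * \<kappa> * w)) * (1 - r * (q' * \<kappa>' * w))
        = 1 - q' * (\<kappa> + \<kappa>') * (r * w) + q'\<^sup>2 * (\<kappa> * \<kappa>') * (r * w)\<^sup>2" for r w
      by (simp add: algebra_simps power2_eq_square)
    ultimately show ?thesis
      unfolding g_def by (simp add: Y_steps \<Lambda>)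
  qed
  then have "(\<Prod>j<n. g (i + int j * s)) = qpoch \<iota> p (q' * \<kappa> * Y' i) n * qpoch \<iota> p (q' * \<kappa>' * Y' i) n"
    by (simp add: prod.distrib q)
  also have "\<dots> = (1 - (q' * \<kappa> * Y' i) ^ n) * (1 - (q' * \<kappa>' * Y' i) ^ n)"
    by (simp add: qpoch_prim_root[OF p \<iota>] mult.commute)
  also have "\<dots> = 1 - q' ^ n * (\<kappa> ^ n + \<kappa>' ^ n) * Y' i ^ n + (q' ^ n)\<^sup>2 * (\<kappa> * \<kappa>') ^ n * (Y' i ^ n)\<^sup>2"
    by (simp add: algebra_simps power2_eq_square power_mult_distrib)
  also have "\<dots> = fr.g i"
    by (simp add: fr.g_def \<Lambda>)
  finally show ?thesis .
qed

text \<open>\<open>ox\<close> and \<open>oz\<close> are sums of a diagonal part and a pure shift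
  that commute up to the factor \<open>p\<close>, so their n-th powers are taken termwise. The n-th
  power of the upward shift collects the product computed in \<open>g_prod\<close>.\<close>

lemma power_ops: "ox ^ n = fr.ox" "oy ^ n = fr.oy" "oz ^ n = fr.oz"
proof -
  have n: "n > 0" using p by (simp add: prim_root_def)
  have hom: "unital_hom (\<lambda>c. sc (\<iota> c))"
    by (rule unital_hom_comp[OF unital_hom_sc \<iota>])
  have diag: "tri s (\<lambda>_. 0) v (\<lambda>_. 0) ^ k = tri (int k * s) (\<lambda>_. 0) (\<lambda>i. v i ^ k) (\<lambda>_. 0)" for v k
  proof (induction k)
    case (Suc k)
    show ?case by (rule endo_eqI) (simp add: Suc app_op)
  qed (rule endo_eqI, simp add: app_op)
  then show "oy ^ n = fr.oy"
    by (simp add: oy_def fr.oy_def)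
  have down: "tri s (\<lambda>_. 0) (\<lambda>_. 0) (\<lambda>_. 1) ^ k = tri (int k * s) (\<lambda>_. 0) (\<lambda>_. 0) (\<lambda>_. 1)" if "k > 0" for k
    using that
  proof (induction k rule: nat_induct_non_zero)
    case (Suc k)
    show ?case by (rule endo_eqI) (simp add: Suc app_op algebra_simps)
  qed simp
  have up: "tri s u (\<lambda>_. 0) (\<lambda>_. 0) ^ k = tri (int k * s) (\<lambda>i. \<Prod>j<k. u (i + int j * s)) (\<lambda>_. 0) (\<lambda>_. 0)"
    if "k > 0" for u k
    using that
  proof (induction k rule: nat_induct_non_zero)
    case (Suc k)
    have "(\<Prod>j<Suc k. u (i + int j * s)) = u i * (\<Prod>j<k. u (i + s + int j * s))" for i
      by (subst prod.lessThan_Suc_shift) (simp add: algebra_simps)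
    then show ?case
      by (intro endo_eqI) (simp add: Suc app_op algebra_simps del: prod.lessThan_Suc)
  qed simp
  define d where "d = tri s (\<lambda>_. 0) Y' (\<lambda>_. 0)"
  have ox: "ox = d + tri s (\<lambda>_. 0) (\<lambda>_. 0) (\<lambda>_. 1)" and oz: "oz = d + tri s g (\<lambda>_. 0) (\<lambda>_. 0)"
    by (simp_all add: ox_def oz_def d_def tri_add)
  \<comment> \<open>In the relation v u = p u v required here the downward shift must play u, hence
    the swapped sum. For \<open>oz\<close>, where the shift goes upwards, \<open>d\<close> plays
    u.\<close>
  have "ox ^ n = d ^ n + tri s (\<lambda>_. 0) (\<lambda>_. 0) (\<lambda>_. 1) ^ n"
    unfolding ox add.commute[of d]
    by (rule trans[OF q_binomial_prim_root[OF p hom]])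
       (auto simp: d_def sc_tri q'_p[symmetric] intro!: endo_eqI simp: app_op Y_shift algebra_simps power2_eq_square
         cancel mult.left_commute[of q' q])
  also have "\<dots> = fr.ox"
    by (simp add: d_def diag down[OF n] fr.ox_def tri_add)
  finally show "ox ^ n = fr.ox" .
  have "oz ^ n = d ^ n + tri s g (\<lambda>_. 0) (\<lambda>_. 0) ^ n"
    unfolding oz
    by (rule q_binomial_prim_root[OF p hom])
       (auto simp: d_def sc_tri q'_p[symmetric] intro!: endo_eqI simp: app_op Y_shift algebra_simps)
  also have "\<dots> = fr.oz"
    by (simp add: d_def diag up[OF n] g_prod fr.oz_def tri_add)
  finally show "oz ^ n = fr.oz" .
qed

text \<open>\<open>decompose\<close> brings each operator into the form of
  \<open>q_weyl_cheb\<close> for an equitable pair rescaled by inverse factors, which preserves the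
  Weyl relation. The decomposition of the n-th power model reassembles the outcome.\<close>

lemma cheb_ops: "cheb n oA = fr.oA" "cheb n oB = fr.oB" "cheb n oC = fr.oC"
proof -
  have hom: "unital_hom (\<lambda>c. sc (\<iota> c))"
    by (rule unital_hom_comp[OF unital_hom_sc \<iota>])
  have main: "cheb n (sc u' * y + sc u * x + sc t * (1 - (sc u' * y) * (sc u * x)))
     = sc (u' ^ n) * y ^ n + sc (u ^ n) * x ^ n + sc (t ^ n) * (1 - (sc (u' ^ n) * y ^ n) * (sc (u ^ n) * x ^ n))"
    if xy: "x * y = sc (q'\<^sup>2) * y * x + sc (1 - q'\<^sup>2)" and u: "u * u' = 1"
      and x: "\<And>l. x * sc l = sc l * x" and y: "\<And>l. y * sc l = sc l * y" for x y :: "'l endo" and u u' t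
  proof -
    have left: "x * (sc l * z) = sc l * (x * z)" "y * (sc l * z) = sc l * (y * z)" for l z
      by (simp_all add: x y flip: mult.assoc)
    have pow: "(sc l * z) ^ k = sc (l ^ k) * z ^ k" if "\<And>l. z * sc l = sc l * z" for l :: 'l and z k
    proof (induction k)
      case (Suc k)
      have "z * (sc m * w) = sc m * (z * w)" for m w
        by (simp add: that flip: mult.assoc)
      then have "(sc l * z) ^ Suc k = sc l * sc (l ^ k) * z ^ Suc k"
        by (simp add: Suc mult.assoc)
      then show ?case by (simp only: power_Suc sc.mult)
    qed (simp add: sc.one)
    have scc: "sc l * sc m = sc m * sc l" for l m :: 'l by (rule sc_comm)
    have "q_weyl (\<lambda>c. sc (\<iota> c)) p (sc u * x) (sc u' * y) (sc t)"
    proof (intro q_weyl.intro hom)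
      have "sc u * x * (sc u' * y) = sc (u * u') * (x * y)"
        by (simp add: sc.mult mult.assoc left)
      also have "\<dots> = sc (u * u') * (sc (\<iota> p) * y * x + sc (1 - \<iota> p))"
        by (simp only: xy q'_p)
      also have "\<dots> = sc (\<iota> p) * (sc u' * y) * (sc u * x) + sc (\<iota> (1 - p))"
      proof -
        have "sc (\<iota> p) * (sc u' * y) * (sc u * x) = sc (\<iota> p * (u * u')) * (y * x)"
          by (simp add: sc.mult mult.assoc left) (metis mult.assoc scc)
        then show ?thesis by (simp add: u sc.one \<iota>.simps mult.assoc)
      qed
      finally show "sc u * x * (sc u' * y) = sc (\<iota> p) * (sc u' * y) * (sc u * x) + sc (\<iota> (1 - p))" .
    qed (simp_all add: mult.assoc x y left scc, (simp add: scc flip: mult.assoc)+)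
    from q_weyl_cheb[OF this p] show ?thesis
      by (simp add: pow x y sc.power)
  qed
  have cent: "ox * sc l = sc l * ox" "oy * sc l = sc l * oy" "oz * sc l = sc l * oz" for l
    by (simp_all add: ox_def oy_def oz_def sc_tri)
  show "cheb n oA = fr.oA" "cheb n oB = fr.oB" "cheb n oC = fr.oC"
    unfolding decompose fr.decompose
    by (subst main; simp add: weyl inv cent power_ops power_mult_distrib)+
qed

text \<open>The original coefficients are invariant under \<open>n * s\<close>, while those of the
  n-th power model involve only \<open>Y i ^ n\<close> and \<open>Y' i ^ n\<close>, which are
  invariant under \<open>s\<close>. This is the situation of \<open>tri_commute\<close>.\<close>

lemma central_ops:
  assumes "T \<in> {fr.oA, fr.oB, fr.oC}" "S \<in> {oA, oB, oC}"
  shows "T * S = S * T"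
proof -
  have Y: "Y (i + int n * s) = Y i" "Y' (i + int n * s) = Y' i" for i
    by (simp_all add: Y_steps q_period)
  then have g: "g (i + int n * s) = g i" for i
    by (simp add: g_def)
  have Yn: "Y (i + s) ^ n = Y i ^ n" "Y' (i + s) ^ n = Y' i ^ n" for i
    by (simp_all add: Y_shift power_mult_distrib q_period)
  then have gn: "fr.g (i + s) = fr.g i" for i
    by (simp add: fr.g_def)
  from assms show ?thesis
    unfolding oA_def oB_def oC_def fr.oA_def fr.oB_def fr.oC_def
    by (elim insertE emptyE; hypsubst; intro tri_commute; simp add: Y g Yn gn)
qed

end

section \<open>Existence and uniqueness of $\Phi_n$ and $\Psi_n$\<close>

text \<open>Chebyshev polynomials extended evenly to integer indices, so that recurrences become
  two-sided and small indices need no separate treatment.\<close>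

definition ct :: "'r::comm_ring_1 \<Rightarrow> int \<Rightarrow> 'r" where
  "ct x i = cheb (nat \<bar>i\<bar>) x"

lemma ct_minus: "ct x (- i) = ct x i"
  by (simp add: ct_def)

lemma ct_of_nat: "ct x (int n) = cheb n x"
  by (simp add: ct_def)

lemma ct_rec: "ct x (i + 1) = x * ct x i - ct x (i - 1)"
proof -
  have nonneg: "ct x (int n + 1) = x * ct x (int n) - ct x (int n - 1)" for n
  proof (cases n)
    case (Suc m)
    have "int n + 1 = int (Suc (Suc m))" "int n - 1 = int m" using Suc by simp_all
    then show ?thesis by (simp only: ct_of_nat Suc cheb_Suc_Suc)
  qed (simp add: ct_def cheb_rec algebra_simps)
  show ?thesis
  proof (cases i)
    case (nonneg n)
    then show ?thesis using \<open>\<And>n. ct x (int n + 1) = _\<close> by simp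
  next
    case (neg n)
    have "ct x (- int (Suc n) + 1) = ct x (int (Suc n) - 1)" "ct x (- int (Suc n) - 1) = ct x (int (Suc n) + 1)"
      using ct_minus[of x "int (Suc n) - 1"] ct_minus[of x "int (Suc n) + 1"] by (simp_all add: algebra_simps)
    then show ?thesis
      unfolding neg using nonneg[of "Suc n"] ct_minus[of x "int (Suc n)"] by simp
  qed
qed

lemma ct_prod: "ct x (i + j) + ct x (i - j) = ct x i * ct x j"
proof -
  have "ct x (i + int n) + ct x (i - int n) = ct x i * cheb n x" for n
  proof (induction n rule: cheb_poly.induct)
    case 2
    then show ?case using ct_rec[of x i] by (simp add: cheb_1 mult.commute)
  next
    case (3 n)
    have "ct x (i + int (Suc (Suc n))) = x * ct x (i + int (Suc n)) - ct x (i + int n)"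
      using ct_rec[of x "i + int (Suc n)"] by (simp add: algebra_simps)
    moreover have "ct x (i - int (Suc (Suc n))) = x * ct x (i - int (Suc n)) - ct x (i - int n)"
      using ct_rec[of x "i - int (Suc n)"] by (simp add: algebra_simps)
    ultimately have "ct x (i + int (Suc (Suc n))) + ct x (i - int (Suc (Suc n)))
        = x * (ct x (i + int (Suc n)) + ct x (i - int (Suc n))) - (ct x (i + int n) + ct x (i - int n))"
      by (simp add: algebra_simps)
    then show ?case
      unfolding 3 cheb_Suc_Suc by (simp add: algebra_simps)
  qed (simp add: cheb_0)
  note * = this
  show ?thesis
  proof (cases j)
    case (nonneg n)
    then show ?thesis using *[of n] by (simp add: ct_of_nat)
  next
    case (neg n)
    have "ct x (- int (Suc n)) = cheb (Suc n) x"
      by (simp only: ct_minus ct_of_nat)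
    moreover have "i + - int (Suc n) = i - int (Suc n)" "i - - int (Suc n) = i + int (Suc n)"
      by simp_all
    ultimately show ?thesis using *[of "Suc n"] unfolding neg by (simp only: add.commute)
  qed
qed

lemma cheb_cheb: "cheb m (cheb n x) = cheb (m * n) (x :: 'r::comm_ring_1)"
proof (induction m rule: cheb_poly.induct)
  case (3 m)
  have "cheb (Suc (Suc m) * n) x + cheb (m * n) x = cheb (Suc m * n) x * cheb n x"
    using ct_prod[of x "int (Suc m * n)" "int n"]
    by (simp add: ct_of_nat algebra_simps flip: of_nat_add of_nat_mult of_nat_Suc)
       (simp add: ct_def algebra_simps nat_add_distrib nat_mult_distrib)
  then show ?case
    unfolding cheb_Suc_Suc 3 by (simp add: algebra_simps)
qed (simp_all add: cheb_rec)

lemma cheb_double: "cheb (2 * n) x = cheb n x ^ 2 - (2 :: 'r::comm_ring_1)"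
  using cheb_cheb[of 2 n x] by (simp add: cheb_rec numeral_2_eq_2 power2_eq_square)

text \<open>For x = v + v^(-1) and y = w + w^(-1), \<open>u i\<close> is the sum of the i-th powers
  of v w, v w^(-1) and their inverses. Their common polynomial is palindromic with the coefficients
  x y and x^2 + y^2 - 2.\<close>

lemma ct_quadratic:
  fixes x y :: "'r::comm_ring_1"
  defines "u \<equiv> \<lambda>i. ct x i * ct y i"
  shows "u (i + 2) + u (i - 2) = x * y * (u (i + 1) + u (i - 1)) - (x\<^sup>2 + y\<^sup>2 - 2) * u i"
proof -
  have 1: "ct z (i + 2) = z * ct z (i + 1) - ct z i" "ct z (i - 1) = z * ct z i - ct z (i + 1)"
    "ct z (i - 2) = z * ct z (i - 1) - ct z i" for z :: 'r
  proof -
    have *: "i + 1 + 1 = i + 2" "i + 1 - 1 = i" "i - 1 + 1 = i" "i - 1 - 1 = i - 2"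
      by simp_all
    show "ct z (i + 2) = z * ct z (i + 1) - ct z i"
      using ct_rec[of z "i + 1"] unfolding * .
    show "ct z (i - 1) = z * ct z i - ct z (i + 1)"
      using ct_rec[of z i] by simp
    show "ct z (i - 2) = z * ct z (i - 1) - ct z i"
      using ct_rec[of z "i - 1"] unfolding * by simp
  qed
  have "ct z (i - 2) = z * (z * ct z i - ct z (i + 1)) - ct z i" for z :: 'r
    unfolding 1 ..
  note 2 = this 1(1,2)
  show ?thesis
    unfolding u_def 2 by (simp add: algebra_simps power2_eq_square)
qed

locale subring_set =
  fixes S :: "'r::comm_ring_1 set"
  assumes one: "1 \<in> S" and diff: "x \<in> S \<Longrightarrow> y \<in> S \<Longrightarrow> x - y \<in> S"
    and mult: "x \<in> S \<Longrightarrow> y \<in> S \<Longrightarrow> x * y \<in> S"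
begin

lemma zero: "0 \<in> S"
  using diff[OF one one] by simp

lemma uminus: "x \<in> S \<Longrightarrow> - x \<in> S"
  using diff[OF zero, of x] by simp

lemma add: "x \<in> S \<Longrightarrow> y \<in> S \<Longrightarrow> x + y \<in> S"
  using diff[OF _ uminus, of x y] by simp

lemma power: "x \<in> S \<Longrightarrow> x ^ n \<in> S"
  by (induction n) (simp_all add: one mult)

lemma sum: "(\<And>i. i \<in> I \<Longrightarrow> h i \<in> S) \<Longrightarrow> (\<Sum>i\<in>I. h i) \<in> S"
  by (induction I rule: infinite_finite_induct) (simp_all add: zero add)

lemma numeral: "numeral k \<in> S"
proof -
  have "of_nat n \<in> S" for n by (induction n) (simp_all add: zero one add)
  from this[of "numeral k"] show ?thesis by simp
qed

lemmas closed = zero one numeral add diff uminus mult power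

text \<open>Off-diagonal terms come in equal pairs, so the factor 2 is split off inside
  \<open>S\<close> without dividing.\<close>

lemma symmetric_double_sum:
  assumes "finite K" "\<And>k l. h k l = h l k" "\<And>k l. h k l \<in> S"
  shows "\<exists>z\<in>S. (\<Sum>k\<in>K. \<Sum>l\<in>K. h k l) = (\<Sum>k\<in>K. h k k) + 2 * z"
  using assms(1)
proof (induction K rule: finite_induct)
  case (insert a K)
  then obtain z where z: "z \<in> S" "(\<Sum>k\<in>K. \<Sum>l\<in>K. h k l) = (\<Sum>k\<in>K. h k k) + 2 * z" by blast
  have "(\<Sum>k\<in>K. h k a) = (\<Sum>l\<in>K. h a l)"
    by (simp add: assms(2))
  then have "(\<Sum>k\<in>insert a K. \<Sum>l\<in>insert a K. h k l) = (\<Sum>k\<in>insert a K. h k k) + 2 * (z + (\<Sum>l\<in>K. h a l))"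
    using insert z by (simp add: sum.distrib algebra_simps)
  moreover have "z + (\<Sum>l\<in>K. h a l) \<in> S"
    by (intro add sum z assms(3))
  ultimately show ?case by blast
qed (auto intro!: bexI[of _ 0] zero)

end

text \<open>For $X = x + x^{-1}$ and $X_j = a_j + a_j^{-1}$ let $E_1, \dots, E_4$ be $u + u^{-1}$ for
  $u = x a_0, x a_0^{-1}, a_1 a_2, a_1 a_2^{-1}$. Then $\phi_n^{(0)} = \sum_k T_n(E_k)$, and $\psi_n - 6$
  is the second elementary symmetric function of the $T_n(E_k)$. The elementary symmetric functions
  $s_1, \dots, s_4$ of the $E_k$ are polynomials in the $\phi_1^{(i)}$ and $\psi_1$; they give linear
  recurrences for $\phi_n$ and, via the bilinear form \<open>B\<close> below, for $\psi_n$. The latter avoids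
  the division by 2 in Newton's identity.\<close>

locale phi_psi = subring_set S for S :: "'r::comm_ring_1 set" +
  fixes x x0 x1 x2 :: 'r
  assumes torsion_free: "\<And>y z :: 'r. 2 * y = 2 * z \<Longrightarrow> y = z"
    and phi0: "x * x0 + x1 * x2 \<in> S" and phi1: "x * x1 + x2 * x0 \<in> S" and phi2: "x * x2 + x0 * x1 \<in> S"
    and psi: "x\<^sup>2 - 2 + x0\<^sup>2 + x1\<^sup>2 + x2\<^sup>2 + x * x0 * x1 * x2 \<in> S"
begin

text \<open>Here E_1 + E_2 = x x_0 and E_1 E_2 = x^2 + x_0^2 - 4, and similarly for E_3 and E_4 with
  x_1 and x_2. The four elementary symmetric functions come from multiplying the two
  quadratics.\<close>

definition s1 where "s1 = x * x0 + x1 * x2"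
definition s2 where "s2 = (x\<^sup>2 + x0\<^sup>2 - 4) + (x1\<^sup>2 + x2\<^sup>2 - 4) + x * x0 * x1 * x2"
definition s3 where "s3 = x * x0 * (x1\<^sup>2 + x2\<^sup>2 - 4) + x1 * x2 * (x\<^sup>2 + x0\<^sup>2 - 4)"
definition s4 where "s4 = (x\<^sup>2 + x0\<^sup>2 - 4) * (x1\<^sup>2 + x2\<^sup>2 - 4)"

lemma s_closed: "s1 \<in> S" "s2 \<in> S" "s3 \<in> S" "s4 \<in> S"
proof -
  let ?psi = "x\<^sup>2 - 2 + x0\<^sup>2 + x1\<^sup>2 + x2\<^sup>2 + x * x0 * x1 * x2"
  show "s1 \<in> S" unfolding s1_def by (rule phi0)
  have "s2 = ?psi - 6" by (simp add: s2_def)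
  also have "\<dots> \<in> S" by (intro closed psi)
  finally show "s2 \<in> S" .
  have "s3 = (x * x1 + x2 * x0) * (x * x2 + x0 * x1) - 4 * (x * x0 + x1 * x2)"
    by (simp add: s3_def algebra_simps power2_eq_square)
  also have "\<dots> \<in> S" by (intro closed phi0 phi1 phi2)
  finally show "s3 \<in> S" .
  have "s4 = (x * x1 + x2 * x0)\<^sup>2 + (x * x2 + x0 * x1)\<^sup>2 - 4 * (?psi + 2) + 16"
    by (simp add: s4_def algebra_simps power2_eq_square)
  also have "\<dots> \<in> S" by (intro closed psi phi1 phi2)
  finally show "s4 \<in> S" .
qed

definition f where "f i = ct x i * ct x0 i + ct x1 i * ct x2 i"

lemma f_minus: "f (- i) = f i"
  by (simp add: f_def ct_minus)

lemma f_abs: "f \<bar>i\<bar> = f i"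
  by (simp add: abs_if f_minus)

text \<open>The product of the four factors z + z^(-1) - E_k, set to zero and solved for z^4; the
  lower powers run from z^(-4) to z^3.\<close>

definition coef :: "int \<Rightarrow> 'r" where
  "coef k = (if k = 3 \<or> k = -3 then s1 else if k = 2 \<or> k = -2 then - (s2 + 4)
    else if k = 1 \<or> k = -1 then 3 * s1 + s3 else if k = 0 then - (2 * s2 + s4 + 6) else -1)"

lemma coef_closed: "coef k \<in> S"
  unfolding coef_def by (auto intro!: closed s_closed)

lemma f_rec: "f (i + 4) = s1 * (f (i + 3) + 3 * f (i + 1) + 3 * f (i - 1) + f (i - 3))
   - s2 * (f (i + 2) + 2 * f i + f (i - 2)) + s3 * (f (i + 1) + f (i - 1)) - s4 * f i
   - 4 * f (i + 2) - 6 * f i - 4 * f (i - 2) - f (i - 4)"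
proof -
  have quartic: "u (i + 4) = (e + e') * (u (i + 3) + 3 * u (i + 1) + 3 * u (i - 1) + u (i - 3))
     - (h + h' + e * e') * (u (i + 2) + 2 * u i + u (i - 2)) + (e * h' + e' * h) * (u (i + 1) + u (i - 1))
     - h * h' * u i - 4 * u (i + 2) - 6 * u i - 4 * u (i - 2) - u (i - 4)"
    if *: "\<And>i. u (i + 2) + u (i - 2) = e * (u (i + 1) + u (i - 1)) - (h + 2) * u i" for u :: "int \<Rightarrow> 'r" and e h e' h'
  proof -
    \<comment> \<open>\<open>D\<close> is the two-sided recurrence for one pair of the E_k. Applying
      the recurrence operator of the other pair to a vanishing sequence yields the full recurrence,
      whatever \<open>e'\<close> and \<open>h'\<close> are.\<close>
    define D where "D j = u (j + 2) + u (j - 2) - (e * (u (j + 1) + u (j - 1)) - (h + 2) * u j)" for j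
    have "D j = 0" for j by (simp add: D_def *)
    then have "D (i + 2) - e' * (D (i + 1) + D (i - 1)) + (h' + 2) * D i + D (i - 2) = 0"
      by simp
    then show ?thesis
      unfolding D_def by (simp add: algebra_simps)
  qed
  have sums: "s1 = x * x0 + x1 * x2"
    "s2 = (x\<^sup>2 + x0\<^sup>2 - 4) + (x1\<^sup>2 + x2\<^sup>2 - 4) + (x * x0) * (x1 * x2)"
    "s3 = x * x0 * (x1\<^sup>2 + x2\<^sup>2 - 4) + x1 * x2 * (x\<^sup>2 + x0\<^sup>2 - 4)"
    "s4 = (x\<^sup>2 + x0\<^sup>2 - 4) * (x1\<^sup>2 + x2\<^sup>2 - 4)"
    by (simp_all add: s1_def s2_def s3_def s4_def)
  have u: "ct x (i + 4) * ct x0 (i + 4) = s1 * (ct x (i + 3) * ct x0 (i + 3) + 3 * (ct x (i + 1) * ct x0 (i + 1))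
      + 3 * (ct x (i - 1) * ct x0 (i - 1)) + ct x (i - 3) * ct x0 (i - 3))
     - s2 * (ct x (i + 2) * ct x0 (i + 2) + 2 * (ct x i * ct x0 i) + ct x (i - 2) * ct x0 (i - 2))
     + s3 * (ct x (i + 1) * ct x0 (i + 1) + ct x (i - 1) * ct x0 (i - 1))
     - s4 * (ct x i * ct x0 i) - 4 * (ct x (i + 2) * ct x0 (i + 2)) - 6 * (ct x i * ct x0 i)
     - 4 * (ct x (i - 2) * ct x0 (i - 2)) - ct x (i - 4) * ct x0 (i - 4)"
    unfolding sums by (rule quartic) (subst ct_quadratic, simp add: algebra_simps)
  have v: "ct x1 (i + 4) * ct x2 (i + 4) = s1 * (ct x1 (i + 3) * ct x2 (i + 3) + 3 * (ct x1 (i + 1) * ct x2 (i + 1))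
      + 3 * (ct x1 (i - 1) * ct x2 (i - 1)) + ct x1 (i - 3) * ct x2 (i - 3))
     - s2 * (ct x1 (i + 2) * ct x2 (i + 2) + 2 * (ct x1 i * ct x2 i) + ct x1 (i - 2) * ct x2 (i - 2))
     + s3 * (ct x1 (i + 1) * ct x2 (i + 1) + ct x1 (i - 1) * ct x2 (i - 1))
     - s4 * (ct x1 i * ct x2 i) - 4 * (ct x1 (i + 2) * ct x2 (i + 2)) - 6 * (ct x1 i * ct x2 i)
     - 4 * (ct x1 (i - 2) * ct x2 (i - 2)) - ct x1 (i - 4) * ct x2 (i - 4)"
  proof -
    have sums': "s1 = x1 * x2 + x * x0"
      "s2 = (x1\<^sup>2 + x2\<^sup>2 - 4) + (x\<^sup>2 + x0\<^sup>2 - 4) + (x1 * x2) * (x * x0)"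
      "s3 = x1 * x2 * (x\<^sup>2 + x0\<^sup>2 - 4) + x * x0 * (x1\<^sup>2 + x2\<^sup>2 - 4)"
      "s4 = (x1\<^sup>2 + x2\<^sup>2 - 4) * (x\<^sup>2 + x0\<^sup>2 - 4)"
      by (simp_all add: sums algebra_simps)
    show ?thesis
      unfolding sums' by (rule quartic) (subst ct_quadratic, simp add: algebra_simps)
  qed
  show ?thesis
    unfolding f_def u v by (simp add: distrib_left right_diff_distrib)
qed

lemma f_rec_sum: "f (i + 4) = (\<Sum>k=-4..3. coef k * f (i + k))"
proof -
  have "{-4..3::int} = {-4,-3,-2,-1,0,1,2,3}" by auto
  then show ?thesis
    unfolding f_rec by (simp add: coef_def algebra_simps)
qed

lemma f_small:
  "f 0 = 8" "f 1 = s1" "f 2 = s1^2 - 2 * s2 - 8"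
  "f 3 = s1^3 - 3 * s1 * s2 - 3 * s1 + 3 * s3"
  "f 4 = s1^4 - 4 * s1^2 * s2 - 4 * s1^2 + 4 * s1 * s3 + 2 * s2^2 + 8 * s2 - 4 * s4 + 8"
proof -
  have 2: "ct z 2 = z\<^sup>2 - 2" and 3: "ct z 3 = z ^ 3 - 3 * z" and 4: "ct z 4 = z ^ 4 - 4 * z\<^sup>2 + 2" for z :: 'r
    by (simp_all add: ct_def cheb_rec eval_nat_numeral algebra_simps)
  show "f 0 = 8" "f 1 = s1" "f 2 = s1^2 - 2 * s2 - 8"
    "f 3 = s1^3 - 3 * s1 * s2 - 3 * s1 + 3 * s3"
    "f 4 = s1^4 - 4 * s1^2 * s2 - 4 * s1^2 + 4 * s1 * s3 + 2 * s2^2 + 8 * s2 - 4 * s4 + 8"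
    by (simp_all add: f_def s1_def s2_def s3_def s4_def 2 3 4)
       (simp_all add: ct_def cheb_rec eval_nat_numeral algebra_simps)
qed

text \<open>The starting value \<open>r 4\<close> is computed from \<open>B 4 4\<close>, which
  contains \<open>f 8\<close>; hence explicit values up to that index.\<close>

lemma f_5: "f 5 = s1^5 - 5 * s1^3 * s2 - 5 * s1^3 + 5 * s1^2 * s3 + 5 * s1 * s2^2 + 15 * s1 * s2 - 5 * s1 * s4 + 5 * s1 - 5 * s2 * s3 - 15 * s3"
  using f_rec[of 1] f_minus[of 1] f_minus[of 2] f_minus[of 3]
  by (simp add: f_small algebra_simps eval_nat_numeral)

lemma f_6: "f 6 = s1^6 - 6 * s1^4 * s2 - 6 * s1^4 + 6 * s1^3 * s3 + 9 * s1^2 * s2^2 + 24 * s1^2 * s2 - 6 * s1^2 * s4 + 9 * s1^2 - 12 * s1 * s2 * s3 - 24 * s1 * s3 - 2 * s2^3 - 12 * s2^2 + 6 * s2 * s4 - 18 * s2 + 3 * s3^2 + 24 * s4 - 8"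
  using f_rec[of 2] f_minus[of 1] f_minus[of 2] f_minus[of 3]
  by (simp add: f_small f_5 algebra_simps eval_nat_numeral)

lemma f_7: "f 7 = s1^7 - 7 * s1^5 * s2 - 7 * s1^5 + 7 * s1^4 * s3 + 14 * s1^3 * s2^2 + 35 * s1^3 * s2 - 7 * s1^3 * s4 + 14 * s1^3 - 21 * s1^2 * s2 * s3 - 35 * s1^2 * s3 - 7 * s1 * s2^3 - 35 * s1 * s2^2 + 14 * s1 * s2 * s4 - 42 * s1 * s2 + 7 * s1 * s3^2 + 35 * s1 * s4 - 7 * s1 + 7 * s2^2 * s3 + 35 * s2 * s3 - 7 * s3 * s4 + 42 * s3"
  using f_rec[of 3] f_minus[of 1] f_minus[of 2] f_minus[of 3]
  by (simp add: f_small f_5 f_6 algebra_simps eval_nat_numeral)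

lemma f_8: "f 8 = s1^8 - 8 * s1^6 * s2 - 8 * s1^6 + 8 * s1^5 * s3 + 20 * s1^4 * s2^2 + 48 * s1^4 * s2 - 8 * s1^4 * s4 + 20 * s1^4 - 32 * s1^3 * s2 * s3 - 48 * s1^3 * s3 - 16 * s1^2 * s2^3 - 72 * s1^2 * s2^2 + 24 * s1^2 * s2 * s4 - 80 * s1^2 * s2 + 12 * s1^2 * s3^2 + 48 * s1^2 * s4 - 16 * s1^2 + 24 * s1 * s2^2 * s3 + 96 * s1 * s2 * s3 - 16 * s1 * s3 * s4 + 80 * s1 * s3 + 2 * s2^4 + 16 * s2^3 - 8 * s2^2 * s4 + 40 * s2^2 - 8 * s2 * s3^2 - 48 * s2 * s4 + 32 * s2 - 24 * s3^2 + 4 * s4^2 - 80 * s4 + 8"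
  using f_rec[of 4] f_minus[of 1] f_minus[of 2] f_minus[of 3]
  by (simp add: f_small f_5 f_6 f_7 algebra_simps eval_nat_numeral)

lemma f_closed: "f i \<in> S"
proof -
  have "f (int n) \<in> S" for n
  proof (induction n rule: less_induct)
    case (less n)
    show ?case
    \<comment> \<open>For \<open>n = 4\<close> the recurrence reaches back to index -4 and so to
      \<open>f 4\<close> itself, which makes 4 part of the base.\<close>
    proof (cases "n \<le> 4")
      case True
      then have "n \<in> {0, 1, 2, 3, 4}" by auto
      then show ?thesis
        by (auto simp: f_small intro!: closed s_closed)
    next
      case False
      have "f (int n - 4 + k) \<in> S" if "k \<in> {-4..3}" for k
      proof -
        have "f (int n - 4 + k) = f (int (nat \<bar>int n - 4 + k\<bar>))"
          by (simp add: f_abs)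
        moreover have "nat \<bar>int n - 4 + k\<bar> < n"
          using that False by auto
        ultimately show ?thesis using less[of "nat \<bar>int n - 4 + k\<bar>"] by metis
      qed
      then have "(\<Sum>k=-4..3. coef k * f (int n - 4 + k)) \<in> S"
        by (intro sum mult coef_closed) auto
      then show ?thesis using f_rec_sum[of "int n - 4"] by simp
    qed
  qed
  from this[of "nat \<bar>i\<bar>"] show ?thesis
    by (simp add: f_abs)
qed

definition r where
  "r i = ct x (2 * i) + ct x0 i ^ 2 + ct x1 i ^ 2 + ct x2 i ^ 2 + ct x i * ct x0 i * ct x1 i * ct x2 i - 6"

lemma r_abs: "r \<bar>i\<bar> = r i"
  using ct_minus[of x "2 * i"] by (simp add: r_def ct_minus abs_if)

text \<open>As T_(i+j) + T_(i-j) = T_i T_j, this is the sum of T_i(E_k) T_j(E_l) over k different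
  from l: the polarized form of Newton's identity. On the diagonal it is twice the second elementary
  symmetric function.\<close>

definition B where "B i j = f i * f j - f (i + j) - f (i - j)"

lemma B_sym: "B i j = B j i"
  using f_minus[of "i - j"] by (simp add: B_def ac_simps)

lemma B_rec: "B (i + 4) j = (\<Sum>k=-4..3. coef k * B (i + k) j)"
proof -
  have "f (i + 4 + j) = (\<Sum>k=-4..3. coef k * f (i + k + j))" "f (i + 4 - j) = (\<Sum>k=-4..3. coef k * f (i + k - j))"
    using f_rec_sum[of "i + j"] f_rec_sum[of "i - j"] by (simp_all add: algebra_simps)
  then show ?thesis
    unfolding B_def f_rec_sum[of i]
    by (simp add: right_diff_distrib sum_subtractf sum_distrib_right mult.assoc)
qed

lemma ct_double: "ct z (2 * i) = (ct z i)\<^sup>2 - 2"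
  using ct_prod[of z i i] by (simp add: power2_eq_square ct_def cheb_0 eq_diff_eq)

lemma two_r: "2 * r i = B i i"
proof -
  have "f (i - i) = 8" and i: "i + i = 2 * i" by (simp_all add: f_small)
  then show ?thesis
    unfolding B_def r_def i f_def ct_double by (simp add: algebra_simps power2_eq_square)
qed

lemma r_small:
  "r 0 = 24" "r 1 = s2" "r 2 = - (6 * s1^2) - 2 * s1 * s3 + s2^2 + 12 * s2 + 2 * s4 + 24"
  "r 3 = - (3 * s1^2 * s2) + 3 * s1^2 * s4 - 3 * s1 * s2 * s3 + 3 * s1 * s3 + s2^3 + 6 * s2^2 - 3 * s2 * s4 + 9 * s2 + 3 * s3^2 - 12 * s4"
  "r 4 = 6 * s1^4 + 8 * s1^3 * s3 - 4 * s1^2 * s2^2 + 4 * s1^2 * s2 * s4 - 24 * s1^2 * s2 + 2 * s1^2 * s3^2 - 8 * s1^2 * s4 - 24 * s1^2 - 4 * s1 * s2^2 * s3 - 16 * s1 * s2 * s3 - 8 * s1 * s3 * s4 - 8 * s1 * s3 + s2^4 + 8 * s2^3 - 4 * s2^2 * s4 + 28 * s2^2 + 4 * s2 * s3^2 - 8 * s2 * s4 + 48 * s2 + 12 * s3^2 + 6 * s4^2 + 8 * s4 + 24"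
  by (rule torsion_free; simp add: two_r B_def f_small f_5 f_6 f_7 f_8 algebra_simps eval_nat_numeral)+

text \<open>Expanding \<open>B (i + 4) (i + 4)\<close> in both arguments gives twice a combination
  of earlier values of \<open>r\<close> on the diagonal and, by symmetry, twice an element of
  \<open>S\<close> off it. The common factor 2 cancels in the torsion-free ring.\<close>

lemma r_closed: "r (int n) \<in> S"
proof (induction n rule: less_induct)
  case (less n)
  show ?case
  proof (cases "n \<le> 4")
    case True
    then have "n \<in> {0, 1, 2, 3, 4}" by auto
    then show ?thesis
      by (auto simp: r_small intro!: closed s_closed)
  next
    case False
    define i where "i = int n - 4"
    have rK: "r (i + k) \<in> S" if "k \<in> {-4..3}" for k
    proof -
      have "r (i + k) = r (int (nat \<bar>i + k\<bar>))"
        by (simp add: r_abs)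
      moreover have "nat \<bar>i + k\<bar> < n"
        using that False by (auto simp: i_def)
      ultimately show ?thesis using less[of "nat \<bar>i + k\<bar>"] by metis
    qed
    have "\<exists>z\<in>S. (\<Sum>k=-4..3. \<Sum>l=-4..3. coef k * coef l * B (i + k) (i + l))
       = (\<Sum>k=-4..3. coef k * coef k * B (i + k) (i + k)) + 2 * z"
    proof (rule symmetric_double_sum)
      show "coef k * coef l * B (i + k) (i + l) \<in> S" for k l
        unfolding B_def by (intro closed coef_closed f_closed)
      show "coef k * coef l * B (i + k) (i + l) = coef l * coef k * B (i + l) (i + k)" for k l
        by (simp add: B_sym[of "i + k" "i + l"])
    qed simp
    then obtain z where z: "z \<in> S" "(\<Sum>k=-4..3. \<Sum>l=-4..3. coef k * coef l * B (i + k) (i + l))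
       = (\<Sum>k=-4..3. coef k * coef k * B (i + k) (i + k)) + 2 * z" by blast
    have "B (i + 4) (i + 4) = (\<Sum>k=-4..3. coef k * B (i + 4) (i + k))"
      by (subst B_rec) (simp add: B_sym)
    also have "\<dots> = (\<Sum>k=-4..3. \<Sum>l=-4..3. coef k * coef l * B (i + k) (i + l))"
      unfolding B_rec by (simp add: sum_distrib_left mult.assoc B_sym)
    also note z(2)
    finally have "2 * r (i + 4) = 2 * ((\<Sum>k=-4..3. coef k * coef k * r (i + k)) + z)"
      by (simp add: sum_distrib_left distrib_left mult.left_commute[of 2] flip: two_r)
    then have "r (i + 4) = (\<Sum>k=-4..3. coef k * coef k * r (i + k)) + z"
      by (rule torsion_free)
    also have "\<dots> \<in> S"
      by (intro closed sum z coef_closed rK)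
    finally show ?thesis by (simp add: i_def)
  qed
qed

end

section \<open>Leading terms\<close>

declare split_paired_All [simp del] split_paired_Ex [simp del]

type_synonym expo = "int \<times> int \<times> int \<times> int \<times> int"
type_synonym 'k laurent = "expo \<Rightarrow>\<^sub>0 'k"

text \<open>The exponents belong to $a, b, c, \lambda, \eta$; the sequence index is a sixth exponent. For the weight
  below each of $A, B, C, \alpha, \beta, \gamma$ has a unique term of highest weight, and the exponents of
  these six terms are linearly independent.\<close>

fun wt :: "expo \<Rightarrow> int \<Rightarrow> int" where
  "wt (a, b, c, l, h) i = a + b + c + 30 * l + 10 * h + 10 * i"

text \<open>Singled out because \<open>Y i\<close> contains q^(2i) along with its variable: a term
  of degree h in \<eta> acts at index i with the factor q^(2hi).\<close>

fun eta :: "expo \<Rightarrow> int" where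
  "eta (a, b, c, l, h) = h"

lemma wt_diff: "wt (w - m) (i - e) = wt w i - wt m e"
  by (cases w; cases m) (simp add: algebra_simps)

lemma wt_add: "wt (w + m) (i + e) = wt w i + wt m e"
  by (cases w; cases m) (simp add: algebra_simps)

lemma eta_add: "eta (w + m) = eta w + eta m"
  by (cases w; cases m) simp

lemma wt_zero: "wt 0 0 = 0" and eta_zero: "eta 0 = 0"
  by (simp_all add: zero_prod_def)

definition bnd :: "int \<Rightarrow> (int \<Rightarrow> 'k::field laurent) \<Rightarrow> bool" where
  "bnd K f \<longleftrightarrow> (\<forall>i w. K < wt w i \<longrightarrow> lookup (f i) w = 0)"

lemma bndD: "bnd K f \<Longrightarrow> K < wt w i \<Longrightarrow> lookup (f i) w = 0"
  by (simp add: bnd_def)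

definition low :: "int \<Rightarrow> 'k::field laurent endo \<Rightarrow> bool" where
  "low N T \<longleftrightarrow> (\<forall>K f. bnd K f \<longrightarrow> (\<forall>i w. K + N \<le> wt w i \<longrightarrow> lookup (app T f i) w = 0))"

text \<open>The symbol of an operator: modulo operators that add less than \<open>wt m e\<close> to
  the weight, \<open>T\<close> multiplies by a monomial and shifts the index by \<open>e\<close>,
  with the power of q that belongs to \<eta>.\<close>

definition lead :: "'k::field \<Rightarrow> 'k laurent endo \<Rightarrow> 'k \<Rightarrow> expo \<Rightarrow> int \<Rightarrow> bool" where
  "lead q T \<kappa> m e \<longleftrightarrow> (\<forall>K f. bnd K f \<longrightarrow> (\<forall>i w. K + wt m e \<le> wt w i \<longrightarrow>
     lookup (app T f i) w = \<kappa> * q powi (2 * eta m * i) * lookup (f (i - e)) (w - m)))"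

abbreviation con :: "'k::field \<Rightarrow> 'k laurent endo" where
  "con c \<equiv> sc (single 0 c)"

lemma unital_hom_single: "unital_hom (single 0 :: 'k::ring_1 \<Rightarrow> 'm::monoid_add \<Rightarrow>\<^sub>0 'k)"
  by unfold_locales (simp_all add: single_add mult_single)

lemma unital_hom_con: "unital_hom (con :: 'k::field \<Rightarrow> _)"
  by (rule unital_hom_comp[OF unital_hom_sc unital_hom_single])

lemma lookup_numeral_mult:
  fixes g :: "'m::ab_group_add \<Rightarrow>\<^sub>0 'k::ring_1"
  shows "lookup (numeral k * g) w = numeral k * lookup g w"
  using lookup_single_mult[of 0 "numeral k" g w] by simp

lemma lookup_app_con: "lookup (app (con c * T) f i) w = c * lookup (app T f i) w"
  by (simp add: app_op lookup_single_mult)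

lemma lookup_app_sum: "lookup (app (\<Sum>j\<in>I. T j) f i) w = (\<Sum>j\<in>I. lookup (app (T j) f i) w)"
  by (induction I rule: infinite_finite_induct) (simp_all add: app_simps lookup_add)

lemma low_mono: "low N T \<Longrightarrow> N \<le> N' \<Longrightarrow> low N' T"
  unfolding low_def by (meson add_left_mono order_trans)

lemma low_zero: "low N 0"
  by (simp add: low_def app_simps)

lemma low_add: "low N S \<Longrightarrow> low N T \<Longrightarrow> low N (S + T)"
  by (simp add: low_def app_simps lookup_add)

lemma low_diff: "low N S \<Longrightarrow> low N T \<Longrightarrow> low N (S - T)"
  by (simp add: low_def app_simps lookup_minus)

lemma low_con: "low N T \<Longrightarrow> low N (con c * T)"
  by (simp add: low_def lookup_app_con)

lemma low_sum: "(\<And>j. j \<in> I \<Longrightarrow> low N (T j)) \<Longrightarrow> low N (\<Sum>j\<in>I. T j)"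
  by (induction I rule: infinite_finite_induct) (simp_all add: low_add low_zero)

lemma lead_low:
  assumes "lead q T \<kappa> m e" "wt m e < N"
  shows "low N T"
  unfolding low_def
proof (intro allI impI)
  fix K i w and f :: "int \<Rightarrow> 'a laurent"
  assume f: "bnd K f" and "K + N \<le> wt w i"
  with assms(2) have "K + wt m e \<le> wt w i" "K < wt (w - m) (i - e)"
    by (simp_all add: wt_diff)
  then show "lookup (app T f i) w = 0"
    using assms(1) f bndD[OF f] unfolding lead_def by simp
qed

lemma lead_add_low: "lead q T \<kappa> m e \<Longrightarrow> low (wt m e) U \<Longrightarrow> lead q (T + U) \<kappa> m e"
  by (simp add: lead_def low_def app_simps lookup_add)

lemma lead_con: "lead q T \<kappa> m e \<Longrightarrow> lead q (con c * T) (c * \<kappa>) m e"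
  by (simp add: lead_def lookup_app_con mult.assoc)

lemma lead_bnd:
  assumes "lead q T \<kappa> m e" "bnd K f"
  shows "bnd (K + wt m e) (app T f)"
  unfolding bnd_def
proof (intro allI impI)
  fix i w assume "K + wt m e < wt w i"
  then have "K + wt m e \<le> wt w i" "K < wt (w - m) (i - e)"
    by (simp_all add: wt_diff)
  then show "lookup (app T f i) w = 0"
    using assms(1) bndD[OF assms(2)] assms(2) unfolding lead_def by simp
qed

lemma lead_one: "lead q 1 1 0 0"
  by (simp add: lead_def app_simps wt_zero eta_zero)

text \<open>The first factor shifts the index at which the power of q of the second is taken. The
  resulting twist makes symbols a quantum torus, where monomials commute only up to powers of
  q.\<close>

lemma lead_mult:
  assumes q: "q \<noteq> 0" and 1: "lead q S \<kappa> m e" and 2: "lead q T \<kappa>' m' e'"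
  shows "lead q (S * T) (\<kappa> * \<kappa>' * q powi (- 2 * eta m' * e)) (m + m') (e + e')"
  unfolding lead_def
proof (intro allI impI)
  fix K i w and f :: "int \<Rightarrow> 'a laurent"
  assume f: "bnd K f" and "K + wt (m + m') (e + e') \<le> wt w i"
  then have w: "(K + wt m' e') + wt m e \<le> wt w i" "K + wt m' e' \<le> wt (w - m) (i - e)"
    by (simp_all add: wt_add wt_diff)
  have "lookup (app (S * T) f i) w
      = \<kappa> * q powi (2 * eta m * i) * lookup (app T f (i - e)) (w - m)"
    using 1 lead_bnd[OF 2 f] w(1) unfolding lead_def by (simp add: app_simps)
  also have "lookup (app T f (i - e)) (w - m)
      = \<kappa>' * q powi (2 * eta m' * (i - e)) * lookup (f (i - e - e')) (w - m - m')"
    using 2 f w(2) unfolding lead_def by blast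
  also have "q powi (2 * eta m' * (i - e)) = q powi (2 * eta m' * i) * q powi (- 2 * eta m' * e)"
    by (subst power_int_add[symmetric]) (simp_all add: q algebra_simps)
  finally show "lookup (app (S * T) f i) w
      = \<kappa> * \<kappa>' * q powi (- 2 * eta m' * e) * q powi (2 * eta (m + m') * i)
        * lookup (f (i - (e + e'))) (w - (m + m'))"
    by (simp add: eta_add distrib_left distrib_right power_int_add q diff_diff_eq)
qed

definition Lead :: "'k::field \<Rightarrow> 'k laurent endo \<Rightarrow> expo \<Rightarrow> int \<Rightarrow> bool" where
  "Lead q T m e \<longleftrightarrow> (\<exists>\<kappa>. \<kappa> \<noteq> 0 \<and> lead q T \<kappa> m e)"

lemma Lead_mult:
  assumes "q \<noteq> 0" "Lead q S m e" "Lead q T m' e'"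
  shows "Lead q (S * T) (m + m') (e + e')"
proof -
  obtain \<kappa> \<kappa>' where "\<kappa> \<noteq> 0" "\<kappa>' \<noteq> 0" and *: "lead q S \<kappa> m e" "lead q T \<kappa>' m' e'"
    using assms unfolding Lead_def by blast
  moreover from this have "\<kappa> * \<kappa>' * q powi (- 2 * eta m' * e) \<noteq> 0"
    using assms(1) by simp
  ultimately show ?thesis
    unfolding Lead_def using lead_mult[OF assms(1) *] by blast
qed

fun smul :: "int \<Rightarrow> expo \<Rightarrow> expo" where
  "smul k (a, b, c, l, h) = (k * a, k * b, k * c, k * l, k * h)"

lemma wt_smul: "wt (smul k m) (k * e) = k * wt m e"
  by (cases m) (simp add: algebra_simps)

lemma Lead_power:
  assumes "q \<noteq> 0" "Lead q T m e"
  shows "Lead q (T ^ k) (smul (int k) m) (int k * e)"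
proof (induction k)
  case 0
  have "smul 0 m = 0" by (cases m) (simp add: zero_prod_def)
  then show ?case using lead_one[of q] by (auto simp: Lead_def intro!: exI[of _ 1])
next
  case (Suc k)
  have "m + smul (int k) m = smul (int (Suc k)) m" by (cases m) (simp add: algebra_simps)
  moreover have "e + int k * e = int (Suc k) * e" by (simp add: algebra_simps)
  ultimately show ?case using Lead_mult[OF assms Suc] by (simp only: power_Suc)
qed

lemma Lead_add_low: "Lead q T m e \<Longrightarrow> low (wt m e) U \<Longrightarrow> Lead q (T + U) m e"
  unfolding Lead_def using lead_add_low by blast

lemma Lead_low: "Lead q T m e \<Longrightarrow> wt m e < N \<Longrightarrow> low N T"
  unfolding Lead_def using lead_low by blast

text \<open>With positive weight the top power dominates. Degree 0 is excluded because T_0 = 2 may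
  vanish in the field.\<close>

lemma Lead_cheb:
  assumes q: "q \<noteq> 0" and T: "Lead q T m e" and pos: "0 < wt m e"
  shows "Lead q (cheb (Suc k) T) (smul (int (Suc k)) m) (int (Suc k) * e)"
proof -
  have "\<exists>U. cheb (Suc k) T = T ^ Suc k + U \<and> low (int (Suc k) * wt m e) U"
  proof (induction k rule: less_induct)
    case (less k)
    show ?case
    proof (cases k)
      case 0
      then show ?thesis by (auto simp: cheb_1 low_zero)
    next
      case (Suc j)
      then obtain U where U: "cheb k T = T ^ k + U" "low (int k * wt m e) U"
        using less[of j] by auto
      have TU: "low (int (Suc k) * wt m e) (T * U)"
      proof -
        obtain \<kappa> where \<kappa>: "lead q T \<kappa> m e" using T by (auto simp: Lead_def)
        show ?thesis unfolding low_def
        proof (intro allI impI)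
          fix K i w and f :: "int \<Rightarrow> 'a laurent"
          assume f: "bnd K f" and w: "K + int (Suc k) * wt m e \<le> wt w i"
          have b: "bnd (K + int k * wt m e) (app U f)"
            using U(2) f unfolding bnd_def low_def by simp
          have "(K + int k * wt m e) + wt m e \<le> wt w i"
            using w by (simp add: algebra_simps)
          moreover from this have "K + int k * wt m e \<le> wt (w - m) (i - e)"
            by (simp add: wt_diff)
          ultimately show "lookup (app (T * U) f i) w = 0"
            using \<kappa> b U(2) f unfolding lead_def low_def by (simp add: app_simps)
        qed
      qed
      have "low (int (Suc k) * wt m e) (cheb j T)"
      proof (cases j)
        case 0
        have "low (int (Suc k) * wt m e) 1"
          using pos by (intro lead_low[OF lead_one]) (simp add: wt_zero)
        then show ?thesis
          using low_add[of _ 1 1] by (simp add: 0 cheb_0)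
      next
        case (Suc i)
        then obtain V where V: "cheb j T = T ^ j + V" "low (int j * wt m e) V"
          using less[of i] \<open>k = Suc j\<close> by auto
        have "low (int (Suc k) * wt m e) (T ^ j)"
        proof (rule Lead_low[OF Lead_power[OF q T]])
          show "wt (smul (int j) m) (int j * e) < int (Suc k) * wt m e"
            unfolding wt_smul using pos \<open>k = Suc j\<close> by (simp add: algebra_simps)
        qed
        moreover have "low (int (Suc k) * wt m e) V"
          using V(2) pos \<open>k = Suc j\<close> by (intro low_mono[OF V(2)]) (simp add: algebra_simps)
        ultimately show ?thesis unfolding V(1) by (rule low_add)
      qed
      then have "low (int (Suc k) * wt m e) (T * U - cheb j T)"
        by (rule low_diff[OF TU])
      moreover have "cheb (Suc k) T = T ^ Suc k + (T * U - cheb j T)"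
        using U(1) Suc by (simp add: cheb_Suc_Suc distrib_left)
      ultimately show ?thesis by blast
    qed
  qed
  then obtain U where U: "cheb (Suc k) T = T ^ Suc k + U" "low (int (Suc k) * wt m e) U" by blast
  show ?thesis
    unfolding U(1) by (rule Lead_add_low[OF Lead_power[OF q T]]) (simp only: wt_smul U(2))
qed

text \<open>Applied to the sequence supported at 0, a term of maximal weight is the only one to
  contribute at its own exponent and index. Assuming only \<open>low N\<close> instead of a
  vanishing sum allows the coefficients of weight at least \<open>N\<close> to be read off.\<close>

lemma lead_independent:
  fixes q :: "'k::field"
  assumes fin: "finite I" and T: "\<And>j. j \<in> I \<Longrightarrow> Lead q (T j) (m j) (e j)" and q: "q \<noteq> 0"
    and inj: "inj_on (\<lambda>j. (m j, e j)) I"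
    and low: "low N (\<Sum>j\<in>I. con (c j) * T j)"
    and i: "i \<in> I" "N \<le> wt (m i) (e i)"
  shows "c i = 0"
proof (rule ccontr)
  assume "c i \<noteq> 0"
  define J where "J = {j \<in> I. c j \<noteq> 0 \<and> N \<le> wt (m j) (e j)}"
  have "finite J" "J \<noteq> {}" using fin i \<open>c i \<noteq> 0\<close> by (auto simp: J_def)
  then obtain k where k: "k \<in> J" and max: "\<And>j. j \<in> J \<Longrightarrow> wt (m j) (e j) \<le> wt (m k) (e k)"
  proof -
    let ?M = "Max ((\<lambda>j. wt (m j) (e j)) ` J)"
    have "?M \<in> (\<lambda>j. wt (m j) (e j)) ` J"
      using \<open>finite J\<close> \<open>J \<noteq> {}\<close> by (intro Max_in) auto
    then obtain k where "k \<in> J" "?M = wt (m k) (e k)" by blast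
    then show ?thesis
      using \<open>finite J\<close> by (intro that[of k]) (auto intro: Max_ge simp flip: \<open>?M = _\<close>)
  qed
  define \<delta> :: "int \<Rightarrow> 'k laurent" where "\<delta> i = (if i = 0 then 1 else 0)" for i
  have \<delta>: "lookup (\<delta> i) w = (if i = 0 \<and> w = 0 then 1 else 0)" for i w
    by (simp add: \<delta>_def lookup_one when_def)
  have bnd: "bnd 0 \<delta>"
    by (simp add: bnd_def \<delta> zero_prod_def)
  obtain \<kappa> where \<kappa>: "\<kappa> \<noteq> 0" "lead q (T k) \<kappa> (m k) (e k)"
    using T k by (auto simp: J_def Lead_def)
  have zero: "c j * lookup (app (T j) \<delta> (e k)) (m k) = 0" if jI: "j \<in> I" "j \<noteq> k" for j
  proof (cases "c j = 0")
    case False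
    have le: "wt (m j) (e j) \<le> wt (m k) (e k)"
      using max[of j] that False k by (cases "N \<le> wt (m j) (e j)") (auto simp: J_def)
    obtain \<kappa>' where "lead q (T j) \<kappa>' (m j) (e j)"
      using T jI by (auto simp: Lead_def)
    then have "lookup (app (T j) \<delta> (e k)) (m k)
        = \<kappa>' * q powi (2 * eta (m j) * e k) * lookup (\<delta> (e k - e j)) (m k - m j)"
      using bnd le unfolding lead_def by simp
    moreover have "\<not> (e k - e j = 0 \<and> m k - m j = 0)"
      using inj that k by (auto simp: inj_on_def J_def)
    ultimately show ?thesis by (auto simp: \<delta>)
  qed simp
  have "0 = lookup (app (\<Sum>j\<in>I. con (c j) * T j) \<delta> (e k)) (m k)"
    using low bnd k unfolding low_def J_def by simp
  also have "\<dots> = (\<Sum>j\<in>I. c j * lookup (app (T j) \<delta> (e k)) (m k))"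
    by (simp add: lookup_app_sum lookup_app_con)
  also have "\<dots> = c k * lookup (app (T k) \<delta> (e k)) (m k)"
  proof -
    have "(\<Sum>j\<in>I. c j * lookup (app (T j) \<delta> (e k)) (m k))
        = (\<Sum>j\<in>{k}. c j * lookup (app (T j) \<delta> (e k)) (m k))"
    proof (rule sum.mono_neutral_right)
      show "\<forall>j\<in>I - {k}. c j * lookup (app (T j) \<delta> (e k)) (m k) = 0"
        using zero by blast
    qed (use k fin in \<open>auto simp: J_def\<close>)
    then show ?thesis by simp
  qed
  also have "\<dots> = c k * (\<kappa> * q powi (2 * eta (m k) * e k))"
    using \<kappa> bnd unfolding lead_def by (simp add: \<delta>)
  finally show False
    using \<kappa> q k by (simp add: J_def)
qed

section \<open>Leading terms of the generators\<close>

locale aw_rep =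
  fixes q :: "'k::field"
  assumes q: "q \<noteq> 0"
begin

abbreviation mon :: "expo \<Rightarrow> 'k laurent" where "mon m \<equiv> single m 1"

sublocale aw_model
  "single 0 q" "single 0 (inverse q)" "mon (1, 0, 0, 0, 0)" "mon (- 1, 0, 0, 0, 0)"
  "mon (0, 1, 0, 0, 0)" "mon (0, - 1, 0, 0, 0)" "mon (0, 0, 1, 0, 0)" "mon (0, 0, - 1, 0, 0)"
  "mon (0, 0, 0, 1, 0) + mon (0, 0, 0, - 1, 0)"
  "\<lambda>i. single (0, 0, 0, 0, 1) (q powi (2 * i))"
  "\<lambda>i. single (0, 0, 0, 0, - 1) (q powi (- 2 * i))" 1
proof
  have "q powi (2 * (i + 1)) = q\<^sup>2 * q powi (2 * i)" for i
    by (simp add: distrib_left power_int_add q)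
  then show "single (0, 0, 0, 0, 1) (q powi (2 * (i + 1)))
      = (single 0 q)\<^sup>2 * (single (0, 0, 0, 0, 1) (q powi (2 * i)) :: 'k laurent)" for i
    by (simp add: power2_eq_square mult_single zero_prod_def)
  show "single (0, 0, 0, 0, 1) (q powi (2 * i)) * single (0, 0, 0, 0, - 1) (q powi (- 2 * i))
     = (1 :: 'k laurent)" for i
    by (simp add: mult_single q flip: power_int_add zero_prod_def single_one)
qed (simp_all add: mult_single q flip: zero_prod_def single_one)

lemma LeadI:
  assumes "\<kappa> \<noteq> 0"
    and "\<And>K i f w1 w2 w3 w4 w5. (\<And>w i. K < wt w i \<Longrightarrow> lookup (f i) w = 0)
      \<Longrightarrow> K + wt m e \<le> wt (w1, w2, w3, w4, w5) i
      \<Longrightarrow> lookup (app T f i) (w1, w2, w3, w4, w5)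
        = \<kappa> * q powi (2 * eta m * i) * lookup (f (i - e)) ((w1, w2, w3, w4, w5) - m)"
  shows "Lead q T m e"
  unfolding Lead_def lead_def
proof (intro exI[of _ \<kappa>] conjI allI impI assms(1))
  fix K i w and f :: "int \<Rightarrow> 'k laurent"
  assume "bnd K f" "K + wt m e \<le> wt w i"
  then show "lookup (app T f i) w
      = \<kappa> * q powi (2 * eta m * i) * lookup (f (i - e)) (w - m)"
    by (cases w) (simp only:, rule assms(2), auto dest: bndD)
qed

lemmas lead_simps = app_op distrib_right distrib_left left_diff_distrib right_diff_distrib mult.assoc lookup_add lookup_minus
  lookup_single_mult lookup_numeral_mult zero_prod_def power2_eq_square power_int_minus

text \<open>The top term is the subtracted part of the shift coefficient in \<open>oA\<close>. Each
  of A, B, C has a top term of weight 20, and the three exponents add up to that of \<Omega>, which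
  therefore leads like A B C.\<close>

lemma Lead_A: "Lead q oA (0, 1, - 1, 0, 1) (1)"
  unfolding oA_def
  by (rule LeadI[of "- inverse q"]) (use q in simp, simp add: lead_simps q)

lemma Lead_B: "Lead q oB (- 1, 0, 1, 1, 0) (- 1)"
  unfolding oB_def g_def
  by (rule LeadI[of "1"]) (use q in simp, simp add: lead_simps q, simp add: field_simps q)

lemma Lead_C: "Lead q oC (1, - 1, 0, 1, - 1) (0)"
  unfolding oC_def g_def
  by (rule LeadI[of "1"]) (use q in simp, simp add: lead_simps q)

lemma Lead_alpha: "Lead q (sc alpha) (1, 0, 0, 1, 0) (0)"
  unfolding alpha_def
  by (rule LeadI[of "1"]) (use q in simp, simp add: lead_simps q)

lemma Lead_beta: "Lead q (sc beta) (0, 1, 0, 1, 0) (0)"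
  unfolding beta_def
  by (rule LeadI[of "1"]) (use q in simp, simp add: lead_simps q)

lemma Lead_gamma: "Lead q (sc gamma) (0, 0, 1, 1, 0) (0)"
  unfolding gamma_def
  by (rule LeadI[of "1"]) (use q in simp, simp add: lead_simps q)

lemma Lead_omega: "Lead q (sc omega) (0, 0, 0, 2, 0) (0)"
  unfolding omega_def
  by (rule LeadI[of "1"]) (use q in simp, simp add: lead_simps q)

end

section \<open>Integer polynomials in \<phi>_1 and \<psi>_1\<close>

lemma unital_hom_mpol_eval: "unital_hom (mpol_eval \<sigma>)"
proof -
  define \<mu> where "\<mu> m = (\<Prod>v\<in>keys m. \<sigma> v ^ lookup m v)" for m
  have \<mu>: "\<mu> m = (\<Prod>v\<in>S. \<sigma> v ^ lookup m v)" if "finite S" "keys m \<subseteq> S" for m S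
    unfolding \<mu>_def using that by (intro prod.mono_neutral_left) (auto simp: in_keys_iff)
  have "\<mu> (m + n) = \<mu> m * \<mu> n" for m n
    using keys_add[of m n]
    by (simp add: \<mu>[of "keys m \<union> keys n"] lookup_add power_add prod.distrib)
  then have "unital_hom (ma_eval of_int \<mu>)"
    by (intro unital_hom_ma_eval unital_hom_of_int) (simp_all add: \<mu>_def mult.commute)
  moreover have "mpol_eval \<sigma> = ma_eval of_int \<mu>"
    by (simp add: fun_eq_iff mpol_eval_def ma_eval_def \<mu>_def)
  ultimately show ?thesis by simp
qed

lemma mpol_eval_mvar: "mpol_eval \<sigma> (mvar v) = \<sigma> v"
  by (simp add: mpol_eval_def mvar_def)

lemma mpol_induct [case_names const var add mult]:
  fixes p :: "('v, 'a::comm_ring_1) mpol"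
  assumes "\<And>c. P (mconst c)" "\<And>v. P (mvar v)"
    and add: "\<And>x y. P x \<Longrightarrow> P y \<Longrightarrow> P (x + y)" and mult: "\<And>x y. P x \<Longrightarrow> P y \<Longrightarrow> P (x * y)"
  shows "P p"
proof -
  have one: "P 1" using assms(1)[of 1] by (simp add: mconst_def)
  have mono: "P (single m 1)" for m
  proof (induction m rule: poly_mapping_induct_sum)
    case (single v k)
    show ?case
    proof (induction k)
      case (Suc k)
      have "single (single v (Suc k)) 1
          = mvar v * (single (single v k) 1 :: ('v, 'a) mpol)"
        by (simp add: mvar_def mult_single flip: single_add)
      then show ?case using mult[OF assms(2) Suc] by simp
    qed (use one in simp)
  next
    case (add m n)
    then show ?case using mult[OF add] by (simp add: mult_single)
  qed (use one in simp)
  show ?thesis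
  proof (induction p rule: poly_mapping_induct_sum)
    case (single m c)
    then show ?case using mult[OF assms(1)[of c] mono[of m]] by (simp add: mconst_def mult_single)
  qed (use assms(1)[of 0] add in \<open>auto simp: mconst_def\<close>)
qed

lemma mconst_eq_of_int: "mconst c = (of_int c :: ('v, int) mpol)"
  using single_of_int[of c, where ?'b = int] by (simp add: mconst_def)

lemma hom_unique:
  fixes F G :: "('v, int) mpol \<Rightarrow> 'r::ring_1"
  assumes F: "unital_hom F" and G: "unital_hom G" and var: "\<And>v. F (mvar v) = G (mvar v)"
  shows "F p = G p"
  by (induction p rule: mpol_induct)
     (simp_all add: var mconst_eq_of_int unital_hom.simps[OF F] unital_hom.simps[OF G])

lemma mpol_eval_comp: "mpol_eval \<tau> (mpol_eval \<sigma> P) = mpol_eval (\<lambda>v. mpol_eval \<tau> (\<sigma> v)) P"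
  by (rule hom_unique[OF unital_hom_comp[OF unital_hom_mpol_eval unital_hom_mpol_eval] unital_hom_mpol_eval])
     (simp add: mpol_eval_mvar)

lemma mpol_eval_cheb: "mpol_eval \<sigma> (cheb n x) = cheb n (mpol_eval \<sigma> x)"
  by (rule unital_hom.cheb[OF unital_hom_mpol_eval])

lemmas mpol_eval_simps = unital_hom.simps[OF unital_hom_mpol_eval] mpol_eval_mvar mpol_eval_cheb

lemma exhaust_3': "(j :: 3) = 0 \<or> j = 1 \<or> j = 2"
proof (cases j)
  case (of_int z)
  then have "z = 0 \<or> z = 1 \<or> z = 2" by auto
  then show ?thesis using of_int by auto
qed

lemma args_comp: "(\<lambda>v. h (args a b c w v)) = args (h a) (h b) (h c) (h w)"
  by (auto simp: fun_eq_iff args_def split: xvar.split)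

definition phi_args :: "nat \<Rightarrow> xvar \<Rightarrow> (xvar, int) mpol" where
  "phi_args m = args (phi m 0) (phi m 1) (phi m 2) (psi m)"

lemma phi_args_simps: "phi_args m XX = psi m" "phi_args m (XI j) = phi m j"
  using exhaust_3'[of j] by (auto simp: phi_args_def args_def simp del: One_nat_def)

text \<open>Replacing each variable by its T_m value sends \<phi>_n to \<phi>_(mn) and \<psi>_n to
  \<psi>_(mn), because T_m and T_n compose to T_(mn). The defining property of \<open>Phi\<close>
  and \<open>Psi\<close> for all m thus follows from the case m = 1.\<close>

definition cheb_subst :: "nat \<Rightarrow> (xvar, int) mpol \<Rightarrow> (xvar, int) mpol" where
  "cheb_subst m = mpol_eval (\<lambda>v. cheb m (mvar v))"

lemma cheb_subst_phi: "cheb_subst m (phi n j) = phi (m * n) j"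
  by (simp add: cheb_subst_def phi_def mpol_eval_simps cheb_cheb mult.commute[of n m])

lemma cheb_subst_psi: "cheb_subst m (psi n) = psi (m * n)"
  by (simp add: cheb_subst_def psi_def mpol_eval_simps cheb_cheb mult.commute[of n m] mult.assoc)

lemma mpol_torsion_free: "2 * y = 2 * z \<Longrightarrow> y = (z :: ('v, int) mpol)"
proof (rule poly_mapping_eqI)
  fix k
  assume "2 * y = 2 * z"
  then have "y + y = z + z"
    by (simp only: mult_2)
  then have "lookup (y + y) k = lookup (z + z) k"
    by (rule arg_cong)
  then show "lookup y k = lookup z k"
    unfolding lookup_add by linarith
qed

text \<open>The locale \<open>phi_psi\<close> is used with \<open>S\<close> the image of evaluation
  at \<phi>_1 and \<psi>_1; membership in \<open>S\<close> is the existence of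
  \<open>P\<close>.\<close>

lemma phi_psi_exists:
  "\<exists>P. mpol_eval (phi_args 1) P = phi n 0" "\<exists>P. mpol_eval (phi_args 1) P = psi n"
proof -
  interpret h: unital_hom "mpol_eval (phi_args 1)"
    by (rule unital_hom_mpol_eval)
  define x where "x = (mvar XX :: (xvar, int) mpol)"
  define x' where "x' j = (mvar (XI j) :: (xvar, int) mpol)" for j
  let ?S = "range (mpol_eval (phi_args 1))"
  have three: "(3::3) = 0" "(4::3) = 1" by simp_all
  have phi_eq: "phi k j = cheb k x * cheb k (x' j) + cheb k (x' (j + 1)) * cheb k (x' (j + 2))" for k j
    by (simp add: phi_def x_def x'_def)
  have psi_eq: "psi k = cheb (2 * k) x + cheb k (x' 0) ^ 2 + cheb k (x' 1) ^ 2 + cheb k (x' 2) ^ 2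
      + cheb k x * cheb k (x' 0) * cheb k (x' 1) * cheb k (x' 2)" for k
    by (simp add: psi_def x_def x'_def)
  have gen: "phi 1 j \<in> ?S" "psi 1 \<in> ?S" for j
    using rangeI[of "mpol_eval (phi_args 1)" "mvar (XI j)"] rangeI[of "mpol_eval (phi_args 1)" "mvar XX"]
    by (simp_all add: mpol_eval_mvar phi_args_simps)
  interpret phi_psi ?S x "x' 0" "x' 1" "x' 2"
  proof
    show "1 \<in> ?S" using rangeI[of "mpol_eval (phi_args 1)" 1] by (simp only: h.one)
    show "y - z \<in> ?S" "y * z \<in> ?S" if "y \<in> ?S" "z \<in> ?S" for y z
    proof -
      obtain u v where uv: "y = mpol_eval (phi_args 1) u" "z = mpol_eval (phi_args 1) v"
        using \<open>y \<in> ?S\<close> \<open>z \<in> ?S\<close> by blast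
      show "y - z \<in> ?S" "y * z \<in> ?S"
        unfolding uv h.diff[symmetric] h.mult[symmetric] by (rule rangeI)+
    qed
    show "2 * y = 2 * z \<Longrightarrow> y = z" for y z :: "(xvar, int) mpol"
      by (rule mpol_torsion_free)
    show "x * x' 0 + x' 1 * x' 2 \<in> ?S" "x * x' 1 + x' 2 * x' 0 \<in> ?S" "x * x' 2 + x' 0 * x' 1 \<in> ?S"
      using gen(1)[of 0] gen(1)[of 1] gen(1)[of 2] by (simp_all add: phi_eq cheb_rec three)
    show "x\<^sup>2 - 2 + (x' 0)\<^sup>2 + (x' 1)\<^sup>2 + (x' 2)\<^sup>2 + x * x' 0 * x' 1 * x' 2 \<in> ?S"
      using gen(2) by (simp add: psi_eq cheb_rec numeral_2_eq_2 power2_eq_square)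
  qed
  have "phi n 0 \<in> ?S"
    using f_closed[of "int n"] by (simp add: f_def phi_eq ct_of_nat)
  then show "\<exists>P. mpol_eval (phi_args 1) P = phi n 0" by auto
  have "psi n = r (int n) + 6"
  proof -
    have "ct x (2 * int n) = cheb (2 * n) x"
      using ct_of_nat[of x "2 * n"] by simp
    then show ?thesis by (simp add: r_def psi_eq ct_of_nat)
  qed
  then have "psi n \<in> ?S"
    using add[OF r_closed[of n] numeral] by simp
  then show "\<exists>P. mpol_eval (phi_args 1) P = psi n" by auto
qed

lemma Lead_cong: "Lead q T m e \<Longrightarrow> m = m' \<Longrightarrow> e = e' \<Longrightarrow> Lead q T m' e'"
  by simp

lemma three_arith: "(3 :: 3) = 0" "(4 :: 3) = 1"
  by simp_all

section \<open>Ordered monomials and algebraic independence\<close>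

context aw_rep
begin

sublocale con: unital_hom "con :: 'k \<Rightarrow> _" by (rule unital_hom_con)
sublocale sc: unital_hom "sc :: 'k laurent \<Rightarrow> _" by (rule unital_hom_sc)
sublocale single: unital_hom "single 0 :: 'k \<Rightarrow> 'k laurent" by (rule unital_hom_single)

text \<open>Opaque names: the arguments of the locale contain \<open>q powi (- 2 * i)\<close>, which simplification rewrites.\<close>

definition gA where "gA = oA"
definition gB where "gB = oB"
definition gC where "gC = oC"
definition galpha where "galpha = sc alpha"
definition gbeta where "gbeta = sc beta"
definition ggamma where "ggamma = sc gamma"
definition gomega where "gomega = sc omega"

lemmas g_defs = gA_def gB_def gC_def galpha_def gbeta_def ggamma_def gomega_def

lemma g_Lead:
  "Lead q gA (0, 1, - 1, 0, 1) 1" "Lead q gB (- 1, 0, 1, 1, 0) (- 1)" "Lead q gC (1, - 1, 0, 1, - 1) 0"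
  "Lead q galpha (1, 0, 0, 1, 0) 0" "Lead q gbeta (0, 1, 0, 1, 0) 0" "Lead q ggamma (0, 0, 1, 1, 0) 0"
  "Lead q gomega (0, 0, 0, 2, 0) 0"
  unfolding g_defs by (rule Lead_A Lead_B Lead_C Lead_alpha Lead_beta Lead_gamma Lead_omega)+

lemma g_relations:
  "gC * gB = con (q\<^sup>2) * gB * gC + con (q * (q\<^sup>2 - (inverse q)\<^sup>2)) * gA - con (q * (q - inverse q)) * galpha"
  "gC * gA = con ((inverse q)\<^sup>2) * gA * gC - con (inverse q * (q\<^sup>2 - (inverse q)\<^sup>2)) * gB
     + con (inverse q * (q - inverse q)) * gbeta"
  "gB * gA = con (q\<^sup>2) * gA * gB + con (q * (q\<^sup>2 - (inverse q)\<^sup>2)) * gC - con (q * (q - inverse q)) * ggamma"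
  using relations(2,3,1) unfolding g_defs by (simp_all only: single.simps sc.simps)

lemma g_casimir:
  "con (q\<^sup>2) + con ((inverse q)\<^sup>2) - con q * gA * gB * gC - con (q\<^sup>2) * gA\<^sup>2 - con ((inverse q)\<^sup>2) * gB\<^sup>2
   - con (q\<^sup>2) * gC\<^sup>2 + con q * gA * galpha + con (inverse q) * gB * gbeta + con q * gC * ggamma = gomega"
  using casimir unfolding g_defs by (simp only: single.simps sc.simps)

lemma sc_g: "gA * sc l = sc l * gA" "gB * sc l = sc l * gB" "gC * sc l = sc l * gC"
  "galpha * sc l = sc l * galpha" "gbeta * sc l = sc l * gbeta" "ggamma * sc l = sc l * ggamma"
  "gomega * sc l = sc l * gomega"
  unfolding g_defs by (rule sc_central sc_comm)+

type_synonym pbw = "nat \<times> nat \<times> nat \<times> nat \<times> nat \<times> nat"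

fun pbw_expo :: "pbw \<Rightarrow> expo" where
  "pbw_expo (i, j, k, r, s, t) = (int k - int j + int r, int i - int k + int s, int j - int i + int t,
     int j + int k + int r + int s + int t, int i - int k)"

fun pbw_shift :: "pbw \<Rightarrow> int" where
  "pbw_shift (i, j, k, r, s, t) = int i - int j"

text \<open>The exponents show i - j and i - k, therefore also r, s, t, and then j + k, which
  determines the rest.\<close>

lemma inj_pbw_expo: "inj_on (\<lambda>\<tau>. (pbw_expo \<tau>, pbw_shift \<tau>)) S"
proof (rule inj_onI)
  fix x y :: pbw
  assume *: "(pbw_expo x, pbw_shift x) = (pbw_expo y, pbw_shift y)"
  obtain i j k r s t where x: "x = (i, j, k, r, s, t)" by (cases x) auto
  obtain i' j' k' r' s' t' where y: "y = (i', j', k', r', s', t')" by (cases y) auto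
  show "x = y" using * unfolding x y by simp
qed

fun pbw_op :: "pbw \<Rightarrow> 'k laurent endo" where
  "pbw_op (i, j, k, r, s, t) = gA ^ i * (gB ^ j * (gC ^ k * (galpha ^ r * (gbeta ^ s * ggamma ^ t))))"

lemma Lead_pbw: "Lead q (pbw_op \<tau>) (pbw_expo \<tau>) (pbw_shift \<tau>)"
proof (cases \<tau> rule: pbw_op.cases)
  case (1 i j k r s t)
  show ?thesis
    unfolding 1 pbw_op.simps
    by (rule Lead_cong,
        (rule Lead_mult[OF q] Lead_power[OF q] g_Lead)+) simp_all
qed

definition par :: "xvar \<Rightarrow> 'k laurent" where
  "par = args (mon (1, 0, 0, 0, 0) + mon (- 1, 0, 0, 0, 0)) (mon (0, 1, 0, 0, 0) + mon (0, - 1, 0, 0, 0))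
     (mon (0, 0, 1, 0, 0) + mon (0, 0, - 1, 0, 0)) (mon (0, 0, 0, 1, 0) + mon (0, 0, 0, - 1, 0))"

lemma par_simps:
  "par XX = mon (0, 0, 0, 1, 0) + mon (0, 0, 0, - 1, 0)"
  "par (XI 0) = mon (1, 0, 0, 0, 0) + mon (- 1, 0, 0, 0, 0)"
  "par (XI 1) = mon (0, 1, 0, 0, 0) + mon (0, - 1, 0, 0, 0)"
  "par (XI 2) = mon (0, 0, 1, 0, 0) + mon (0, 0, - 1, 0, 0)"
  by (simp_all add: par_def args_def)

lemma mpol_eval_par_phi_args: "mpol_eval par (phi_args 1 v) = args alpha beta gamma omega v"
proof (cases v)
  case XX
  then show ?thesis
    by (simp add: phi_args_simps psi_def mpol_eval_simps cheb_rec numeral_2_eq_2 power2_eq_square par_simps args_def omega_def)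
next
  case (XI j)
  then show ?thesis
    using exhaust_3'[of j]
    by (auto simp: phi_args_simps phi_def mpol_eval_simps cheb_rec par_simps args_def alpha_def beta_def gamma_def three_arith
        simp del: One_nat_def)
       (simp_all add: cheb_rec ac_simps)
qed

text \<open>The monomials in \<alpha>, \<beta>, \<gamma>, \<Omega> have pairwise distinct leading
  exponents. The hypothesis on \<open>of_int\<close> lets an integer coefficient be recovered from
  its image in the field.\<close>

lemma args_independent:
  assumes "inj (of_int :: int \<Rightarrow> 'k)" and P: "mpol_eval (args alpha beta gamma omega) P = 0"
  shows "P = 0"
proof (rule ccontr)
  assume "P \<noteq> 0"
  define T :: "(xvar \<Rightarrow>\<^sub>0 nat) \<Rightarrow> 'k laurent endo" where
    "T m = sc alpha ^ lookup m (XI 0) * (sc beta ^ lookup m (XI 1)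
       * (sc gamma ^ lookup m (XI 2) * sc omega ^ lookup m XX))" for m
  define ex :: "(xvar \<Rightarrow>\<^sub>0 nat) \<Rightarrow> expo" where
    "ex m = (int (lookup m (XI 0)), int (lookup m (XI 1)), int (lookup m (XI 2)),
       int (lookup m (XI 0)) + int (lookup m (XI 1)) + int (lookup m (XI 2))
       + 2 * int (lookup m XX), 0)" for m
  have UNIV: "(UNIV :: xvar set) = {XX, XI 0, XI 1, XI 2}"
  proof -
    have "v \<in> {XX, XI 0, XI 1, XI 2}" for v
      using exhaust_3' by (cases v) auto
    then show ?thesis by blast
  qed
  have T: "sc (\<Prod>v\<in>keys m. args alpha beta gamma omega v ^ lookup m v) = T m" for m
  proof -
    have "(\<Prod>v\<in>keys m. args alpha beta gamma omega v ^ lookup m v)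
        = (\<Prod>v\<in>{XX, XI 0, XI 1, XI 2}. args alpha beta gamma omega v ^ lookup m v)"
    proof (rule prod.mono_neutral_left)
      show "keys m \<subseteq> {XX, XI 0, XI 1, XI 2}" by (simp flip: UNIV)
    qed (auto simp: in_keys_iff)
    also have "\<dots> = alpha ^ lookup m (XI 0) * (beta ^ lookup m (XI 1)
       * (gamma ^ lookup m (XI 2) * omega ^ lookup m XX))"
      by (simp add: args_def)
    finally show ?thesis by (simp add: T_def sc.mult sc.power)
  qed
  have Lead: "Lead q (T m) (ex m) 0" for m
    unfolding T_def ex_def
    by (rule Lead_cong,
        (rule Lead_mult[OF q] Lead_power[OF q] Lead_omega Lead_alpha Lead_beta Lead_gamma)+) simp_all
  have inj: "inj_on (\<lambda>m. (ex m, 0 :: int)) (keys P)"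
  proof (rule inj_onI)
    fix m n assume "(ex m, 0 :: int) = (ex n, 0)"
    then have "lookup m v = lookup n v" if "v \<in> {XX, XI 0, XI 1, XI 2}" for v
      using that by (auto simp: ex_def)
    then show "m = n"
      by (intro poly_mapping_eqI) (simp flip: UNIV)
  qed
  have "sc (mpol_eval (args alpha beta gamma omega) P)
      = (\<Sum>m\<in>keys P. con (of_int (lookup P m)) * T m)"
    by (simp add: mpol_eval_def sc.sum sc.mult T single.of_int)
  then have low: "low 0 (\<Sum>m\<in>keys P. con (of_int (lookup P m)) * T m)"
    unfolding P by (simp add: sc.zero low_zero)
  have "of_int (lookup P m) = (0 :: 'k)" if m: "m \<in> keys P" for m
    by (rule lead_independent[OF _ Lead q inj low m]) (simp_all add: ex_def)
  then have "lookup P m = 0" if "m \<in> keys P" for m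
    using that injD[OF assms(1), of _ 0] by simp
  then have "P = 0"
    by (intro poly_mapping_eqI) (auto simp: in_keys_iff)
  then show False
    using \<open>P \<noteq> 0\<close> by simp
qed

end

text \<open>Specializing the X and X_i to sums of a Laurent variable and its inverse turns \<phi>_1
  and \<psi>_1 into \<open>alpha\<close>, \<open>beta\<close>, \<open>gamma\<close>,
  \<open>omega\<close>. These do not involve q, so q = 1 over the rationals serves to give
  independence over the integers.\<close>

lemma phi_args_inj:
  assumes "mpol_eval (phi_args 1) P = mpol_eval (phi_args 1) Q"
  shows "P = Q"
proof -
  interpret aw_rep "1 :: rat" by unfold_locales simp
  have "mpol_eval par (mpol_eval (phi_args 1) (P - Q)) = 0"
    using assms by (simp add: mpol_eval_simps)
  then have "mpol_eval (args alpha beta gamma omega) (P - Q) = 0"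
    by (simp only: mpol_eval_comp mpol_eval_par_phi_args)
  from args_independent[OF _ this] show ?thesis
    by (simp add: inj_def)
qed

lemma mpol_eval_phi_args_dilate:
  assumes "mpol_eval (phi_args 1) P = R"
  shows "mpol_eval (phi_args m) P = cheb_subst m R"
proof -
  have "cheb_subst m (phi_args 1 v) = phi_args m v" for v
    by (cases v) (simp_all only: phi_args_simps cheb_subst_phi cheb_subst_psi mult_1_right)
  moreover have "cheb_subst m (mpol_eval (phi_args 1) P) = mpol_eval (\<lambda>v. cheb_subst m (phi_args 1 v)) P"
    unfolding cheb_subst_def by (rule mpol_eval_comp)
  ultimately show ?thesis
    unfolding assms by simp
qed

lemma mpol_eval_Phi: "mpol_eval (phi_args m) (Phi n) = phi (m * n) 0"
proof -
  obtain P where P: "mpol_eval (phi_args 1) P = phi n 0"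
    using phi_psi_exists(1)[of n] by blast
  have "\<forall>m. mpol_eval (phi_args m) (Phi n) = phi (m * n) 0"
    unfolding Phi_def phi_args_def[symmetric]
  proof (rule theI)
    show "\<forall>m. mpol_eval (phi_args m) P = phi (m * n) 0"
      unfolding mpol_eval_phi_args_dilate[OF P] cheb_subst_phi by simp
    fix Q assume "\<forall>m. mpol_eval (phi_args m) Q = phi (m * n) 0"
    then have "mpol_eval (phi_args 1) Q = phi (1 * n) 0" by blast
    then show "Q = P"
      unfolding mult_1_left P[symmetric] by (rule phi_args_inj)
  qed
  then show ?thesis by blast
qed

lemma mpol_eval_Psi: "mpol_eval (phi_args m) (Psi n) = psi (m * n)"
proof -
  obtain P where P: "mpol_eval (phi_args 1) P = psi n"
    using phi_psi_exists(2)[of n] by blast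
  have "\<forall>m. mpol_eval (phi_args m) (Psi n) = psi (m * n)"
    unfolding Psi_def phi_args_def[symmetric]
  proof (rule theI)
    show "\<forall>m. mpol_eval (phi_args m) P = psi (m * n)"
      unfolding mpol_eval_phi_args_dilate[OF P] cheb_subst_psi by simp
    fix Q assume "\<forall>m. mpol_eval (phi_args m) Q = psi (m * n)"
    then have "mpol_eval (phi_args 1) Q = psi (1 * n)" by blast
    then show "Q = P"
      unfolding mult_1_left P[symmetric] by (rule phi_args_inj)
  qed
  then show ?thesis by blast
qed

text \<open>Rotating the X_j maps \<phi>_m^(j) to \<phi>_m^(i+j) and fixes \<psi>_m, so rotation may
  be applied after evaluating \<open>Phi n\<close> instead of before.\<close>

lemma mpol_eval_Phi_shift: "mpol_eval (phi_args 1) (Phi_shift n i) = phi n i"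
proof -
  define rot where "rot = (\<lambda>v. case v of XX \<Rightarrow> mvar XX | XI j \<Rightarrow> (mvar (XI (i + j)) :: (xvar, int) mpol))"
  have rot: "rot XX = mvar XX" "rot (XI j) = mvar (XI (i + j))" for j
    by (simp_all add: rot_def)
  have rot_phi: "mpol_eval rot (phi m j) = phi m (i + j)" for m j
    by (simp add: phi_def mpol_eval_simps rot add.assoc)
  have rot_psi: "mpol_eval rot (psi m) = psi m" for m
  proof -
    have "i = 0 \<or> i = 1 \<or> i = 2" by (rule exhaust_3')
    then show ?thesis
    proof (elim disjE)
      assume i: "i = 1"
      show ?thesis unfolding psi_def by (simp add: mpol_eval_simps rot i three_arith)
    next
      assume i: "i = 2"
      show ?thesis unfolding psi_def by (simp add: mpol_eval_simps rot i three_arith)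
    qed (simp add: psi_def mpol_eval_simps rot)
  qed
  have "mpol_eval (phi_args 1) (Phi_shift n i) = mpol_eval (\<lambda>v. mpol_eval (phi_args 1) (rot v)) (Phi n)"
    unfolding Phi_shift_def rot_def[symmetric] by (rule mpol_eval_comp)
  also have "(\<lambda>v. mpol_eval (phi_args 1) (rot v)) = (\<lambda>v. mpol_eval rot (phi_args 1 v))"
  proof
    show "mpol_eval (phi_args 1) (rot v) = mpol_eval rot (phi_args 1 v)" for v
      by (cases v) (simp_all only: rot mpol_eval_mvar phi_args_simps rot_phi rot_psi)
  qed
  also have "mpol_eval (\<lambda>v. mpol_eval rot (phi_args 1 v)) (Phi n) = mpol_eval rot (mpol_eval (phi_args 1) (Phi n))"
    by (rule mpol_eval_comp[symmetric])
  also have "\<dots> = phi n i"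
    by (simp only: mpol_eval_Phi rot_phi mult_1_left add_0_right)
  finally show ?thesis .
qed

section \<open>A faithful representation\<close>

lemma ring_ring_of_type: "ring (ring_of_type_algebra :: 'b::ring_1 ring)"
proof -
  have "\<exists>y. x + y = 0" for x :: 'b
    using add.right_inverse by blast
  then show ?thesis
    unfolding ring_of_type_algebra_def using add.right_inverse
    by unfold_locales (auto simp: algebra_simps Units_def)
qed

lemma ring_of_type_simps [simp]:
  "carrier ring_of_type_algebra = UNIV" "x \<oplus>\<^bsub>ring_of_type_algebra\<^esub> y = x + y"
  "x \<otimes>\<^bsub>ring_of_type_algebra\<^esub> y = x * y" "\<zero>\<^bsub>ring_of_type_algebra\<^esub> = 0" "\<one>\<^bsub>ring_of_type_algebra\<^esub> = 1"
  by (simp_all add: ring_of_type_algebra_def)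

lemma a_inv_ring_of_type: "\<ominus>\<^bsub>ring_of_type_algebra\<^esub> (x :: 'b::ring_1) = - x"
proof -
  interpret R: ring "ring_of_type_algebra :: 'b ring" by (rule ring_ring_of_type)
  show ?thesis
    using R.minus_equality[of "- x" x] by simp
qed

lemma ideal_ring_of_type:
  fixes I :: "'b::ring_1 set"
  assumes "ideal I ring_of_type_algebra"
  shows "0 \<in> I" "x \<in> I \<Longrightarrow> y \<in> I \<Longrightarrow> x + y \<in> I" "x \<in> I \<Longrightarrow> z * x \<in> I" "x \<in> I \<Longrightarrow> x * z \<in> I"
    "x \<in> I \<Longrightarrow> - x \<in> I" "x \<in> I \<Longrightarrow> y \<in> I \<Longrightarrow> x - y \<in> I"
proof -
  interpret ideal I "ring_of_type_algebra :: 'b ring" by fact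
  show 0: "0 \<in> I" using additive_subgroup.zero_closed[OF is_additive_subgroup] by simp
  show add: "x \<in> I \<Longrightarrow> y \<in> I \<Longrightarrow> x + y \<in> I" for x y
    using additive_subgroup.a_closed[OF is_additive_subgroup, of x y] by simp
  show l: "x \<in> I \<Longrightarrow> z * x \<in> I" for x z using I_l_closed[of x z] by simp
  show "x \<in> I \<Longrightarrow> x * z \<in> I" using I_r_closed[of x z] by simp
  show neg: "x \<in> I \<Longrightarrow> - x \<in> I" for x using l[of x "- 1"] by simp
  show "x \<in> I \<Longrightarrow> y \<in> I \<Longrightarrow> x - y \<in> I" using add[OF _ neg, of x y] by simp
qed

lemma ideal_ring_of_typeI:
  fixes I :: "'b::ring_1 set"
  assumes "0 \<in> I" "\<And>x y. x \<in> I \<Longrightarrow> y \<in> I \<Longrightarrow> x + y \<in> I"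
    and l: "\<And>x z. x \<in> I \<Longrightarrow> z * x \<in> I" and r: "\<And>x z. x \<in> I \<Longrightarrow> x * z \<in> I"
  shows "ideal I ring_of_type_algebra"
proof -
  interpret R: ring "ring_of_type_algebra :: 'b ring" by (rule ring_ring_of_type)
  show ?thesis
  proof (rule idealI[OF ring_ring_of_type])
    have "- x \<in> I" if "x \<in> I" for x
      using l[OF that, of "- 1"] by simp
    then show "subgroup I (add_monoid (ring_of_type_algebra :: 'b ring))"
      using assms(1,2) by (intro R.add.subgroupI) (auto simp: a_inv_ring_of_type simp flip: a_inv_def)
  qed (use l r in simp_all)
qed

lemma ideal_genideal: "ideal (Idl\<^bsub>ring_of_type_algebra\<^esub> (S :: 'b::ring_1 set)) ring_of_type_algebra"
  by (rule ring.genideal_ideal[OF ring_ring_of_type]) simp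

lemma genideal_subset:
  fixes S I :: "'b::ring_1 set"
  assumes "ideal I ring_of_type_algebra" "S \<subseteq> I"
  shows "Idl\<^bsub>ring_of_type_algebra\<^esub> S \<subseteq> I"
  by (rule ring.genideal_minimal[OF ring_ring_of_type assms])

lemma genideal_self: "(x :: 'b::ring_1) \<in> S \<Longrightarrow> x \<in> Idl\<^bsub>ring_of_type_algebra\<^esub> S"
  using ring.genideal_self[OF ring_ring_of_type, of S] by auto

lemma ideal_kernel:
  assumes "unital_hom h"
  shows "ideal {x. h x = 0} ring_of_type_algebra"
proof -
  interpret unital_hom h by fact
  show ?thesis by (rule ideal_ring_of_typeI) (simp_all add: simps)
qed

lemma unital_hom_fconst: "unital_hom (fconst :: 'a::field \<Rightarrow> 'x word \<Rightarrow>\<^sub>0 'a)"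
  unfolding fconst_def[abs_def] by (rule unital_hom_single)

lemma fconst_central: "x * fconst c = fconst c * (x :: 'x word \<Rightarrow>\<^sub>0 'a::field)"
  by (induction x rule: poly_mapping_induct_sum)
     (simp_all add: fconst_def mult_single distrib_left distrib_right mult.commute)

lemma free_induct [case_names const var add mult]:
  fixes x :: "'x word \<Rightarrow>\<^sub>0 'a::field"
  assumes const: "\<And>c. P (fconst c)" and var: "\<And>v. P (fvar v)"
    and add: "\<And>x y. P x \<Longrightarrow> P y \<Longrightarrow> P (x + y)" and mult: "\<And>x y. P x \<Longrightarrow> P y \<Longrightarrow> P (x * y)"
  shows "P x"
proof -
  have word: "P (single (Word l) 1)" for l
  proof (induction l)
    case Nil
    then show ?case using const[of 1] by (simp add: fconst_def zero_word_def)
  next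
    case (Cons g l)
    then show ?case using mult[OF var[of g] Cons] by (simp add: fvar_def mult_single plus_word_def)
  qed
  show ?thesis
  proof (induction x rule: poly_mapping_induct_sum)
    case zero
    then show ?case using const[of 0] by (simp add: fconst_def)
  next
    case (single m c)
    then show ?case
      using mult[OF const[of c] word[of "letters m"]] by (simp add: fconst_def mult_single)
  qed (rule add)
qed

context aw_rep
begin

fun gen :: "aw_gen \<Rightarrow> 'k laurent endo" where
  "gen GenA = gA"
| "gen GenB = gB"
| "gen GenC = gC"
| "gen GenAlpha = galpha"
| "gen GenBeta = gbeta"
| "gen GenGamma = ggamma"

lemma gen_sc: "gen v * sc l = sc l * gen v"
  by (cases v) (simp_all add: sc_g)

definition rep :: "'k aw_free \<Rightarrow> 'k laurent endo" where
  "rep = ma_eval con (\<lambda>w. prod_list (map gen (letters w)))"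

lemma unital_hom_rep: "unital_hom rep"
  unfolding rep_def
proof (rule unital_hom_ma_eval[OF unital_hom_con])
  have "prod_list (map gen l) * con c = con c * prod_list (map gen l)" for l c
  proof (induction l)
    case (Cons v l)
    have "gen v * (con c * z) = con c * (gen v * z)" for z
      by (simp add: gen_sc flip: mult.assoc)
    then show ?case by (simp add: Cons mult.assoc)
  qed simp
  then show "prod_list (map gen (letters w)) * con c = con c * prod_list (map gen (letters w))" for w c .
qed (simp_all add: zero_word_def plus_word_def)

sublocale rep: unital_hom rep by (rule unital_hom_rep)
sublocale fconst: unital_hom "fconst :: 'k \<Rightarrow> 'k aw_free" by (rule unital_hom_fconst)

lemma rep_fvar: "rep (fvar v) = gen v"
  unfolding rep_def fvar_def ma_eval_single[OF unital_hom_con] con.one by simp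

lemma rep_fconst: "rep (fconst c) = con c"
  unfolding rep_def fconst_def ma_eval_single[OF unital_hom_con] by (simp add: zero_word_def)

lemmas rep_simps = rep.simps rep_fvar rep_fconst gen.simps

lemma rep_casimir: "rep (casimir q) = gomega"
  unfolding casimir_def Let_def by (simp only: rep_simps g_casimir)

lemma rep_relator: "x \<in> aw_relators q \<Longrightarrow> rep x = 0"
proof -
  have central: "galpha * gen v = gen v * galpha" "gbeta * gen v = gen v * gbeta" "ggamma * gen v = gen v * ggamma" for v
    unfolding galpha_def gbeta_def ggamma_def by (simp_all add: gen_sc)
  assume "x \<in> aw_relators q"
  then consider z v where "x = z * fvar v - fvar v * z" "z \<in> {fvar GenAlpha, fvar GenBeta, fvar GenGamma}"
    | "x = fvar GenC * fvar GenB - (fconst (q^2) * fvar GenB * fvar GenC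
        + fconst (q * (q^2 - inverse q^2)) * fvar GenA - fconst (q * (q - inverse q)) * fvar GenAlpha)"
    | "x = fvar GenC * fvar GenA - (fconst (inverse q^2) * fvar GenA * fvar GenC
        - fconst (inverse q * (q^2 - inverse q^2)) * fvar GenB + fconst (inverse q * (q - inverse q)) * fvar GenBeta)"
    | "x = fvar GenB * fvar GenA - (fconst (q^2) * fvar GenA * fvar GenB
        + fconst (q * (q^2 - inverse q^2)) * fvar GenC - fconst (q * (q - inverse q)) * fvar GenGamma)"
    unfolding aw_relators_def Let_def by blast
  then show "rep x = 0"
  proof cases
    case 1
    then show ?thesis by (auto simp: rep_simps central)
  next
    case 2
    show ?thesis unfolding 2 by (simp only: rep_simps g_relations) (simp only: diff_self)
  next
    case 3
    show ?thesis unfolding 3 by (simp only: rep_simps g_relations) (simp only: diff_self)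
  next
    case 4
    show ?thesis unfolding 4 by (simp only: rep_simps g_relations) (simp only: diff_self)
  qed
qed

lemma rep_aw_ideal: "x \<in> aw_ideal q \<Longrightarrow> rep x = 0"
  unfolding aw_ideal_def
  using genideal_subset[OF ideal_kernel[OF unital_hom_rep], of "aw_relators q"] rep_relator by auto

definition cong :: "'k aw_free \<Rightarrow> 'k aw_free \<Rightarrow> bool" (infix "\<approx>" 50) where
  "x \<approx> y \<longleftrightarrow> x - y \<in> aw_ideal q"

lemmas aw_ideal_closed = ideal_ring_of_type[OF ideal_genideal[of "aw_relators q"], folded aw_ideal_def]

lemma cong_refl: "x \<approx> x"
  by (simp add: cong_def aw_ideal_closed)

lemma cong_trans [trans]: "x \<approx> y \<Longrightarrow> y \<approx> z \<Longrightarrow> x \<approx> z"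
  using aw_ideal_closed(2)[of "x - y" "y - z"] by (simp add: cong_def)

lemma cong_add: "x \<approx> y \<Longrightarrow> x' \<approx> y' \<Longrightarrow> x + x' \<approx> y + y'"
  using aw_ideal_closed(2)[of "x - y" "x' - y'"] by (simp add: cong_def algebra_simps)

lemma cong_left: "x \<approx> y \<Longrightarrow> z * x \<approx> z * y"
  using aw_ideal_closed(3)[of "x - y" z] by (simp add: cong_def algebra_simps)

lemma cong_right: "x \<approx> y \<Longrightarrow> x * z \<approx> y * z"
  using aw_ideal_closed(4)[of "x - y" z] by (simp add: cong_def algebra_simps)

lemma relator_mem: "x \<in> aw_relators q \<Longrightarrow> x \<in> aw_ideal q"
  unfolding aw_ideal_def by (rule genideal_self)

lemma cong_relations:
  "fvar GenC * fvar GenB \<approx> fconst (q^2) * fvar GenB * fvar GenC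
        + fconst (q * (q^2 - inverse q^2)) * fvar GenA - fconst (q * (q - inverse q)) * fvar GenAlpha"
  "fvar GenC * fvar GenA \<approx> fconst (inverse q^2) * fvar GenA * fvar GenC
        - fconst (inverse q * (q^2 - inverse q^2)) * fvar GenB + fconst (inverse q * (q - inverse q)) * fvar GenBeta"
  "fvar GenB * fvar GenA \<approx> fconst (q^2) * fvar GenA * fvar GenB
        + fconst (q * (q^2 - inverse q^2)) * fvar GenC - fconst (q * (q - inverse q)) * fvar GenGamma"
  unfolding cong_def by (rule relator_mem, simp add: aw_relators_def Let_def)+

lemma cong_central:
  assumes "z \<in> {fvar GenAlpha, fvar GenBeta, fvar GenGamma}"
  shows "z * x \<approx> x * z"
proof (induction x rule: free_induct)
  case (const c)
  then show ?case by (simp add: fconst_central cong_refl)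
next
  case (var v)
  have "z * fvar v - fvar v * z \<in> aw_relators q"
    using assms unfolding aw_relators_def Let_def by blast
  then show ?case by (simp add: cong_def relator_mem)
next
  case (add x y)
  then show ?case using cong_add by (simp add: algebra_simps)
next
  case (mult x y)
  have "z * (x * y) \<approx> x * z * y"
    using cong_right[OF mult(1)] by (simp add: mult.assoc)
  also have "x * z * y \<approx> x * (y * z)"
    using cong_left[OF mult(2)] by (simp add: mult.assoc)
  finally show ?case by (simp add: mult.assoc)
qed

section \<open>Spanning by ordered monomials and faithfulness\<close>

fun fm :: "pbw \<Rightarrow> 'k aw_free" where
  "fm (i, j, k, r, s, t) = fvar GenA ^ i * (fvar GenB ^ j * (fvar GenC ^ k
     * (fvar GenAlpha ^ r * (fvar GenBeta ^ s * fvar GenGamma ^ t))))"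

lemma rep_fm: "rep (fm \<tau>) = pbw_op \<tau>"
  by (cases \<tau> rule: fm.cases) (simp add: rep_simps)

text \<open>A filtration by the degree in A, B, C alone. Besides the reordered product, each
  relation contains only terms with at most one of these letters, so its corrections drop in degree
  while the central letters are free.\<close>

inductive_set spn :: "nat \<Rightarrow> 'k aw_free set" for d where
  mono: "i + j + k \<le> d \<Longrightarrow> fconst c * fm (i, j, k, r, s, t) \<in> spn d"
| add: "x \<in> spn d \<Longrightarrow> y \<in> spn d \<Longrightarrow> x + y \<in> spn d"
| ideal: "x \<in> aw_ideal q \<Longrightarrow> x \<in> spn d"

lemma spn_mono1: "i + j + k \<le> d \<Longrightarrow> fm (i, j, k, r, s, t) \<in> spn d"
  using spn.mono[of i j k d 1] by (simp only: fconst.one mult_1_left)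

lemma spn_cong: "x \<in> spn d \<Longrightarrow> y \<approx> x \<Longrightarrow> y \<in> spn d"
  using spn.add[of x d "y - x"] spn.ideal[of "y - x"] by (simp add: cong_def)

lemma spn_le: "x \<in> spn d \<Longrightarrow> d \<le> e \<Longrightarrow> x \<in> spn e"
  by (induction rule: spn.induct) (auto intro: spn.intros simp del: fm.simps)

lemma spn_mult_left:
  assumes "x \<in> spn d" and "\<And>i j k r s t. i + j + k \<le> d \<Longrightarrow> v * fm (i, j, k, r, s, t) \<in> spn e"
    and scale: "\<And>c y. y \<in> spn e \<Longrightarrow> fconst c * y \<in> spn e"
  shows "v * x \<in> spn e"
  using assms(1)
proof (induction rule: spn.induct)
  case (mono i j k c r s t)
  have "fconst c * (v * fm (i, j, k, r, s, t)) \<in> spn e"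
    by (intro scale assms(2) mono)
  then show ?case
    by (simp add: fconst_central del: fm.simps flip: mult.assoc)
qed (auto simp: distrib_left intro: spn.intros aw_ideal_closed(3))

lemma spn_scale: "x \<in> spn d \<Longrightarrow> fconst c * x \<in> spn d"
proof (induction rule: spn.induct)
  case (mono i j k c' r s t)
  then show ?case
    using spn.mono[of i j k d "c * c'"] by (simp add: fconst.mult mult.assoc del: fm.simps)
qed (auto simp: distrib_left intro: spn.intros aw_ideal_closed(3))

lemma spn_uminus: "x \<in> spn d \<Longrightarrow> - x \<in> spn d"
  using spn_scale[of x d "- 1"] by (simp add: fconst.simps)

lemma spn_diff: "x \<in> spn d \<Longrightarrow> y \<in> spn d \<Longrightarrow> x - y \<in> spn d"
  using spn.add[OF _ spn_uminus, of x d y] by simp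

lemma spn_central:
  assumes "x \<in> spn d" "v \<in> {GenAlpha, GenBeta, GenGamma}"
  shows "fvar v * x \<in> spn d"
proof (rule spn_mult_left[OF assms(1)])
  fix i j k r s t :: nat assume le: "i + j + k \<le> d"
  have cent: "fvar v * y \<approx> y * fvar v" for y
    using assms(2) by (intro cong_central) auto
  have "fvar v * fm (i, j, k, r, s, t)
      = fvar v * (fvar GenA ^ i * fvar GenB ^ j * fvar GenC ^ k) * (fvar GenAlpha ^ r * (fvar GenBeta ^ s * fvar GenGamma ^ t))"
    by (simp add: mult.assoc)
  also have "\<dots> \<approx> (fvar GenA ^ i * fvar GenB ^ j * fvar GenC ^ k) * fvar v * (fvar GenAlpha ^ r * (fvar GenBeta ^ s * fvar GenGamma ^ t))"
    by (rule cong_right[OF cent])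
  also have "\<dots> \<approx> fm (i, j, k, if v = GenAlpha then Suc r else r, if v = GenBeta then Suc s else s, if v = GenGamma then Suc t else t)"
  proof -
    have B: "fvar GenBeta * (fvar GenAlpha ^ r * w) \<approx> fvar GenAlpha ^ r * (fvar GenBeta * w)" for w
      using cong_right[OF cong_central[of "fvar GenBeta" "fvar GenAlpha ^ r"], of w] by (simp add: mult.assoc)
    have C: "fvar GenGamma * (fvar GenAlpha ^ r * (fvar GenBeta ^ s * w)) \<approx> fvar GenAlpha ^ r * (fvar GenBeta ^ s * (fvar GenGamma * w))" for w
      using cong_right[OF cong_central[of "fvar GenGamma" "fvar GenAlpha ^ r * fvar GenBeta ^ s"], of w] by (simp add: mult.assoc)
    from assms(2) have "fvar v * (fvar GenAlpha ^ r * (fvar GenBeta ^ s * fvar GenGamma ^ t))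
       \<approx> fvar GenAlpha ^ (if v = GenAlpha then Suc r else r) * (fvar GenBeta ^ (if v = GenBeta then Suc s else s)
          * fvar GenGamma ^ (if v = GenGamma then Suc t else t))"
      using B[of "fvar GenBeta ^ s * fvar GenGamma ^ t"] C[of "fvar GenGamma ^ t"] by (auto simp: mult.assoc cong_refl)
    from cong_left[OF this, of "fvar GenA ^ i * fvar GenB ^ j * fvar GenC ^ k"] show ?thesis
      by (simp add: mult.assoc)
  qed
  finally have *: "fvar v * fm (i, j, k, r, s, t) \<approx> \<dots>" .
  show "fvar v * fm (i, j, k, r, s, t) \<in> spn d"
    by (rule spn_cong[OF spn_mono1[OF le] *])
qed (rule spn_scale)

lemma spn_A: "x \<in> spn d \<Longrightarrow> fvar GenA * x \<in> spn (Suc d)"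
proof (erule spn_mult_left)
  fix i j k r s t :: nat assume "i + j + k \<le> d"
  then have "fm (Suc i, j, k, r, s, t) \<in> spn (Suc d)"
    by (intro spn_mono1) simp
  then show "fvar GenA * fm (i, j, k, r, s, t) \<in> spn (Suc d)"
    by (simp add: mult.assoc)
qed (rule spn_scale)

text \<open>Moving B past A creates C, and moving C past A creates B, always in front of a shorter
  monomial; hence the simultaneous induction. In each step B comes first, since moving C past B
  leaves B in front of an element of filtration degree \<open>Suc d\<close>.\<close>

lemma spn_BC:
  "x \<in> spn d \<Longrightarrow> fvar GenB * x \<in> spn (Suc d)" "x \<in> spn d \<Longrightarrow> fvar GenC * x \<in> spn (Suc d)"
proof (induction d arbitrary: x)
  case 0
  {
    case 1
    show ?case
    proof (rule spn_mult_left[OF 1])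
      show "fvar GenB * fm (i, j, k, r, s, t) \<in> spn (Suc 0)" if "i + j + k \<le> 0" for i j k r s t
        using that spn_mono1[of 0 1 0 "Suc 0" r s t] by simp
    qed (rule spn_scale)
  next
    case 2
    show ?case
    proof (rule spn_mult_left[OF 2])
      show "fvar GenC * fm (i, j, k, r, s, t) \<in> spn (Suc 0)" if "i + j + k \<le> 0" for i j k r s t
        using that spn_mono1[of 0 0 1 "Suc 0" r s t] by simp
    qed (rule spn_scale)
  }
next
  case (Suc d)
  note IH = Suc
  have B: "fvar GenB * x \<in> spn (Suc (Suc d))" if x: "x \<in> spn (Suc d)" for x
  proof (rule spn_mult_left[OF x])
    fix i j k r s t :: nat assume le: "i + j + k \<le> Suc d"
    show "fvar GenB * fm (i, j, k, r, s, t) \<in> spn (Suc (Suc d))"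
    proof (cases i)
      case 0
      then show ?thesis
        using spn_mono1[of 0 "Suc j" k "Suc (Suc d)" r s t] le by (simp add: mult.assoc)
    next
      case (Suc i')
      define M where "M = fm (i', j, k, r, s, t)"
      have M: "M \<in> spn d" unfolding M_def using le Suc by (intro spn_mono1) simp
      have "fvar GenB * fm (i, j, k, r, s, t) = (fvar GenB * fvar GenA) * M"
        by (simp add: M_def Suc mult.assoc)
      also have "\<dots> \<approx> (fconst (q^2) * fvar GenA * fvar GenB
        + fconst (q * (q^2 - inverse q^2)) * fvar GenC - fconst (q * (q - inverse q)) * fvar GenGamma) * M"
        by (rule cong_right[OF cong_relations(3)])
      also have "\<dots> = fconst (q^2) * (fvar GenA * (fvar GenB * M)) + fconst (q * (q^2 - inverse q^2)) * (fvar GenC * M)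
        - fconst (q * (q - inverse q)) * (fvar GenGamma * M)"
        by (simp add: algebra_simps)
      finally have *: "fvar GenB * fm (i, j, k, r, s, t) \<approx> \<dots>" .
      have "fconst (q^2) * (fvar GenA * (fvar GenB * M)) + fconst (q * (q^2 - inverse q^2)) * (fvar GenC * M)
        - fconst (q * (q - inverse q)) * (fvar GenGamma * M) \<in> spn (Suc (Suc d))"
        using M by (intro spn_diff spn.add spn_scale spn_A IH(1) spn_le[OF IH(2)] spn_le[OF spn_central]) auto
      from spn_cong[OF this *] show ?thesis .
    qed
  qed (rule spn_scale)
  {
    case 1
    then show ?case by (rule B)
  next
    case 2
    show ?case
    proof (rule spn_mult_left[OF 2])
      fix i j k r s t :: nat assume le: "i + j + k \<le> Suc d"
      consider i' where "i = Suc i'" | j' where "i = 0" "j = Suc j'" | "i = 0" "j = 0"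
        by (cases i; cases j) auto
      then show "fvar GenC * fm (i, j, k, r, s, t) \<in> spn (Suc (Suc d))"
      proof cases
        case (1 i')
        define M where "M = fm (i', j, k, r, s, t)"
        have M: "M \<in> spn d" unfolding M_def using le 1 by (intro spn_mono1) simp
        have "fvar GenC * fm (i, j, k, r, s, t) = (fvar GenC * fvar GenA) * M"
          by (simp add: M_def 1 mult.assoc)
        also have "\<dots> \<approx> (fconst (inverse q^2) * fvar GenA * fvar GenC
        - fconst (inverse q * (q^2 - inverse q^2)) * fvar GenB + fconst (inverse q * (q - inverse q)) * fvar GenBeta) * M"
          by (rule cong_right[OF cong_relations(2)])
        also have "\<dots> = fconst (inverse q^2) * (fvar GenA * (fvar GenC * M)) - fconst (inverse q * (q^2 - inverse q^2)) * (fvar GenB * M)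
          + fconst (inverse q * (q - inverse q)) * (fvar GenBeta * M)"
          by (simp add: algebra_simps)
        finally have *: "fvar GenC * fm (i, j, k, r, s, t) \<approx> \<dots>" .
        have "fconst (inverse q^2) * (fvar GenA * (fvar GenC * M)) - fconst (inverse q * (q^2 - inverse q^2)) * (fvar GenB * M)
          + fconst (inverse q * (q - inverse q)) * (fvar GenBeta * M) \<in> spn (Suc (Suc d))"
          using M by (intro spn_diff spn.add spn_scale spn_A IH(2) spn_le[OF IH(1)] spn_le[OF spn_central]) auto
        from spn_cong[OF this *] show ?thesis .
      next
        case (2 j')
        define M where "M = fm (0, j', k, r, s, t)"
        have M: "M \<in> spn d" unfolding M_def using le 2 by (intro spn_mono1) simp
        have "fvar GenC * fm (i, j, k, r, s, t) = (fvar GenC * fvar GenB) * M"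
          by (simp add: M_def 2 mult.assoc)
        also have "\<dots> \<approx> (fconst (q^2) * fvar GenB * fvar GenC
        + fconst (q * (q^2 - inverse q^2)) * fvar GenA - fconst (q * (q - inverse q)) * fvar GenAlpha) * M"
          by (rule cong_right[OF cong_relations(1)])
        also have "\<dots> = fconst (q^2) * (fvar GenB * (fvar GenC * M)) + fconst (q * (q^2 - inverse q^2)) * (fvar GenA * M)
          - fconst (q * (q - inverse q)) * (fvar GenAlpha * M)"
          by (simp add: algebra_simps)
        finally have *: "fvar GenC * fm (i, j, k, r, s, t) \<approx> \<dots>" .
        have "fconst (q^2) * (fvar GenB * (fvar GenC * M)) + fconst (q * (q^2 - inverse q^2)) * (fvar GenA * M)
          - fconst (q * (q - inverse q)) * (fvar GenAlpha * M) \<in> spn (Suc (Suc d))"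
          using M by (intro spn_diff spn.add spn_scale B IH(2) spn_le[OF spn_A] spn_le[OF spn_central]) auto
        from spn_cong[OF this *] show ?thesis .
      next
        case 3
        then show ?thesis
          using spn_mono1[of 0 0 "Suc k" "Suc (Suc d)" r s t] le by (simp add: mult.assoc)
      qed
    qed (rule spn_scale)
  }
qed

lemma spn_all: "\<exists>d. x \<in> spn d"
proof (induction x rule: poly_mapping_induct_sum)
  case zero
  then show ?case using spn.ideal[of 0] aw_ideal_closed(1) by auto
next
  case (single w c)
  have "\<exists>d. single (Word l) 1 \<in> spn d" for l
  proof (induction l)
    case Nil
    then show ?case
      using spn_mono1[of 0 0 0 0 0 0 0] by (auto simp flip: zero_word_def)
  next
    case (Cons v l)
    then obtain d where d: "single (Word l) 1 \<in> spn d" by blast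
    have "fvar v * single (Word l) 1 \<in> spn (Suc d)"
    proof (cases "v \<in> {GenAlpha, GenBeta, GenGamma}")
      case True
      show ?thesis by (rule spn_le[OF spn_central[OF d True]]) simp
    next
      case False
      then show ?thesis
        using spn_A[OF d] spn_BC[OF d] by (cases v) simp_all
    qed
    then show ?case
      by (auto simp: fvar_def mult_single plus_word_def)
  qed
  then obtain d where "single (Word (letters w)) 1 \<in> spn d" by blast
  from spn_scale[OF this, of c] show ?case
    by (auto simp: fconst_def mult_single)
next
  case (add x y)
  then obtain d e where "x \<in> spn d" "y \<in> spn e" by blast
  then have "x \<in> spn (max d e)" "y \<in> spn (max d e)"
    using spn_le by (meson max.cobounded1 max.cobounded2)+
  then show ?case using spn.add by blast
qed

lemma pbw_spanning: "\<exists>c :: pbw \<Rightarrow>\<^sub>0 'k. x \<approx> ma_eval fconst fm c"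
proof -
  obtain d where "x \<in> spn d" using spn_all by blast
  then show ?thesis
  proof (induction rule: spn.induct)
    case (mono i j k c r s t)
    show ?case
      by (rule exI[of _ "single (i, j, k, r, s, t) c"])
         (simp only: ma_eval_single[OF unital_hom_fconst] cong_refl)
  next
    case (add x y)
    then obtain c d :: "pbw \<Rightarrow>\<^sub>0 'k" where "x \<approx> ma_eval fconst fm c" "y \<approx> ma_eval fconst fm d" by blast
    then show ?case
      by (intro exI[of _ "c + d"]) (simp only: ma_eval_add[OF unital_hom_fconst] cong_add)
  next
    case (ideal x)
    then show ?case
      by (intro exI[of _ 0]) (simp only: ma_eval_zero[OF unital_hom_fconst] cong_def diff_0_right)
  qed
qed

lemma rep_ma_eval_fm: "rep (ma_eval fconst fm c) = (\<Sum>\<tau>\<in>keys c. con (lookup c \<tau>) * pbw_op \<tau>)"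
  by (simp add: ma_eval_def rep.sum rep.mult rep_fconst rep_fm)

lemma rep_cong: "x \<approx> y \<Longrightarrow> rep x = rep y"
  using rep_aw_ideal[of "x - y"] by (simp add: cong_def rep.diff)

text \<open>Ordered monomials span modulo the ideal and have independent images. A vanishing image
  therefore has no nonzero coefficient in its ordered expansion.\<close>

theorem rep_eq_0_iff: "rep x = 0 \<longleftrightarrow> x \<in> aw_ideal q"
proof
  assume "rep x = 0"
  obtain c :: "pbw \<Rightarrow>\<^sub>0 'k" where c: "x \<approx> ma_eval fconst fm c"
    using pbw_spanning by blast
  then have sum: "(\<Sum>\<tau>\<in>keys c. con (lookup c \<tau>) * pbw_op \<tau>) = 0"
    using rep_cong[OF c] \<open>rep x = 0\<close> by (simp add: rep_ma_eval_fm)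
  have *: "lookup c \<tau> = 0" if "\<tau> \<in> keys c" for \<tau>
    by (rule lead_independent[OF _ Lead_pbw q inj_pbw_expo, where I = "keys c" and c = "lookup c" and N = "wt (pbw_expo \<tau>) (pbw_shift \<tau>)"])
       (simp_all add: sum low_zero that)
  have "c = 0"
  proof (rule poly_mapping_eqI)
    show "lookup c \<tau> = lookup 0 \<tau>" for \<tau>
      using *[of \<tau>] by (cases "\<tau> \<in> keys c") (simp_all add: in_keys_iff)
  qed
  with c show "x \<in> aw_ideal q"
    by (simp only: \<open>c = 0\<close> ma_eval_zero[OF unital_hom_fconst] cong_def diff_0_right)
qed (rule rep_aw_ideal)

end

section \<open>Central elements\<close>

lemma prod_list_mult_commuting:
  fixes f h :: "'v \<Rightarrow> 'r::monoid_mult"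
  assumes "\<And>v w. f v * h w = h w * f v"
  shows "prod_list (map (\<lambda>v. f v * h v) l) = prod_list (map f l) * prod_list (map h l)"
proof (induction l)
  case (Cons v l)
  have "prod_list (map f l) * h v = h v * prod_list (map f l)"
  proof (induction l)
    case (Cons w l)
    have "f w * (h v * z) = h v * (f w * z)" for z
      by (simp add: assms flip: mult.assoc)
    then show ?case by (simp add: Cons mult.assoc)
  qed simp
  then have "h v * (prod_list (map f l) * z) = prod_list (map f l) * (h v * z)" for z
    by (simp flip: mult.assoc)
  then show ?case by (simp add: Cons mult.assoc)
qed simp

lemma power_mult_commute:
  fixes x y :: "'r::monoid_mult"
  assumes "x * y = y * x"
  shows "x ^ i * y ^ j = y ^ j * x ^ i"
  by (rule power_commuting_commutes) (rule power_commuting_commutes[OF assms[symmetric], symmetric])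

locale aw_center = aw_rep q for q :: "'k::field" +
  fixes n :: nat
  assumes prim: "prim_root n ((inverse q)\<^sup>2)"
begin

sublocale root: aw_model_root
  "single 0 q" "single 0 (inverse q)" "mon (1, 0, 0, 0, 0)" "mon (- 1, 0, 0, 0, 0)"
  "mon (0, 1, 0, 0, 0)" "mon (0, - 1, 0, 0, 0)" "mon (0, 0, 1, 0, 0)" "mon (0, 0, - 1, 0, 0)"
  "mon (0, 0, 0, 1, 0) + mon (0, 0, 0, - 1, 0)"
  "\<lambda>i. single (0, 0, 0, 0, 1) (q powi (2 * i))"
  "\<lambda>i. single (0, 0, 0, 0, - 1) (q powi (- 2 * i))" 1
  "single 0" "(inverse q)\<^sup>2" n "mon (0, 0, 0, 1, 0)" "mon (0, 0, 0, - 1, 0)"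
  by unfold_locales
     (use prim unital_hom_single in \<open>simp_all add: unital_hom_def mult_single single.power flip: zero_prod_def single_one\<close>)

lemma n_pos: "n > 0"
  using prim by (simp add: prim_root_def)

lemma q_power_n: "(q ^ n)\<^sup>2 = 1" "inverse q ^ n = q ^ n"
proof -
  have "(inverse q ^ n)\<^sup>2 = 1"
    using prim by (simp add: prim_root_def mult.commute flip: power_mult)
  then have *: "inverse ((q ^ n)\<^sup>2) = 1"
    by (simp add: power_inverse)
  then have "inverse (inverse ((q ^ n)\<^sup>2)) = inverse 1"
    by (rule arg_cong)
  then show 1: "(q ^ n)\<^sup>2 = 1"
    by (simp only: inverse_inverse_eq inverse_1)
  have "inverse q ^ n = inverse q ^ n * (q ^ n)\<^sup>2"
    by (simp only: 1 mult_1_right)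
  also have "\<dots> = (inverse q * q) ^ n * q ^ n"
    by (simp only: power2_eq_square power_mult_distrib mult.assoc)
  finally show "inverse q ^ n = q ^ n"
    using q by simp
qed

definition tA where "tA = cheb n gA"
definition tB where "tB = cheb n gB"
definition tC where "tC = cheb n gC"

lemma t_fr: "tA = root.fr.oA" "tB = root.fr.oB" "tC = root.fr.oC"
  unfolding tA_def tB_def tC_def gA_def gB_def gC_def by (rule root.cheb_ops)+

lemma t_sc: "tA * sc l = sc l * tA" "tB * sc l = sc l * tB" "tC * sc l = sc l * tC"
  unfolding t_fr by (rule root.fr.sc_central)+

lemma t_g:
  "tA * gA = gA * tA" "tA * gB = gB * tA" "tA * gC = gC * tA"
  "tB * gA = gA * tB" "tB * gB = gB * tB" "tB * gC = gC * tB"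
  "tC * gA = gA * tC" "tC * gB = gB * tC" "tC * gC = gC * tC"
  unfolding t_fr gA_def gB_def gC_def by (rule root.central_ops; blast)+

lemma t_gen: "tA * gen v = gen v * tA" "tB * gen v = gen v * tB" "tC * gen v = gen v * tC"
  by (cases v; simp only: gen.simps t_g galpha_def gbeta_def ggamma_def t_sc)+

fun zgen :: "center_gen \<Rightarrow> 'k laurent endo" where
  "zgen ZTA = tA"
| "zgen ZTB = tB"
| "zgen ZTC = tC"
| "zgen ZAlpha = galpha"
| "zgen ZBeta = gbeta"
| "zgen ZGamma = ggamma"
| "zgen ZOmega = gomega"

lemma zgen_sc: "zgen z * sc l = sc l * zgen z"
  by (cases z) (simp_all only: zgen.simps t_sc sc_g)

lemma zgen_gen: "zgen z * gen v = gen v * zgen z"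
  by (cases z) (simp_all only: zgen.simps t_gen galpha_def gbeta_def ggamma_def gomega_def gen_sc)

lemma cheb_commute:
  fixes x y :: "'r::ring_1"
  assumes "x * y = y * x"
  shows "x * cheb m y = cheb m y * x"
proof (induction m rule: cheb_poly.induct)
  case (3 m)
  have "x * (y * z) = y * (x * z)" for z
    by (simp add: assms flip: mult.assoc)
  then show ?case
    by (simp only: cheb_Suc_Suc 3 right_diff_distrib left_diff_distrib mult.assoc)
qed (simp_all add: cheb_rec assms mult_2 mult_2_right)

lemma zgen_comm: "zgen z * zgen w = zgen w * zgen z"
proof -
  have "zgen z * gA = gA * zgen z" "zgen z * gB = gB * zgen z" "zgen z * gC = gC * zgen z"
    using zgen_gen[of z GenA] zgen_gen[of z GenB] zgen_gen[of z GenC] by (simp_all only: gen.simps)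
  note * = this
  have "zgen z * tA = tA * zgen z" "zgen z * tB = tB * zgen z" "zgen z * tC = tC * zgen z"
    unfolding tA_def tB_def tC_def by (rule cheb_commute, rule *)+
  then show ?thesis
    by (cases w) (simp_all only: zgen.simps galpha_def gbeta_def ggamma_def gomega_def zgen_sc)
qed

text \<open>The operators form a noncommutative ring, so monomials in the pairwise commuting
  \<open>zgen\<close> are taken as products along a fixed list.\<close>

definition zvars :: "center_gen list" where
  "zvars = [ZTA, ZTB, ZTC, ZAlpha, ZBeta, ZGamma, ZOmega]"

definition zmon :: "(center_gen \<Rightarrow>\<^sub>0 nat) \<Rightarrow> 'k laurent endo" where
  "zmon m = prod_list (map (\<lambda>v. zgen v ^ lookup m v) zvars)"

definition cev :: "(center_gen, 'k) mpol \<Rightarrow> 'k laurent endo" where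
  "cev = ma_eval con zmon"

lemma zmon_commute: "(\<And>v. x * zgen v = zgen v * x) \<Longrightarrow> x * zmon m = zmon m * x"
proof -
  assume x: "\<And>v. x * zgen v = zgen v * x"
  have p: "x * zgen v ^ k = zgen v ^ k * x" for v k
    using power_mult_commute[OF x, of 1 v k] by simp
  have "x * prod_list (map (\<lambda>v. zgen v ^ lookup m v) l)
      = prod_list (map (\<lambda>v. zgen v ^ lookup m v) l) * x" for l
  proof (induction l)
    case (Cons v l)
    have "x * (zgen v ^ k * z) = zgen v ^ k * (x * z)" for k z
      by (simp only: p flip: mult.assoc)
    then show ?case by (simp add: Cons mult.assoc)
  qed simp
  then show ?thesis by (simp only: zmon_def)
qed

lemma unital_hom_cev: "unital_hom cev"
  unfolding cev_def
proof (rule unital_hom_ma_eval[OF unital_hom_con])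
  show "zmon m * con c = con c * zmon m" for m c
    by (rule zmon_commute[symmetric]) (rule zgen_sc[symmetric])
  show "zmon 0 = 1"
    by (simp add: zmon_def zvars_def)
  show "zmon (m + m') = zmon m * zmon m'" for m m'
    unfolding zmon_def lookup_add power_add
    by (rule prod_list_mult_commuting) (rule power_mult_commute[OF zgen_comm])
qed

sublocale cev: unital_hom cev by (rule unital_hom_cev)

lemma cev_mvar: "cev (mvar v) = zgen v"
proof -
  have "zmon (single v 1) = zgen v"
    by (cases v) (simp_all add: zmon_def zvars_def lookup_single)
  then show ?thesis
    by (simp only: cev_def mvar_def ma_eval_single[OF unital_hom_con] con.one mult_1_left)
qed

lemma cev_mconst: "cev (mconst c) = con c"
proof -
  have "zmon 0 = 1" by (simp add: zmon_def zvars_def)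
  then show ?thesis
    by (simp only: cev_def mconst_def ma_eval_single[OF unital_hom_con] mult_1_right)
qed

lemma cev_single: "cev (single m c) = con c * zmon m"
  by (simp only: cev_def ma_eval_single[OF unital_hom_con])

lemma cev_gen: "cev p * gen v = gen v * cev p"
proof (induction p rule: mpol_induct)
  case (mult x y)
  have "cev x * cev y * gen v = cev x * (gen v * cev y)"
    by (simp only: mult.assoc mult(2))
  also have "\<dots> = gen v * cev x * cev y"
    by (simp only: mult(1) flip: mult.assoc)
  finally show ?case by (simp only: cev.mult mult.assoc)
qed (simp_all only: cev_mconst cev_mvar gen_sc zgen_gen cev.add distrib_left distrib_right)

definition zargs :: "xvar \<Rightarrow> (center_gen, 'k) mpol" where
  "zargs = args (mvar ZAlpha) (mvar ZBeta) (mvar ZGamma) (mvar ZOmega)"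

lemma cev_mpol_eval: "cev (mpol_eval zargs P) = sc (mpol_eval par (mpol_eval (phi_args 1) P))"
proof -
  have "(\<lambda>v. cev (zargs v)) = args galpha gbeta ggamma gomega"
    unfolding zargs_def args_comp[of cev "mvar ZAlpha" "mvar ZBeta" "mvar ZGamma" "mvar ZOmega"] cev_mvar zgen.simps ..
  also have "\<dots> = (\<lambda>v. sc (args alpha beta gamma omega v))"
    unfolding args_comp[of sc alpha beta gamma omega] galpha_def gbeta_def ggamma_def gomega_def ..
  finally have *: "cev (zargs v) = sc (args alpha beta gamma omega v)" for v
    by (rule fun_cong)
  have "cev (mpol_eval zargs P) = sc (mpol_eval (args alpha beta gamma omega) P)"
  proof (rule hom_unique)
    show "unital_hom (\<lambda>P. cev (mpol_eval zargs P))"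
      by (rule unital_hom_comp[OF unital_hom_cev unital_hom_mpol_eval])
    show "unital_hom (\<lambda>P. sc (mpol_eval (args alpha beta gamma omega) P))"
      by (rule unital_hom_comp[OF unital_hom_sc unital_hom_mpol_eval])
  qed (simp only: mpol_eval_mvar *)
  also have "mpol_eval (args alpha beta gamma omega) P = mpol_eval par (mpol_eval (phi_args 1) P)"
    unfolding mpol_eval_comp mpol_eval_par_phi_args ..
  finally show ?thesis .
qed

text \<open>As T_n(a + a^(-1)) = a^n + a^(-n), \<phi>_n and \<psi>_n at the Laurent parameters are
  the scalars of the n-th power model.\<close>

lemma par_phi:
  "mpol_eval par (phi n 0) = root.fr.alpha" "mpol_eval par (phi n 1) = root.fr.beta"
  "mpol_eval par (phi n 2) = root.fr.gamma" "mpol_eval par (psi n) = root.fr.omega"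
proof -
  have inv: "cheb n (mon m + mon (- m)) = mon m ^ n + mon (- m) ^ n" for m
    by (rule cheb_plus_inverse) (simp_all add: mult_single)
  have neg: "- (1, 0, 0, 0, 0) = ((- 1, 0, 0, 0, 0) :: expo)" "- (0, 1, 0, 0, 0) = ((0, - 1, 0, 0, 0) :: expo)"
    "- (0, 0, 1, 0, 0) = ((0, 0, - 1, 0, 0) :: expo)" "- (0, 0, 0, 1, 0) = ((0, 0, 0, - 1, 0) :: expo)"
    by simp_all
  have cheb_par: "cheb n (par XX) = mon (0, 0, 0, 1, 0) ^ n + mon (0, 0, 0, - 1, 0) ^ n"
    "cheb n (par (XI 0)) = mon (1, 0, 0, 0, 0) ^ n + mon (- 1, 0, 0, 0, 0) ^ n"
    "cheb n (par (XI 1)) = mon (0, 1, 0, 0, 0) ^ n + mon (0, - 1, 0, 0, 0) ^ n"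
    "cheb n (par (XI 2)) = mon (0, 0, 1, 0, 0) ^ n + mon (0, 0, - 1, 0, 0) ^ n"
    using inv[of "(0, 0, 0, 1, 0)"] inv[of "(1, 0, 0, 0, 0)"] inv[of "(0, 1, 0, 0, 0)"] inv[of "(0, 0, 1, 0, 0)"]
    unfolding neg par_simps by blast+
  have i: "0 + 1 = (1 :: 3)" "0 + 2 = (2 :: 3)" "1 + 1 = (2 :: 3)" "1 + 2 = (0 :: 3)" "2 + 1 = (0 :: 3)" "2 + 2 = (1 :: 3)"
    by simp_all
  show "mpol_eval par (phi n 0) = root.fr.alpha" "mpol_eval par (phi n 1) = root.fr.beta"
    "mpol_eval par (phi n 2) = root.fr.gamma"
    unfolding phi_def mpol_eval_simps i cheb_par root.fr.alpha_def root.fr.beta_def root.fr.gamma_def by (rule refl)+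
  show "mpol_eval par (psi n) = root.fr.omega"
    unfolding psi_def mpol_eval_simps cheb_double cheb_par root.fr.omega_def by (rule refl)
qed

text \<open>The Casimir identity of the n-th power model. There q^(2n) = 1 and q^(-n) = q^n, so all
  square coefficients become 1 and the constant q^2 + q^(-2) becomes 2.\<close>

lemma t_relation:
  "con (q ^ n) * sc root.fr.alpha * tA + con (q ^ n) * sc root.fr.beta * tB + con (q ^ n) * sc root.fr.gamma * tC
   = con (q ^ n) * tA * tB * tC + tA\<^sup>2 + tB\<^sup>2 + tC\<^sup>2 + sc root.fr.omega - 2"
proof -
  have s: "sc ((single 0 q ^ n)\<^sup>2) = (1 :: 'k laurent endo)"
    "sc ((single 0 (inverse q) ^ n)\<^sup>2) = (1 :: 'k laurent endo)"
    "sc (single 0 (inverse q) ^ n) = (con (q ^ n) :: 'k laurent endo)"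
    "sc (single 0 q ^ n) = (con (q ^ n) :: 'k laurent endo)"
    by (simp_all only: single.power[symmetric] q_power_n con.one)
  have "1 + 1 - con (q ^ n) * tA * tB * tC - 1 * tA\<^sup>2 - 1 * tB\<^sup>2 - 1 * tC\<^sup>2
     + con (q ^ n) * tA * sc root.fr.alpha + con (q ^ n) * tB * sc root.fr.beta + con (q ^ n) * tC * sc root.fr.gamma
     = sc root.fr.omega"
    using root.fr.casimir unfolding s t_fr[symmetric] .
  then show ?thesis
    by (simp add: mult.assoc t_sc algebra_simps)
qed

theorem cev_center_relator: "cev (center_relator q n) = 0"
proof -
  have Phi: "cev (mpol_eval zargs (Phi_shift n 0)) = sc root.fr.alpha"
    "cev (mpol_eval zargs (Phi_shift n 1)) = sc root.fr.beta"
    "cev (mpol_eval zargs (Phi_shift n 2)) = sc root.fr.gamma"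
    and Psi: "cev (mpol_eval zargs (Psi n)) = sc root.fr.omega"
    by (simp_all only: cev_mpol_eval mpol_eval_Phi_shift mpol_eval_Psi mult_1_left par_phi)
  show ?thesis
    unfolding center_relator_def Let_def zargs_def[symmetric]
    by (simp only: cev.simps cev_mvar cev_mconst Phi Psi zgen.simps t_relation) simp
qed

fun zexp :: "(center_gen \<Rightarrow>\<^sub>0 nat) \<Rightarrow> pbw" where
  "zexp m = (n * lookup m ZTA + lookup m ZOmega,
     n * lookup m ZTB + lookup m ZOmega,
     n * lookup m ZTC + lookup m ZOmega,
     lookup m ZAlpha, lookup m ZBeta, lookup m ZGamma)"

lemma Lead_t: "Lead q tA (smul (int n) (0, 1, - 1, 0, 1)) (int n * 1)"
  "Lead q tB (smul (int n) (- 1, 0, 1, 1, 0)) (int n * (- 1))"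
  "Lead q tC (smul (int n) (1, - 1, 0, 1, - 1)) (int n * 0)"
proof -
  have "Suc (n - 1) = n" using n_pos by simp
  note cheb = Lead_cheb[OF q, of _ _ _ "n - 1", unfolded this]
  show "Lead q tA (smul (int n) (0, 1, - 1, 0, 1)) (int n * 1)"
    "Lead q tB (smul (int n) (- 1, 0, 1, 1, 0)) (int n * (- 1))"
    "Lead q tC (smul (int n) (1, - 1, 0, 1, - 1)) (int n * 0)"
    unfolding tA_def tB_def tC_def by ((rule cheb, rule g_Lead), simp)+
qed

lemma Lead_zmon: "Lead q (zmon m) (pbw_expo (zexp m)) (pbw_shift (zexp m))"
  unfolding zmon_def zvars_def list.map zgen.simps prod_list.Cons prod_list.Nil mult_1_right
  by (rule Lead_cong, (rule Lead_mult[OF q] Lead_power[OF q] Lead_t g_Lead)+) (simp_all add: algebra_simps)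

end

section \<open>Leading exponents of central elements\<close>

lemma lead_diff: "lead q S \<kappa> m e \<Longrightarrow> lead q T \<kappa>' m e \<Longrightarrow> lead q (S - T) (\<kappa> - \<kappa>') m e"
  by (simp add: lead_def app_simps lookup_minus left_diff_distrib)

lemma lead_zero_low: "lead q T 0 m e \<Longrightarrow> low (wt m e) T"
  by (simp add: lead_def low_def)

context aw_center
begin

lemma q_powi_eq_1:
  assumes "q powi (2 * z) = 1"
  shows "int n dvd z"
proof -
  define w where "w = inverse ((inverse q)\<^sup>2)"
  have w: "q powi (2 * y) = w powi y" for y
    by (simp add: w_def power_inverse power_int_mult)
  have wn: "w ^ k = 1 \<longleftrightarrow> ((inverse q)\<^sup>2) ^ k = 1" for k
    unfolding w_def power_inverse by (metis inverse_1 inverse_inverse_eq)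
  have "w \<noteq> 0" using q by (simp add: w_def)
  have "w powi z = w powi (int n * (z div int n) + z mod int n)"
    by simp
  also have "\<dots> = (w ^ n) powi (z div int n) * w powi (z mod int n)"
    using \<open>w \<noteq> 0\<close> by (subst power_int_add) (simp_all add: power_int_mult)
  also have "w ^ n = 1"
    using prim wn by (simp add: prim_root_def)
  finally have 1: "w powi (z mod int n) = 1"
    using assms w by simp
  define k where "k = nat (z mod int n)"
  have k: "int k = z mod int n" "k < n"
    using n_pos by (simp_all add: k_def nat_less_iff)
  then have "w ^ k = 1"
    using 1 by (simp flip: k(1))
  then have "k = 0"
    using prim k(2) wn by (auto simp: prim_root_def)
  then show ?thesis using k(1) by (simp add: dvd_eq_mod_eq_0)
qed

text \<open>The commutator of an ordered monomial with \<open>x\<close> has its symbol scaled by the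
  difference \<open>\<chi>\<close> of the two twists from \<open>lead_mult\<close>. Top terms with
  \<open>\<chi>\<close> nonzero would have commutators that are independent modulo lower weight,
  against the vanishing of the total commutator.\<close>

lemma commutator_exponents:
  assumes fin: "finite K" and u: "u = (\<Sum>\<tau>\<in>K. con (c \<tau>) * pbw_op \<tau>)" and comm: "u * x = x * u"
    and x: "Lead q x m e" and xc: "\<And>l. x * con l = con l * x"
    and N: "\<And>\<tau>. \<tau> \<in> K \<Longrightarrow> c \<tau> \<noteq> 0 \<Longrightarrow> wt (pbw_expo \<tau>) (pbw_shift \<tau>) \<le> N"
    and \<tau>: "\<tau> \<in> K" "c \<tau> \<noteq> 0" "wt (pbw_expo \<tau>) (pbw_shift \<tau>) = N"
  shows "q powi (- 2 * eta m * pbw_shift \<tau>) = q powi (- 2 * eta (pbw_expo \<tau>) * e)"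
proof (rule ccontr)
  assume neq: "q powi (- 2 * eta m * pbw_shift \<tau>) \<noteq> q powi (- 2 * eta (pbw_expo \<tau>) * e)"
  define D where "D \<sigma> = pbw_op \<sigma> * x - x * pbw_op \<sigma>" for \<sigma>
  define \<chi> where "\<chi> \<sigma> = q powi (- 2 * eta m * pbw_shift \<sigma>) - q powi (- 2 * eta (pbw_expo \<sigma>) * e)" for \<sigma>
  have D: "\<exists>\<kappa>. \<kappa> \<noteq> 0 \<and> lead q (D \<sigma>) (\<kappa> * \<chi> \<sigma>) (pbw_expo \<sigma> + m) (pbw_shift \<sigma> + e)" for \<sigma>
  proof -
    obtain \<kappa> \<kappa>' where \<kappa>: "\<kappa> \<noteq> 0" "\<kappa>' \<noteq> 0" and 1: "lead q (pbw_op \<sigma>) \<kappa> (pbw_expo \<sigma>) (pbw_shift \<sigma>)"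
      and 2: "lead q x \<kappa>' m e"
      using Lead_pbw[of \<sigma>] x unfolding Lead_def by blast
    have "lead q (D \<sigma>) (\<kappa> * \<kappa>' * q powi (- 2 * eta m * pbw_shift \<sigma>) - \<kappa>' * \<kappa> * q powi (- 2 * eta (pbw_expo \<sigma>) * e))
        (pbw_expo \<sigma> + m) (pbw_shift \<sigma> + e)"
      unfolding D_def using lead_mult[OF q 1 2] lead_mult[OF q 2 1]
      by (intro lead_diff) (simp_all only: add.commute[of m] add.commute[of e])
    then have "lead q (D \<sigma>) (\<kappa> * \<kappa>' * \<chi> \<sigma>) (pbw_expo \<sigma> + m) (pbw_shift \<sigma> + e)"
      by (simp only: \<chi>_def right_diff_distrib mult.commute[of \<kappa>' \<kappa>])
    moreover have "\<kappa> * \<kappa>' \<noteq> 0" using \<kappa> by simp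
    ultimately show ?thesis by blast
  qed
  define K' where "K' = {\<sigma> \<in> K. c \<sigma> \<noteq> 0 \<and> wt (pbw_expo \<sigma>) (pbw_shift \<sigma>) = N \<and> \<chi> \<sigma> \<noteq> 0}"
  define M where "M = N + wt m e"
  have rest: "low M (con (c \<sigma>) * D \<sigma>)" if \<sigma>: "\<sigma> \<in> K - K'" for \<sigma>
  proof (cases "c \<sigma> = 0")
    case True
    then show ?thesis using low_zero by (simp only: True con.zero mult_zero_left)
  next
    case False
    obtain \<kappa> where \<kappa>: "lead q (D \<sigma>) (\<kappa> * \<chi> \<sigma>) (pbw_expo \<sigma> + m) (pbw_shift \<sigma> + e)"
      using D[of \<sigma>] by blast
    have "wt (pbw_expo \<sigma>) (pbw_shift \<sigma>) < N \<or> \<chi> \<sigma> = 0"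
      using N[of \<sigma>] \<sigma> False by (auto simp: K'_def order_le_less)
    then have "low M (D \<sigma>)"
    proof
      assume "wt (pbw_expo \<sigma>) (pbw_shift \<sigma>) < N"
      then show ?thesis
        by (intro lead_low[OF \<kappa>]) (simp only: wt_add M_def add_strict_right_mono)
    next
      assume "\<chi> \<sigma> = 0"
      with \<kappa> have "low (wt (pbw_expo \<sigma> + m) (pbw_shift \<sigma> + e)) (D \<sigma>)"
        by (intro lead_zero_low) simp
      then show ?thesis
        using N[of \<sigma>] \<sigma> False by (intro low_mono[of _ _ M]) (auto simp only: wt_add M_def intro!: add_right_mono)
    qed
    then show ?thesis by (rule low_con)
  qed
  have "(\<Sum>\<sigma>\<in>K. con (c \<sigma>) * D \<sigma>) = u * x - x * u"
  proof -
    have "x * (con l * z) = con l * (x * z)" for l z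
      by (simp only: xc flip: mult.assoc)
    then show ?thesis
      unfolding u D_def by (simp only: sum_distrib_left sum_distrib_right right_diff_distrib sum_subtractf mult.assoc)
  qed
  then have "(\<Sum>\<sigma>\<in>K. con (c \<sigma>) * D \<sigma>) = 0"
    by (simp only: comm diff_self)
  moreover have "(\<Sum>\<sigma>\<in>K. con (c \<sigma>) * D \<sigma>) = (\<Sum>\<sigma>\<in>K'. con (c \<sigma>) * D \<sigma>) + (\<Sum>\<sigma>\<in>K - K'. con (c \<sigma>) * D \<sigma>)"
    using fin by (subst sum.subset_diff[of K' K]) (auto simp: K'_def add.commute)
  ultimately have "(\<Sum>\<sigma>\<in>K'. con (c \<sigma>) * D \<sigma>) = 0 - (\<Sum>\<sigma>\<in>K - K'. con (c \<sigma>) * D \<sigma>)"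
    by (simp add: eq_neg_iff_add_eq_0)
  also have "low M \<dots>"
    by (intro low_diff low_zero low_sum rest)
  finally have low: "low M (\<Sum>\<sigma>\<in>K'. con (c \<sigma>) * D \<sigma>)" .
  have "c \<tau> = 0"
  proof (rule lead_independent[OF _ _ q _ low])
    show "finite K'" using fin by (simp add: K'_def)
    show "Lead q (D \<sigma>) (pbw_expo \<sigma> + m) (pbw_shift \<sigma> + e)" if "\<sigma> \<in> K'" for \<sigma>
    proof -
      obtain \<kappa> where \<kappa>: "\<kappa> \<noteq> 0" "lead q (D \<sigma>) (\<kappa> * \<chi> \<sigma>) (pbw_expo \<sigma> + m) (pbw_shift \<sigma> + e)"
        using D[of \<sigma>] by blast
      moreover have "\<kappa> * \<chi> \<sigma> \<noteq> 0" using \<kappa>(1) that by (simp add: K'_def)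
      ultimately show ?thesis unfolding Lead_def by blast
    qed
    show "inj_on (\<lambda>\<sigma>. (pbw_expo \<sigma> + m, pbw_shift \<sigma> + e)) K'"
      using inj_pbw_expo[of K'] by (simp add: inj_on_def)
    show "\<tau> \<in> K'" using \<tau> neq by (simp add: K'_def \<chi>_def)
    show "M \<le> wt (pbw_expo \<tau> + m) (pbw_shift \<tau> + e)"
      unfolding wt_add M_def \<tau>(3) by simp
  qed
  with \<tau>(2) show False by simp
qed

text \<open>The minimum of i, j, k is the exponent of \<Omega>; what is left of each is divisible by
  n and gives the exponents of the T_n.\<close>

lemma zexp_surj:
  assumes "int n dvd int i - int k" "int n dvd int k - int j"
  obtains m where "zexp m = (i, j, k, r, s, t)"
proof -
  define l where "l = min i (min j k)"
  have ij: "int n dvd int i - int j"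
    using dvd_add[OF assms] by simp
  have "int n dvd int a - int b" if "a \<in> {i, j, k}" "b \<in> {i, j, k}" for a b
    using that assms ij by (auto simp: dvd_diff_commute)
  moreover have "l \<in> {i, j, k}" by (simp add: l_def min_def)
  ultimately have l: "int n dvd int a - int l" if "a \<in> {i, j, k}" for a
    using that by blast
  have le: "l \<le> i" "l \<le> j" "l \<le> k" by (simp_all add: l_def)
  have d: "n dvd i - l" "n dvd j - l" "n dvd k - l"
    using l[of i] l[of j] l[of k] le by (simp_all flip: of_nat_diff add: int_dvd_int_iff)
  define m where "m = single ZTA ((i - l) div n) + single ZTB ((j - l) div n)
     + single ZTC ((k - l) div n) + single ZAlpha r + single ZBeta s
     + single ZGamma t + single ZOmega l"
  have "zexp m = (i, j, k, r, s, t)"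
    using d le by (simp add: m_def lookup_add lookup_single)
  then show ?thesis by (rule that)
qed

fun zfree :: "center_gen \<Rightarrow> 'k aw_free" where
  "zfree ZTA = cheb n (fvar GenA)"
| "zfree ZTB = cheb n (fvar GenB)"
| "zfree ZTC = cheb n (fvar GenC)"
| "zfree ZAlpha = fvar GenAlpha"
| "zfree ZBeta = fvar GenBeta"
| "zfree ZGamma = fvar GenGamma"
| "zfree ZOmega = casimir q"

lemma rep_zfree: "rep (zfree v) = zgen v"
  by (cases v) (simp_all only: zfree.simps zgen.simps rep.cheb rep_fvar gen.simps rep_casimir tA_def tB_def tC_def)

text \<open>An additive lift only: the \<open>zfree v\<close> need not commute in the free algebra,
  so products are respected only after \<open>rep\<close>. It keeps differences in the image of
  \<open>rep\<close>, where ordered expansions exist.\<close>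

definition zlift :: "(center_gen, 'k) mpol \<Rightarrow> 'k aw_free" where
  "zlift = ma_eval fconst (\<lambda>m. prod_list (map (\<lambda>v. zfree v ^ lookup m v) zvars))"

lemma rep_zlift: "rep (zlift p) = cev p"
proof -
  have "map (rep \<circ> (\<lambda>v. zfree v ^ lookup m v)) zvars = map (\<lambda>v. zgen v ^ lookup m v) zvars" for m
    by (simp only: o_def rep.power rep_zfree)
  then show ?thesis
    unfolding zlift_def cev_def ma_eval_def
    by (simp only: rep.sum rep.mult rep_fconst rep.prod_list map_map zmon_def)
qed

text \<open>Descent on the weight bound: every top term is cancelled by a scalar multiple of a
  monomial in the proposed generators, and the difference again commutes with A and B. Commutation
  with these two already yields both congruences, and weights of ordered monomials are nonnegative,
  so the descent ends at zero.\<close>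

theorem center_generated:
  assumes "rep x * gA = gA * rep x" "rep x * gB = gB * rep x"
  shows "\<exists>p. rep x = cev p"
proof -
  have wt_nonneg: "0 \<le> wt (pbw_expo \<tau>) (pbw_shift \<tau>)" for \<tau>
    by (cases \<tau> rule: pbw_op.cases) simp
  have "\<exists>p. rep x = cev p"
    if "low (int N) (rep x)" "rep x * gA = gA * rep x" "rep x * gB = gB * rep x" for N x
    using that
  proof (induction N arbitrary: x)
    case (0 x)
    obtain c :: "pbw \<Rightarrow>\<^sub>0 'k" where c: "x \<approx> ma_eval fconst fm c"
      using pbw_spanning by blast
    have u: "rep x = (\<Sum>\<tau>\<in>keys c. con (lookup c \<tau>) * pbw_op \<tau>)"
      using rep_cong[OF c] by (simp only: rep_ma_eval_fm)
    have "lookup c \<tau> = 0" if "\<tau> \<in> keys c" for \<tau>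
      by (rule lead_independent[OF finite_keys Lead_pbw q inj_pbw_expo 0(1)[unfolded u] that])
         (simp add: wt_nonneg)
    then have "rep x = 0"
      unfolding u by (intro sum.neutral ballI) (simp only: con.zero mult_zero_left)
    then show ?case by (intro exI[of _ 0]) (simp only: cev.zero)
  next
    case (Suc N x)
    obtain c' :: "pbw \<Rightarrow>\<^sub>0 'k" where c': "x \<approx> ma_eval fconst fm c'"
      using pbw_spanning by blast
    define K c where "K = keys c'" and "c = lookup c'"
    have fin: "finite K" by (simp add: K_def)
    have u: "rep x = (\<Sum>\<tau>\<in>K. con (c \<tau>) * pbw_op \<tau>)"
      using rep_cong[OF c'] by (simp only: rep_ma_eval_fm K_def c_def)
    have le: "wt (pbw_expo \<tau>) (pbw_shift \<tau>) \<le> int N" if "\<tau> \<in> K" "c \<tau> \<noteq> 0" for \<tau>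
    proof (rule ccontr)
      assume "\<not> ?thesis"
      then have "c \<tau> = 0"
        by (intro lead_independent[OF fin Lead_pbw q inj_pbw_expo Suc.prems(1)[unfolded u] that(1)]) simp
      with that(2) show False by simp
    qed
    define Top where "Top = {\<tau> \<in> K. c \<tau> \<noteq> 0 \<and> wt (pbw_expo \<tau>) (pbw_shift \<tau>) = int N}"
    have "\<exists>p. low (int N) (con (c \<tau>) * pbw_op \<tau> - cev p)" if "\<tau> \<in> Top" for \<tau>
    proof -
      from that have \<tau>: "\<tau> \<in> K" "c \<tau> \<noteq> 0" "wt (pbw_expo \<tau>) (pbw_shift \<tau>) = int N"
        by (simp_all add: Top_def)
      obtain i j k r s t where ijk: "\<tau> = (i, j, k, r, s, t)" by (cases \<tau>) auto
      \<comment> \<open>\<open>gA\<close> has \<eta>-degree 1 and shift 1, \<open>gB\<close> has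
        \<eta>-degree 0 and shift -1. Together their twists give q^(2(k-j)) = 1 and q^(2(i-k)) =
        1.\<close>
      have A: "q powi (- 2 * (int i - int j)) = q powi (- 2 * (int i - int k))"
        using commutator_exponents[OF fin u Suc.prems(2) g_Lead(1) sc_g(1) le \<tau>] by (simp add: ijk)
      have B: "q powi 0 = q powi (2 * (int i - int k))"
        using commutator_exponents[OF fin u Suc.prems(3) g_Lead(2) sc_g(2) le \<tau>] by (simp add: ijk)
      have "2 * (int k - int j) = - 2 * (int i - int k) - (- 2 * (int i - int j))"
        by simp
      then have "q powi (2 * (int k - int j)) = q powi (- 2 * (int i - int k) - (- 2 * (int i - int j)))"
        by (rule arg_cong)
      also have "\<dots> = q powi (- 2 * (int i - int k)) / q powi (- 2 * (int i - int j))"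
        by (rule power_int_diff) (simp add: q)
      finally have kj: "q powi (2 * (int k - int j)) = 1"
        using A q by simp
      have ik: "q powi (2 * (int i - int k)) = 1"
        using B by simp
      obtain m where m: "zexp m = \<tau>"
        unfolding ijk by (rule zexp_surj[OF q_powi_eq_1[OF ik] q_powi_eq_1[OF kj]])
      obtain \<kappa> \<kappa>' where \<kappa>: "\<kappa> \<noteq> 0" "\<kappa>' \<noteq> 0" and 1: "lead q (pbw_op \<tau>) \<kappa> (pbw_expo \<tau>) (pbw_shift \<tau>)"
        and 2: "lead q (zmon m) \<kappa>' (pbw_expo \<tau>) (pbw_shift \<tau>)"
        using Lead_pbw[of \<tau>] Lead_zmon[of m] unfolding m Lead_def by blast
      have "c \<tau> * \<kappa> - (c \<tau> * \<kappa> / \<kappa>') * \<kappa>' = 0"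
        using \<kappa> by simp
      then have "lead q (con (c \<tau>) * pbw_op \<tau> - con (c \<tau> * \<kappa> / \<kappa>') * zmon m) 0 (pbw_expo \<tau>) (pbw_shift \<tau>)"
        using lead_diff[OF lead_con[OF 1, of "c \<tau>"] lead_con[OF 2, of "c \<tau> * \<kappa> / \<kappa>'"]] by simp
      from lead_zero_low[OF this]
      have "low (int N) (con (c \<tau>) * pbw_op \<tau> - cev (single m (c \<tau> * \<kappa> / \<kappa>')))"
        unfolding \<tau>(3) cev_single .
      then show ?thesis by blast
    qed
    then obtain p where p: "\<And>\<tau>. \<tau> \<in> Top \<Longrightarrow> low (int N) (con (c \<tau>) * pbw_op \<tau> - cev (p \<tau>))"
      by metis
    define P where "P = (\<Sum>\<tau>\<in>Top. p \<tau>)"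
    have "Top \<subseteq> K" "finite Top" using fin by (auto simp: Top_def)
    have rest: "low (int N) (con (c \<tau>) * pbw_op \<tau>)" if \<tau>: "\<tau> \<in> K - Top" for \<tau>
    proof (cases "c \<tau> = 0")
      case True
      then show ?thesis using low_zero by (simp only: True con.zero mult_zero_left)
    next
      case False
      then have "wt (pbw_expo \<tau>) (pbw_shift \<tau>) < int N"
        using le[of \<tau>] \<tau> by (auto simp: Top_def order_le_less)
      then show ?thesis
        by (intro low_con Lead_low[OF Lead_pbw])
    qed
    have "rep (x - zlift P) = (\<Sum>\<tau>\<in>K - Top. con (c \<tau>) * pbw_op \<tau>) + (\<Sum>\<tau>\<in>Top. con (c \<tau>) * pbw_op \<tau> - cev (p \<tau>))"
      unfolding rep.diff rep_zlift P_def cev.sum sum_subtractf u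
      by (subst sum.subset_diff[OF \<open>Top \<subseteq> K\<close> fin]) (simp only: add_diff_eq)
    also have "low (int N) \<dots>"
      by (intro low_add low_sum rest p)
    finally have low: "low (int N) (rep (x - zlift P))" .
    have "rep (x - zlift P) * gA = gA * rep (x - zlift P)" "rep (x - zlift P) * gB = gB * rep (x - zlift P)"
      using cev_gen[of P GenA] cev_gen[of P GenB] Suc.prems(2,3)
      by (simp_all only: rep.diff rep_zlift gen.simps left_diff_distrib right_diff_distrib)
    from Suc.IH[OF low this] obtain p' where "rep (x - zlift P) = cev p'" by blast
    then have "rep x = cev (p' + P)"
      by (simp only: rep.diff rep_zlift cev.add diff_eq_eq)
    then show ?case by blast
  qed
  moreover obtain N where "low (int N) (rep x)"
  proof -
    obtain c :: "pbw \<Rightarrow>\<^sub>0 'k" where c: "x \<approx> ma_eval fconst fm c"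
      using pbw_spanning by blast
    define N where "N = Suc (nat (\<Sum>\<tau>\<in>keys c. wt (pbw_expo \<tau>) (pbw_shift \<tau>)))"
    have "low (int N) (rep x)"
      unfolding rep_cong[OF c] rep_ma_eval_fm
    proof (intro low_sum low_con Lead_low[OF Lead_pbw])
      fix \<tau> assume "\<tau> \<in> keys c"
      then have "wt (pbw_expo \<tau>) (pbw_shift \<tau>) \<le> (\<Sum>\<tau>\<in>keys c. wt (pbw_expo \<tau>) (pbw_shift \<tau>))"
        by (intro member_le_sum wt_nonneg) simp_all
      then show "wt (pbw_expo \<tau>) (pbw_shift \<tau>) < int N"
        unfolding N_def by linarith
    qed
    then show ?thesis by (rule that)
  qed
  ultimately show ?thesis using assms by blast
qed

end

section \<open>The presentation of the center\<close>

definition abc_degree :: "(center_gen \<Rightarrow>\<^sub>0 nat) \<Rightarrow> nat" where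
  "abc_degree m = lookup m ZTA + lookup m ZTB + lookup m ZTC"

text \<open>The monomials left untouched when the relation is read as a rewrite rule for the product
  of the three T_n.\<close>

definition normal_mon :: "(center_gen \<Rightarrow>\<^sub>0 nat) \<Rightarrow> bool" where
  "normal_mon m \<longleftrightarrow> lookup m ZTA = 0 \<or> lookup m ZTB = 0 \<or> lookup m ZTC = 0"

definition abc_le :: "nat \<Rightarrow> (center_gen, 'a::field) mpol \<Rightarrow> bool" where
  "abc_le k P \<longleftrightarrow> (\<forall>m\<in>keys P. abc_degree m \<le> k)"

lemma abc_le_mono: "abc_le k P \<Longrightarrow> k \<le> l \<Longrightarrow> abc_le l P"
  by (auto simp: abc_le_def)

lemma abc_le_add: "abc_le k P \<Longrightarrow> abc_le k Q \<Longrightarrow> abc_le k (P + Q)"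
  using keys_add[of P Q] by (auto simp: abc_le_def)

lemma abc_le_uminus: "abc_le k P \<Longrightarrow> abc_le k (- P)"
  by (simp add: abc_le_def in_keys_iff)

lemma abc_le_diff: "abc_le k P \<Longrightarrow> abc_le k Q \<Longrightarrow> abc_le k (P - Q)"
  using abc_le_add[OF _ abc_le_uminus, of k P Q] by simp

lemma abc_le_mult: "abc_le k P \<Longrightarrow> abc_le l Q \<Longrightarrow> abc_le (k + l) (P * Q)"
  using keys_mult[of P Q] by (fastforce simp: abc_le_def abc_degree_def lookup_add)

lemma abc_le_single: "abc_degree m \<le> k \<Longrightarrow> abc_le k (single m c)"
  by (simp add: abc_le_def)

lemma abc_le_const: "abc_le 0 (mconst c)"
  unfolding mconst_def by (rule abc_le_single) (simp add: abc_degree_def)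

lemma abc_le_var: "abc_le (if v \<in> {ZTA, ZTB, ZTC} then 1 else 0) (mvar v)"
  unfolding mvar_def by (rule abc_le_single) (cases v; simp add: abc_degree_def lookup_single)

lemma abc_le_mpol_eval: "abc_le 0 (mpol_eval (args (mvar ZAlpha) (mvar ZBeta) (mvar ZGamma) (mvar ZOmega)) P)"
proof (induction P rule: mpol_induct)
  case (const c)
  have "abc_le 0 (mconst (of_int c) :: (center_gen, 'a) mpol)" by (rule abc_le_const)
  then show ?case
    by (simp add: mconst_eq_of_int unital_hom.of_int[OF unital_hom_mpol_eval]) (simp add: mconst_def)
next
  case (var v)
  have "abc_le 0 (mvar z :: (center_gen, 'a) mpol)" if "z \<notin> {ZTA, ZTB, ZTC}" for z
    using abc_le_var[of z, where 'a = 'a] that by simp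
  then show ?case
    by (cases v) (simp_all add: mpol_eval_mvar args_def)
next
  case (add x y)
  then show ?case by (simp add: unital_hom.add[OF unital_hom_mpol_eval] abc_le_add)
next
  case (mult x y)
  then show ?case using abc_le_mult[of 0 _ 0] by (simp add: unital_hom.mult[OF unital_hom_mpol_eval])
qed

definition reducible_mod :: "(center_gen, 'a::field) mpol set \<Rightarrow> (center_gen, 'a) mpol \<Rightarrow> bool" where
  "reducible_mod I P \<longleftrightarrow> (\<exists>N. (\<forall>m\<in>keys N. normal_mon m) \<and> P - N \<in> I)"

text \<open>As q^n is invertible, the relator can be solved for the product of the three T_n. All
  other terms have degree at most 2 in them, so each replacement lowers
  \<open>abc_degree\<close>.\<close>

lemma center_reduction:
  fixes q :: "'a::field"
  assumes q: "q \<noteq> 0"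
  shows "reducible_mod (center_rel_ideal q n) P"
proof -
  let ?I = "center_rel_ideal q n"
  note I = ideal_ring_of_type[OF ideal_genideal[of "{center_relator q n}"], folded center_rel_ideal_def]
  have add: "reducible_mod ?I (P + Q)" if P: "reducible_mod ?I P" and Q: "reducible_mod ?I Q" for P Q
  proof -
    obtain M where M: "\<forall>m\<in>keys M. normal_mon m" "P - M \<in> ?I"
      using P unfolding reducible_mod_def by blast
    obtain N where N: "\<forall>m\<in>keys N. normal_mon m" "Q - N \<in> ?I"
      using Q unfolding reducible_mod_def by blast
    have "P + Q - (M + N) = (P - M) + (Q - N)" by simp
    then have "P + Q - (M + N) \<in> ?I" using I(2)[OF M(2) N(2)] by (simp only:)
    moreover have "\<forall>m\<in>keys (M + N). normal_mon m"
      using M(1) N(1) keys_add[of M N] by blast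
    ultimately show ?thesis unfolding reducible_mod_def by blast
  qed
  have scale: "reducible_mod ?I (mconst c * P)" if P: "reducible_mod ?I P" for c P
  proof -
    obtain M where M: "\<forall>m\<in>keys M. normal_mon m" "P - M \<in> ?I"
      using P unfolding reducible_mod_def by blast
    have "keys (mconst c * M) \<subseteq> keys M"
      using keys_mult[of "mconst c" M] by (auto simp: mconst_def split: if_splits)
    moreover have "mconst c * P - mconst c * M \<in> ?I"
      using I(3)[OF M(2), of "mconst c"] by (simp only: right_diff_distrib)
    ultimately show ?thesis using M(1) unfolding reducible_mod_def by blast
  qed
  have zero: "reducible_mod ?I 0"
    unfolding reducible_mod_def by (intro exI[of _ 0]) (simp add: I(1))
  have sum: "reducible_mod ?I P" if "\<And>m. m \<in> keys P \<Longrightarrow> reducible_mod ?I (single m 1)" for P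
  proof -
    have "reducible_mod ?I (\<Sum>m\<in>S. single m (lookup P m))" if "S \<subseteq> keys P" for S
      using finite_subset[OF that finite_keys] that
    proof (induction S rule: finite_induct)
      case (insert m S)
      have "single m (lookup P m) = mconst (lookup P m) * single m 1"
        by (simp add: mconst_def mult_single)
      then show ?case
        using insert by (simp add: add scale \<open>\<And>m. m \<in> keys P \<Longrightarrow> _\<close>)
    qed (simp add: zero)
    then show ?thesis
      by (subst poly_mapping_sum_single) simp
  qed
  have mono: "reducible_mod ?I (single m 1)" for m
  proof (induction "abc_degree m" arbitrary: m rule: less_induct)
    case less
    show ?case
    proof (cases "normal_mon m")
      case True
      then show ?thesis
        unfolding reducible_mod_def by (intro exI[of _ "single m 1"]) (simp add: I(1))
    next
      case False
      let ?a = "mvar ZTA :: (center_gen, 'a) mpol" and ?b = "mvar ZTB :: (center_gen, 'a) mpol"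
      let ?c = "mvar ZTC :: (center_gen, 'a) mpol" and ?s = "mconst (q ^ n) :: (center_gen, 'a) mpol"
      let ?ev = "mpol_eval (args (mvar ZAlpha) (mvar ZBeta) (mvar ZGamma) (mvar ZOmega)) :: _ \<Rightarrow> (center_gen, 'a) mpol"
      define e where "e = single ZTA 1 + single ZTB 1 + single ZTC (1 :: nat)"
      define m' where "m' = m - e"
      have m: "m = m' + e"
      proof (rule poly_mapping_eqI)
        show "lookup m v = lookup (m' + e) v" for v
          using False by (cases v) (simp_all add: m'_def e_def normal_mon_def lookup_add lookup_minus lookup_single)
      qed
      have deg: "abc_degree m = abc_degree m' + 3"
        unfolding m by (simp add: abc_degree_def lookup_add e_def lookup_single)
      define W where "W = ?s * ?ev (Phi_shift n 0) * ?a + ?s * ?ev (Phi_shift n 1) * ?b + ?s * ?ev (Phi_shift n 2) * ?c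
        - ?a * ?a - ?b * ?b - ?c * ?c - ?ev (Psi n) + mconst 2"
      have abc: "(single m 1 :: (center_gen, 'a) mpol) = single m' 1 * (?a * ?b * ?c)"
        by (simp add: m e_def mvar_def mult_single add.assoc)
      have rel: "center_relator q n = W - ?s * (?a * ?b * ?c)"
      proof -
        have "mconst 2 = (2 :: (center_gen, 'a) mpol)" by (simp add: mconst_def)
        then show ?thesis
          unfolding center_relator_def Let_def W_def by (simp add: algebra_simps power2_eq_square)
      qed
      define Q where "Q = single m' 1 * (mconst (inverse (q ^ n)) * W)"
      have unit: "mconst (inverse (q ^ n)) * ?s = 1"
        using q by (simp add: mconst_def mult_single)
      have "single m 1 - Q = (single m' 1 * mconst (- inverse (q ^ n))) * center_relator q n"
      proof -
        have neg: "mconst (- inverse (q ^ n)) = - (mconst (inverse (q ^ n)) :: (center_gen, 'a) mpol)"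
          by (simp add: mconst_def single_uminus)
        have "single m 1 = single m' 1 * ((mconst (inverse (q ^ n)) * ?s) * (?a * ?b * ?c))"
          unfolding unit abc by simp
        then show ?thesis
          unfolding Q_def rel neg by (simp add: algebra_simps)
      qed
      then have diff: "single m 1 - Q \<in> ?I"
        using I(3)[OF genideal_self[of "center_relator q n" "{center_relator q n}", folded center_rel_ideal_def]] by simp
      have var: "abc_le 1 ?a" "abc_le 1 ?b" "abc_le 1 ?c"
        using abc_le_var[of ZTA, where 'a = 'a] abc_le_var[of ZTB, where 'a = 'a]
          abc_le_var[of ZTC, where 'a = 'a] by simp_all
      have ev: "abc_le 2 (?s * ?ev P * w)" if "abc_le 1 w" for P w
        using abc_le_mult[OF abc_le_mult[OF abc_le_const abc_le_mpol_eval] that] by (rule abc_le_mono) simp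
      have sq: "abc_le 2 (w * w)" if "abc_le 1 w" for w :: "(center_gen, 'a) mpol"
        using abc_le_mult[OF that that] by (simp add: numeral_2_eq_2)
      have "abc_le 2 W"
        unfolding W_def
        by (intro abc_le_add abc_le_diff ev sq var abc_le_mono[OF abc_le_mpol_eval] abc_le_mono[OF abc_le_const]) simp_all
      then have Q: "abc_le (abc_degree m' + (0 + 2)) Q"
        unfolding Q_def by (intro abc_le_mult abc_le_single abc_le_const) simp
      have "reducible_mod ?I Q"
      proof (rule sum)
        fix k assume "k \<in> keys Q"
        with Q have "abc_degree k \<le> abc_degree m' + 2"
          by (simp add: abc_le_def)
        then show "reducible_mod ?I (single k 1)"
          using deg by (intro less) simp
      qed
      then obtain N where N: "\<forall>m\<in>keys N. normal_mon m" "Q - N \<in> ?I"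
        unfolding reducible_mod_def by blast
      have "single m 1 - N = (single m 1 - Q) + (Q - N)" by simp
      then have "single m 1 - N \<in> ?I"
        using I(2)[OF diff N(2)] by (simp only:)
      then show ?thesis
        using N(1) unfolding reducible_mod_def by blast
    qed
  qed
  show ?thesis by (rule sum) (rule mono)
qed

context aw_center
begin

text \<open>In a normal monomial one of the T_n is missing, so the exponent of \<Omega> is recovered
  as the minimum of the first three entries.\<close>

lemma zexp_inj: "inj_on zexp {m. normal_mon m}"
proof (rule inj_onI)
  fix m m' assume "m \<in> {m. normal_mon m}" "m' \<in> {m. normal_mon m}" and eq: "zexp m = zexp m'"
  have min: "lookup k ZOmega = min (n * lookup k ZTA + lookup k ZOmega)
      (min (n * lookup k ZTB + lookup k ZOmega)
           (n * lookup k ZTC + lookup k ZOmega))" if "normal_mon k" for k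
    using that by (auto simp: normal_mon_def)
  from eq have *: "n * lookup m ZTA + lookup m ZOmega = n * lookup m' ZTA + lookup m' ZOmega"
    "n * lookup m ZTB + lookup m ZOmega = n * lookup m' ZTB + lookup m' ZOmega"
    "n * lookup m ZTC + lookup m ZOmega = n * lookup m' ZTC + lookup m' ZOmega"
    "lookup m ZAlpha = lookup m' ZAlpha" "lookup m ZBeta = lookup m' ZBeta"
    "lookup m ZGamma = lookup m' ZGamma"
    by simp_all
  have \<Omega>: "lookup m ZOmega = lookup m' ZOmega"
    using \<open>m \<in> _\<close> \<open>m' \<in> _\<close> min[of m] min[of m'] unfolding *(1-3) by simp
  show "m = m'"
  proof (rule poly_mapping_eqI)
    show "lookup m v = lookup m' v" for v
      using * \<Omega> n_pos by (cases v) simp_all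
  qed
qed

text \<open>Modulo the relation every polynomial is a combination of normal monomials, whose images
  have distinct leading exponents; a normal form in the kernel is thus zero.\<close>

theorem cev_eq_0_iff: "cev p = 0 \<longleftrightarrow> p \<in> center_rel_ideal q n"
proof
  have ideal: "p \<in> center_rel_ideal q n \<Longrightarrow> cev p = 0" for p
    using genideal_subset[OF ideal_kernel[OF unital_hom_cev], of "{center_relator q n}"] cev_center_relator
    unfolding center_rel_ideal_def by blast
  show "p \<in> center_rel_ideal q n \<Longrightarrow> cev p = 0" by (rule ideal)
  assume p: "cev p = 0"
  obtain N where N: "\<forall>m\<in>keys N. normal_mon m" "p - N \<in> center_rel_ideal q n"
    using center_reduction[OF q, of n p] unfolding reducible_mod_def by blast
  have "cev N = 0"
    using ideal[OF N(2)] p by (simp only: cev.diff diff_0 neg_equal_0_iff_equal)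
  then have sum: "(\<Sum>m\<in>keys N. con (lookup N m) * zmon m) = 0"
    by (simp only: cev_def ma_eval_def)
  have inj: "inj_on (\<lambda>m. (pbw_expo (zexp m), pbw_shift (zexp m))) (keys N)"
  proof (rule inj_onI)
    fix m m' assume m: "m \<in> keys N" "m' \<in> keys N"
      and "(pbw_expo (zexp m), pbw_shift (zexp m)) = (pbw_expo (zexp m'), pbw_shift (zexp m'))"
    then have "zexp m = zexp m'"
      using inj_onD[OF inj_pbw_expo[of UNIV], of "zexp m" "zexp m'"] by simp
    then show "m = m'"
      using inj_onD[OF zexp_inj] N(1) m by blast
  qed
  have *: "lookup N m = 0" if "m \<in> keys N" for m
  proof (rule lead_independent[OF finite_keys Lead_zmon q inj _ that order_refl])
    show "low (wt (pbw_expo (zexp m)) (pbw_shift (zexp m))) (\<Sum>m\<in>keys N. con (lookup N m) * zmon m)"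
      unfolding sum by (rule low_zero)
  qed
  have "N = 0"
  proof (rule poly_mapping_eqI)
    show "lookup N m = lookup 0 m" for m
      using *[of m] by (cases "m \<in> keys N") (simp_all add: in_keys_iff)
  qed
  with N(2) show "p \<in> center_rel_ideal q n" by simp
qed

section \<open>The isomorphism onto the center\<close>

lemma aw_class_hom: "aw_class q \<in> ring_hom ring_of_type_algebra (AW q)"
  unfolding aw_class_def[abs_def] AW_def aw_ideal_def
  by (rule ideal.rcos_ring_hom[OF ideal_genideal])

lemma ring_AW: "ring (AW q)"
  unfolding AW_def aw_ideal_def by (rule ideal.quotient_is_ring[OF ideal_genideal])

lemma aw_class_eq_iff: "aw_class q x = aw_class q y \<longleftrightarrow> rep x = rep y"
proof -
  interpret ideal "aw_ideal q" "ring_of_type_algebra :: 'k aw_free ring"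
    unfolding aw_ideal_def by (rule ideal_genideal)
  have "aw_class q x = aw_class q y \<longleftrightarrow> x - y \<in> aw_ideal q"
    unfolding aw_class_def
    using quotient_eq_iff_same_a_r_cos[OF ideal_axioms, of x y]
    by (simp add: a_minus_def a_inv_ring_of_type)
  also have "\<dots> \<longleftrightarrow> rep x = rep y"
    using rep_eq_0_iff[of "x - y"] by (simp add: rep.diff)
  finally show ?thesis .
qed

lemma carrier_AW: "carrier (AW q) = range (aw_class q)"
  unfolding AW_def FactRing_def aw_class_def[abs_def] by (auto simp: A_RCOSETS_def')

lemma aw_class_mult: "aw_class q x \<otimes>\<^bsub>AW q\<^esub> aw_class q y = aw_class q (x * y)"
  using ring_hom_mult[OF aw_class_hom, of x y] by simp

lemma aw_class_central_iff:
  "aw_class q x \<in> carrier (center_ring (AW q)) \<longleftrightarrow> (\<exists>p. rep x = cev p)"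
proof -
  have "aw_class q x \<in> carrier (center_ring (AW q)) \<longleftrightarrow> (\<forall>y. rep x * rep y = rep y * rep x)"
    by (simp add: center_ring_def carrier_AW aw_class_mult aw_class_eq_iff rep.mult)
  also have "\<dots> \<longleftrightarrow> (\<exists>p. rep x = cev p)"
  proof
    assume *: "\<forall>y. rep x * rep y = rep y * rep x"
    show "\<exists>p. rep x = cev p"
      using *[rule_format, of "fvar GenA"] *[rule_format, of "fvar GenB"]
      by (intro center_generated) (simp_all only: rep_fvar gen.simps)
  next
    assume "\<exists>p. rep x = cev p"
    then obtain p where p: "rep x = cev p" by blast
    show "\<forall>y. rep x * rep y = rep y * rep x"
    proof
      fix y
      show "rep x * rep y = rep y * rep x"
        unfolding p
      proof (induction y rule: free_induct)
        case (const c)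
        show ?case
          unfolding rep_fconst cev_mconst[symmetric] cev.mult[symmetric] by (simp only: mult.commute)
      next
        case (var v)
        show ?case by (simp only: rep_fvar cev_gen)
      next
        case (add y z)
        then show ?case by (simp only: rep.add distrib_left distrib_right)
      next
        case (mult y z)
        have "cev p * (rep y * rep z) = rep y * (cev p * rep z)"
          by (simp only: mult(1) flip: mult.assoc)
        then show ?case by (simp only: rep.mult mult(2) mult.assoc)
      qed
    qed
  qed
  finally show ?thesis .
qed

text \<open>The map to which the first isomorphism theorem is applied: its kernel is the relation
  ideal and its image the center. Although \<open>zlift\<close> is only additive, passing to classes
  makes it a ring homomorphism.\<close>

definition present :: "(center_gen, 'k) mpol \<Rightarrow> 'k aw_free set" where
  "present p = aw_class q (zlift p)"

lemma present_eq_iff: "present p = aw_class q x \<longleftrightarrow> cev p = rep x"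
  by (simp add: present_def aw_class_eq_iff rep_zlift)

lemma present_hom: "ring_hom_ring ring_of_type_algebra (AW q) present"
proof (rule ring_hom_ringI)
  show "ring (ring_of_type_algebra :: (center_gen, 'k) mpol ring)"
    by (rule ring_ring_of_type)
  show "ring (AW q)" by (rule ring_AW)
  show "present p \<in> carrier (AW q)" for p
    by (simp add: present_def carrier_AW)
  show "present (p \<otimes>\<^bsub>ring_of_type_algebra\<^esub> p') = present p \<otimes>\<^bsub>AW q\<^esub> present p'" for p p'
    by (simp add: present_def aw_class_mult aw_class_eq_iff rep_zlift rep.mult cev.mult)
  show "present (p \<oplus>\<^bsub>ring_of_type_algebra\<^esub> p') = present p \<oplus>\<^bsub>AW q\<^esub> present p'" for p p'
  proof -
    have "present p \<oplus>\<^bsub>AW q\<^esub> present p' = aw_class q (zlift p + zlift p')"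
      unfolding present_def using ring_hom_add[OF aw_class_hom, of "zlift p" "zlift p'"] by simp
    then show ?thesis
      by (simp add: present_eq_iff rep_zlift rep.add cev.add)
  qed
  have "\<one>\<^bsub>AW q\<^esub> = aw_class q 1"
    using ring_hom_one[OF aw_class_hom] by simp
  then show "present \<one>\<^bsub>ring_of_type_algebra\<^esub> = \<one>\<^bsub>AW q\<^esub>"
    by (simp add: present_eq_iff rep.one cev.one)
qed

lemma present_kernel: "a_kernel ring_of_type_algebra (AW q) present = center_rel_ideal q n"
proof -
  interpret pr: ring_hom_ring ring_of_type_algebra "AW q" present by (rule present_hom)
  have "\<zero>\<^bsub>AW q\<^esub> = present 0"
    using pr.hom_zero[symmetric] by (simp only: ring_of_type_simps)
  also have "\<dots> = aw_class q 0"
    by (simp only: present_eq_iff rep.zero cev.zero)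
  finally show ?thesis
    unfolding a_kernel_def' by (simp only: present_eq_iff rep.zero cev_eq_0_iff ring_of_type_simps) blast
qed

lemma present_image: "AW q\<lparr>carrier := present ` carrier ring_of_type_algebra\<rparr> = center_ring (AW q)"
proof -
  have "range present = carrier (center_ring (AW q))"
  proof
    show "range present \<subseteq> carrier (center_ring (AW q))"
      unfolding present_def aw_class_central_iff image_subset_iff rep_zlift by blast
    show "carrier (center_ring (AW q)) \<subseteq> range present"
    proof
      fix z assume z: "z \<in> carrier (center_ring (AW q))"
      then have "z \<in> carrier (AW q)" by (simp add: center_ring_def)
      then obtain x where x: "z = aw_class q x" by (auto simp: carrier_AW)
      then obtain p where "rep x = cev p" using z aw_class_central_iff by blast
      then have "present p = z" by (simp add: x present_eq_iff)
      then show "z \<in> range present" by blast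
    qed
  qed
  then show ?thesis by (simp add: center_ring_def)
qed

theorem center_presentation:
  "\<exists>f \<in> ring_iso (center_pres q n) (center_ring (AW q)). \<forall>p. f (center_pres_class q n p) = present p"
proof -
  interpret pr: ring_hom_ring ring_of_type_algebra "AW q" present by (rule present_hom)
  let ?f = "\<lambda>U. the_elem (present ` U)"
  have "?f \<in> ring_iso (center_pres q n) (center_ring (AW q))"
    using pr.FactRing_iso_set_aux unfolding present_kernel present_image center_pres_def .
  moreover have "?f (center_pres_class q n p) = present p" for p
    unfolding center_pres_class_def present_kernel[symmetric]
    by (rule pr.the_elem_simp) (simp only: ring_of_type_simps UNIV_I)
  ultimately show ?thesis
    by (intro bexI[of _ ?f] allI)
qed

end

text \<open>The order of q^(-2) is d / gcd(d, 2). For odd d an exponent 2k between d and 2d is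
  reduced by d before minimality of d is used.\<close>

lemma prim_root_dbar:
  fixes q :: "'a::field"
  assumes "primitive_root_of_unity d q"
  shows "q \<noteq> 0" "prim_root (dbar d) ((inverse q)\<^sup>2)"
proof -
  have d: "d \<ge> 1" "q ^ d = 1" and prim: "\<And>k. 0 < k \<Longrightarrow> k < d \<Longrightarrow> q ^ k \<noteq> 1"
    using assms by (auto simp: primitive_root_of_unity_def)
  show "q \<noteq> 0" using d by (auto simp: power_0_left)
  have eq: "((inverse q)\<^sup>2) ^ k = 1 \<longleftrightarrow> q ^ (2 * k) = 1" for k
    by (simp add: power_inverse flip: power_mult)
  show "prim_root (dbar d) ((inverse q)\<^sup>2)"
    unfolding prim_root_def eq
  proof (intro conjI allI impI)
    show "dbar d > 0" using d(1) by (auto simp: dbar_def)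
    show "q ^ (2 * dbar d) = 1"
      using d(2) by (auto simp: dbar_def power_mult mult.commute[of 2])
    fix k assume k: "0 < k \<and> k < dbar d"
    show "q ^ (2 * k) \<noteq> 1"
    proof (cases "even d")
      case True
      then show ?thesis using k by (intro prim) (auto simp: dbar_def)
    next
      case False
      show ?thesis
      proof
        assume 1: "q ^ (2 * k) = 1"
        have "k < d" using k False by (simp add: dbar_def)
        have "2 * k \<noteq> d" using False by auto
        then consider "2 * k < d" | "d < 2 * k" by linarith
        then show False
        proof cases
          case 1
          then show False using prim[of "2 * k"] k \<open>q ^ (2 * k) = 1\<close> by simp
        next
          case 2
          then have "q ^ (2 * k) = q ^ d * q ^ (2 * k - d)"
            by (simp flip: power_add)
          then have "q ^ (2 * k - d) = 1" using 1 d by simp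
          then show False using prim[of "2 * k - d"] 2 \<open>k < d\<close> by simp
        qed
      qed
    qed
  qed
qed

theorem theorem4p13:
  fixes q :: "'a::field" and d :: nat
  assumes "d \<ge> 1" and "primitive_root_of_unity d q"
  shows "\<exists>f \<in> ring_iso (center_pres q (dbar d)) (center_ring (AW q)).
      (\<forall>c. f (center_pres_class q (dbar d) (mconst c)) = aw_class q (fconst c))
    \<and> f (center_pres_class q (dbar d) (mvar ZTA)) = aw_class q (cheb (dbar d) (fvar GenA))
    \<and> f (center_pres_class q (dbar d) (mvar ZTB)) = aw_class q (cheb (dbar d) (fvar GenB))
    \<and> f (center_pres_class q (dbar d) (mvar ZTC)) = aw_class q (cheb (dbar d) (fvar GenC))
    \<and> f (center_pres_class q (dbar d) (mvar ZAlpha)) = aw_class q (fvar GenAlpha)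
    \<and> f (center_pres_class q (dbar d) (mvar ZBeta)) = aw_class q (fvar GenBeta)
    \<and> f (center_pres_class q (dbar d) (mvar ZGamma)) = aw_class q (fvar GenGamma)
    \<and> f (center_pres_class q (dbar d) (mvar ZOmega)) = aw_class q (casimir q)"
proof -
  interpret aw_center q "dbar d"
    using prim_root_dbar[OF assms(2)] by unfold_locales
  obtain f where f: "f \<in> ring_iso (center_pres q (dbar d)) (center_ring (AW q))"
    and present: "\<And>p. f (center_pres_class q (dbar d) p) = present p"
    using center_presentation by blast
  have "present (mvar v) = aw_class q (zfree v)" for v
    by (simp only: present_eq_iff cev_mvar rep_zfree)
  note var = this[of ZTA] this[of ZTB] this[of ZTC] this[of ZAlpha] this[of ZBeta] this[of ZGamma] this[of ZOmega]
  have const: "present (mconst c) = aw_class q (fconst c)" for c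
    by (simp only: present_eq_iff cev_mconst rep_fconst)
  show ?thesis
    by (intro bexI[OF _ f] conjI allI) (simp_all only: present var const zfree.simps)
qed

end
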